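(* Let $r>1$, let $(W_n,f_n)_{n\in\mathbb N}$ be a sequence in $\mathcal{WS}_r$ and let $(W,f)\in\mathcal{WS}_r$. Then, as $n\to\infty$, $$\delta_\square((W_n,f_n),(W,f))\to0\quad\Longleftrightarrow\quad t((F,\boldsymbol d),(W_n,f_n))\to t((F,\boldsymbol d),(W,f))\ \text{ for all simple graphs } F \text{ and all } \boldsymbol d\in\mathbb N_0^{v(F)}.$$
   Context: $\lambda^m$ is $m$-dimensional Lebesgue measure. A kernel is a bounded symmetric measurable function $W:[0,1]^2\to\mathbb R$; a graphon is a kernel with values in $[0,1]$. For $r>0$, $\mathcal{WS}_r$ is the set of graphon-signals: pairs $(W,f)$ with $W$ a graphon and $f\in L^\infty[0,1]$, $\|f\|_\infty\le r$. Cut norms: $\|W\|_\square=\sup_{S,T\subseteq[0,1]}\left|\int_{S\times T}W\,d\lambda^2\right|$ for kernels and $\|f\|_\square=\sup_{S\subseteq[0,1]}\left|\int_S f\,d\lambda\right|$ for signals ($S,T$ measurable). Let $S_{[0,1]}$ be the set of Lebesgue-measure preserving maps $\varphi:[0,1]\to[0,1]$ that are bijective almost everywhere; $W^\varphi(x,y)=W(\varphi(x),\varphi(y))$, $f^\varphi(x)=f(\varphi(x))$. Cut distance: $\delta_\square((W,f),(V,g))=\inf_{\varphi\in S_{[0,1]}}\left(\|W-V^\varphi\|_\square+\|f-g^\varphi\|_\square\right)$. A simple graph is a finite undirected graph without loops or parallel edges; $v(F)$ is its number of vertices. For $V(F)=[k]$ and $\boldsymbol d\in\mathbb N_0^k$,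 the signal-weighted homomorphism density is $$t((F,\boldsymbol d),(W,f))=\int_{[0,1]^k}\Big(\prod_{i\in V(F)}f(x_i)^{d_i}\Big)\Big(\prod_{\{i,j\}\in E(F)}W(x_i,x_j)\Big)d\lambda^k(\boldsymbol x).$$ *)

theory Defs
  imports "HOL-Probability.Probability"
begin

abbreviation unit_leb :: "real measure" where
  "unit_leb \<equiv> lebesgue_on {0..1}"

text \<open>Kernels and signals are functions on \<^typ>\<open>real \<times> real\<close> and \<^typ>\<open>real\<close>; their values
  outside the unit square and the unit interval play no role.
  Measurability is with respect to (two-dimensional) Lebesgue measure.\<close>

definition kernel :: "(real \<times> real \<Rightarrow> real) \<Rightarrow> bool" where
  "kernel W \<longleftrightarrow>
     W \<in> borel_measurable (lebesgue_on ({0..1} \<times> {0..1})) \<and>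
     bounded (W ` ({0..1} \<times> {0..1})) \<and>
     (\<forall>x\<in>{0..1}. \<forall>y\<in>{0..1}. W (x, y) = W (y, x))"

definition graphon :: "(real \<times> real \<Rightarrow> real) \<Rightarrow> bool" where
  "graphon W \<longleftrightarrow> kernel W \<and> (\<forall>z\<in>{0..1} \<times> {0..1}. 0 \<le> W z \<and> W z \<le> 1)"

text \<open>Elements of \<open>L\<^sup>\<infinity>[0,1]\<close> are given by representatives, so the bound is on the
  essential supremum and not pointwise.\<close>

definition graphon_signals :: "real \<Rightarrow> ((real \<times> real \<Rightarrow> real) \<times> (real \<Rightarrow> real)) set" where
  "graphon_signals r =
     {(W, f). graphon W \<and> f \<in> borel_measurable unit_leb \<and>
              esssup unit_leb (\<lambda>x. ereal \<bar>f x\<bar>) \<le> ereal r}"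

definition kernel_cut_norm :: "(real \<times> real \<Rightarrow> real) \<Rightarrow> real" where
  "kernel_cut_norm W =
     (SUP (S, T) \<in> sets unit_leb \<times> sets unit_leb. \<bar>LINT z:S \<times> T|lebesgue. W z\<bar>)"

definition signal_cut_norm :: "(real \<Rightarrow> real) \<Rightarrow> real" where
  "signal_cut_norm f = (SUP S \<in> sets unit_leb. \<bar>LINT x:S|lebesgue. f x\<bar>)"

definition ae_bij_measure_preserving :: "(real \<Rightarrow> real) set" where
  "ae_bij_measure_preserving =
     {\<phi>. \<phi> \<in> measurable unit_leb unit_leb \<and>
         distr unit_leb unit_leb \<phi> = unit_leb \<and>
         (\<exists>M \<in> null_sets unit_leb. \<exists>N \<in> null_sets unit_leb.
            bij_betw \<phi> ({0..1} - M) ({0..1} - N))}"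

definition cut_distance ::
    "(real \<times> real \<Rightarrow> real) \<times> (real \<Rightarrow> real) \<Rightarrow> (real \<times> real \<Rightarrow> real) \<times> (real \<Rightarrow> real) \<Rightarrow> real" where
  "cut_distance = (\<lambda>(W, f) (V, g).
     INF \<phi> \<in> ae_bij_measure_preserving.
       kernel_cut_norm (\<lambda>(x, y). W (x, y) - V (\<phi> x, \<phi> y)) +
       signal_cut_norm (\<lambda>x. f x - g (\<phi> x)))"

text \<open>A simple graph on the vertex set \<open>{1..k}\<close> is given by \<open>k\<close> and its set of edges.\<close>

definition simple_graph_on :: "nat \<Rightarrow> nat set set \<Rightarrow> bool" where
  "simple_graph_on k E \<longleftrightarrow> (\<forall>e\<in>E. e \<subseteq> {1..k} \<and> card e = 2)"

text \<open>An edge \<open>e = {i, j}\<close> contributes \<open>W (x\<^sub>i, x\<^sub>j)\<close>; as kernels are symmetric, the order of the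
  endpoints is immaterial, and \<^term>\<open>Min e\<close>, \<^term>\<open>Max e\<close> just name them.
  The completion of the product measure is \<open>k\<close>-dimensional Lebesgue measure on \<open>[0,1]\<^sup>k\<close>;
  without completing, \<open>x \<mapsto> W (x\<^sub>i, x\<^sub>j)\<close> need not be measurable for Lebesgue measurable \<open>W\<close>.\<close>

definition hom_density ::
    "nat \<Rightarrow> nat set set \<Rightarrow> (nat \<Rightarrow> nat) \<Rightarrow> (real \<times> real \<Rightarrow> real) \<times> (real \<Rightarrow> real) \<Rightarrow> real" where
  "hom_density k E d = (\<lambda>(W, f).
     \<integral>x. (\<Prod>i\<in>{1..k}. f (x i) ^ d i) * (\<Prod>e\<in>E. W (x (Min e), x (Max e)))
       \<partial>completion (\<Pi>\<^sub>M i\<in>{1..k}. unit_leb))"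

end

theory Submission
  imports Defs
begin

text \<open>
  The signal part of the cut norm is equivalent to the \<open>L\<^sup>1\<close> norm, and an edge factor
  \<open>W(x\<^sub>i, x\<^sub>j)\<close> may be replaced by \<open>V(x\<^sub>i, x\<^sub>j)\<close> at a cost of order \<open>\<parallel>W - V\<parallel>\<close> in cut norm, because every
  other factor of the integrand depends on at most one of \<open>x\<^sub>i\<close>, \<open>x\<^sub>j\<close>. This gives the forward direction.

  For the converse, sample \<open>x\<^sub>1, \<dots>, x\<^sub>k\<close> uniformly, and a random graph on \<open>{1..k}\<close> with edge probabilities
  \<open>W(x\<^sub>i, x\<^sub>j)\<close>, keeping the signal values \<open>f(x\<^sub>i)\<close>. The expected distance between a graphon-signal and its
  sample tends to 0 uniformly: by weak regularity \<open>W\<close> is close in cut norm to a step function \<open>V\<close> with boundedly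
  many steps; the sampled adjacency matrix minus the sampled \<open>V\<close> has small expected 4-cycle density, which
  dominates the fourth power of its cut norm; and the proportions of sample points in the steps are close to the
  measures of the steps, so the steps can be rearranged by a measure-preserving map. On the other hand, convergence of
  the densities, together with the Weierstrass approximation theorem, says that the samples of
  \<open>(W\<^sub>n, f\<^sub>n)\<close> converge in distribution to those of \<open>(W, f)\<close>. Hence for large \<open>n\<close> some sample is close to
  both.
\<close>

text \<open>The hypotheses concern Lebesgue measurable representatives with essential bounds, which
  behave badly under coordinate maps and Fubini. The argument therefore runs on Borel functions on
  the whole line with pointwise bounds, under the probability measure \<open>unif\<close>; the last
  section transfers the result. The cut distance between a graphon-signal and its sample is an
  infimum with no evident measurability in the sample points. Where it has to be averaged for the
  varying (Wn, fn), it is replaced by an explicit measurable majorant, built from quantities with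
  computable expectation: the 4-cycle density and squared deviations of label counts. Only for the
  fixed limit is the distance itself averaged, and there it is a continuous function of the sampled
  signal values. The 4-cycle is the right statistic because, up to coinciding vertices, averaging
  over the random edges turns its density for the adjacency matrix minus V into that for W - V,
  whereas a cut norm is a maximum over exponentially many pairs of sets.\<close>

section \<open>Bilinear forms and the cut norm\<close>

text \<open>A predicate, since the supremum defining the cut norm is only meaningful once it is known to be finite.\<close>

definition cut_le :: "'a measure \<Rightarrow> ('a \<times> 'a \<Rightarrow> real) \<Rightarrow> real \<Rightarrow> bool" where
  "cut_le M U c \<longleftrightarrow> (\<forall>S\<in>sets M. \<forall>T\<in>sets M.
     \<bar>\<integral>z. indicator S (fst z) * indicator T (snd z) * U z \<partial>(M \<Otimes>\<^sub>M M)\<bar> \<le> c)"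

lemma (in prob_space) integrable_bounded:
  fixes g :: "'a \<Rightarrow> real"
  assumes "g \<in> borel_measurable M" "\<And>x. \<bar>g x\<bar> \<le> K"
  shows "integrable M g"
  by (rule integrable_const_bound[where B=K]) (use assms in auto)

text \<open>Non-integrable functions are covered because their Bochner integral is 0 by convention
  and nonemptiness of the space forces 0 <= K; applications thus carry no integrability side
  condition.\<close>

lemma (in prob_space) integral_abs_le_const:
  fixes g :: "'a \<Rightarrow> real"
  assumes "\<And>x. x \<in> space M \<Longrightarrow> \<bar>g x\<bar> \<le> K"
  shows "\<bar>\<integral>x. g x \<partial>M\<bar> \<le> K"
proof (cases "integrable M g")
  case True
  have "\<bar>\<integral>x. g x \<partial>M\<bar> \<le> (\<integral>x. \<bar>g x\<bar> \<partial>M)" by (rule integral_abs_bound)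
  also have "\<dots> \<le> K"
    by (rule integral_le_const) (use True assms in auto)
  finally show ?thesis .
next
  case False
  obtain x where "x \<in> space M" using not_empty by auto
  with assms have "0 \<le> K" by force
  with False show ?thesis by (simp add: not_integrable_integral_eq)
qed

lemma abs_mult_le:
  fixes a b :: real
  assumes "\<bar>a\<bar> \<le> A" "\<bar>b\<bar> \<le> B"
  shows "\<bar>a * b\<bar> \<le> A * B"
  unfolding abs_mult using assms by (intro mult_mono) auto

lemma abs_indicator_mult_le:
  fixes b :: real
  assumes "\<bar>b\<bar> \<le> B"
  shows "\<bar>indicator S x * b\<bar> \<le> B"
  using assms by (auto simp: indicator_def)

text \<open>The sign of \<open>h\<close> splits the space into two sets, and the integral of |h| is
  the difference of the integrals of \<open>h\<close> over them, each at most \<open>d\<close> in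
  modulus. This is the source of the factor 2.\<close>

lemma (in prob_space) integral_mult_le_indicators:
  fixes a h :: "'a \<Rightarrow> real"
  assumes [measurable]: "a \<in> borel_measurable M" "h \<in> borel_measurable M"
    and K: "\<And>x. \<bar>h x\<bar> \<le> K"
    and C: "\<And>x. \<bar>a x\<bar> \<le> C"
    and d: "\<And>S. S \<in> sets M \<Longrightarrow> \<bar>\<integral>x. indicator S x * h x \<partial>M\<bar> \<le> d"
  shows "\<bar>\<integral>x. a x * h x \<partial>M\<bar> \<le> 2 * C * d"
proof -
  have C0: "C \<ge> 0" using C[of undefined] by linarith
  define P where "P = {x\<in>space M. 0 \<le> h x}"
  define N where "N = {x\<in>space M. h x < 0}"
  have [measurable]: "P \<in> sets M" "N \<in> sets M" unfolding P_def N_def by measurable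
  have iP: "integrable M (\<lambda>x. indicator P x * h x)" "integrable M (\<lambda>x. indicator N x * h x)"
    by (rule integrable_bounded[where K=K], measurable, rule abs_indicator_mult_le, rule K)+
  have ih: "integrable M (\<lambda>x. \<bar>h x\<bar>)"
    by (intro integrable_abs integrable_bounded[where K=K] K) measurable
  have "\<bar>\<integral>x. a x * h x \<partial>M\<bar> \<le> (\<integral>x. \<bar>a x * h x\<bar> \<partial>M)" by (rule integral_abs_bound)
  also have "\<dots> \<le> (\<integral>x. C * \<bar>h x\<bar> \<partial>M)"
    using C by (intro integral_mono_AE' AE_I2 integrable_mult_right ih) (auto simp: abs_mult mult_right_mono C0)
  also have "\<dots> = C * (\<integral>x. indicator P x * h x - indicator N x * h x \<partial>M)"
    unfolding P_def N_def by (subst integral_mult_right_zero) (auto intro!: Bochner_Integration.integral_cong simp: indicator_def)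
  also have "\<dots> = C * ((\<integral>x. indicator P x * h x \<partial>M) - (\<integral>x. indicator N x * h x \<partial>M))"
    using iP by simp
  also have "\<dots> \<le> C * (d + d)"
    using d[of P] d[of N] by (intro mult_left_mono C0) auto
  finally show ?thesis by simp
qed

text \<open>By Fubini the previous bound applies in one variable at a time: first \<open>a\<close>
  is replaced by indicators of sets S, then, for fixed S, \<open>b\<close> by indicators of sets T.
  Each replacement costs a factor 2.\<close>

lemma cut_bilinear:
  fixes a b :: "'a \<Rightarrow> real"
  assumes "prob_space M"
    and [measurable]: "a \<in> borel_measurable M" "b \<in> borel_measurable M" "U \<in> borel_measurable (M \<Otimes>\<^sub>M M)"
    and U: "\<And>z. \<bar>U z\<bar> \<le> K" and a: "\<And>x. \<bar>a x\<bar> \<le> A" and b: "\<And>x. \<bar>b x\<bar> \<le> B"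
    and c: "cut_le M U c"
  shows "\<bar>\<integral>z. a (fst z) * b (snd z) * U z \<partial>(M \<Otimes>\<^sub>M M)\<bar> \<le> 4 * A * B * c"
proof -
  interpret prob_space M by fact
  interpret P: pair_prob_space M M ..
  have fub: "(\<integral>z. g (fst z) * h (snd z) * U z \<partial>(M \<Otimes>\<^sub>M M)) = (\<integral>x. g x * (\<integral>y. h y * U (x, y) \<partial>M) \<partial>M)"
     "(\<integral>z. g (fst z) * h (snd z) * U z \<partial>(M \<Otimes>\<^sub>M M)) = (\<integral>y. h y * (\<integral>x. g x * U (x, y) \<partial>M) \<partial>M)"
    if [measurable]: "g \<in> borel_measurable M" "h \<in> borel_measurable M"
      and G: "\<And>x. \<bar>g x\<bar> \<le> G" and H: "\<And>x. \<bar>h x\<bar> \<le> H" for g h :: "'a \<Rightarrow> real" and G H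
  proof -
    have i: "integrable (M \<Otimes>\<^sub>M M) (\<lambda>(x, y). g x * h y * U (x, y))"
    proof (rule P.integrable_bounded[where K="G * H * K"])
      show "(\<lambda>(x, y). g x * h y * U (x, y)) \<in> borel_measurable (M \<Otimes>\<^sub>M M)" by measurable
      show "\<bar>case z of (x, y) \<Rightarrow> g x * h y * U (x, y)\<bar> \<le> G * H * K" for z
        by (cases z) (auto intro!: abs_mult_le G H U)
    qed
    show "(\<integral>z. g (fst z) * h (snd z) * U z \<partial>(M \<Otimes>\<^sub>M M)) = (\<integral>x. g x * (\<integral>y. h y * U (x, y) \<partial>M) \<partial>M)"
      using P.integral_fst'[OF i] by (simp add: split_beta' mult.assoc)
    show "(\<integral>z. g (fst z) * h (snd z) * U z \<partial>(M \<Otimes>\<^sub>M M)) = (\<integral>y. h y * (\<integral>x. g x * U (x, y) \<partial>M) \<partial>M)"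
      using P.integral_snd[OF i] by (simp add: split_beta' mult.assoc mult.left_commute[of "g _"])
  qed
  have bd: "\<bar>\<integral>y. h y * U (x, y) \<partial>M\<bar> \<le> H * K" "\<bar>\<integral>y. h y * U (y, x) \<partial>M\<bar> \<le> H * K"
    if [measurable]: "h \<in> borel_measurable M" and H: "\<And>x. \<bar>h x\<bar> \<le> H" for h :: "'a \<Rightarrow> real" and H x
  proof -
    have "\<bar>\<integral>y. k y \<partial>M\<bar> \<le> H * K" if "\<And>x. \<bar>k x\<bar> \<le> H * K" for k :: "'a \<Rightarrow> real"
      using that by (rule integral_abs_le_const)
    from this[of "\<lambda>y. h y * U (x, y)"] this[of "\<lambda>y. h y * U (y, x)"]
    show "\<bar>\<integral>y. h y * U (x, y) \<partial>M\<bar> \<le> H * K" "\<bar>\<integral>y. h y * U (y, x) \<partial>M\<bar> \<le> H * K"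
      by (auto intro!: abs_mult_le H U)
  qed
  have ind: "\<bar>indicator S x :: real\<bar> \<le> 1" for S and x :: 'a by (auto simp: indicator_def)
  have [measurable]: "(\<lambda>x. \<integral>y. b y * U (x, y) \<partial>M) \<in> borel_measurable M" by measurable
  have "\<bar>\<integral>x. a x * (\<integral>y. b y * U (x, y) \<partial>M) \<partial>M\<bar> \<le> 2 * A * (2 * B * c)"
  proof (rule integral_mult_le_indicators)
    show "\<bar>\<integral>y. b y * U (x, y) \<partial>M\<bar> \<le> B * K" for x using bd b by simp
    fix S assume S[measurable]: "S \<in> sets M"
    have "\<bar>\<integral>y. b y * (\<integral>x. indicator S x * U (x, y) \<partial>M) \<partial>M\<bar> \<le> 2 * B * c"
    proof (rule integral_mult_le_indicators)
      show "\<bar>\<integral>x. indicator S x * U (x, y) \<partial>M\<bar> \<le> 1 * K" for y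
        by (rule bd) (auto intro: ind)
      fix T assume T[measurable]: "T \<in> sets M"
      show "\<bar>\<integral>y. indicator T y * (\<integral>x. indicator S x * U (x, y) \<partial>M) \<partial>M\<bar> \<le> c"
        using c[unfolded cut_le_def, rule_format, OF S T] fub(2)[of "indicator S" "indicator T" 1 1] ind by simp
    qed (use b in auto)
    then show "\<bar>\<integral>x. indicator S x * (\<integral>y. b y * U (x, y) \<partial>M) \<partial>M\<bar> \<le> 2 * B * c"
      using fub[of "indicator S" b 1 B] ind b by simp
  qed (use a in auto)
  then show ?thesis using fub(1)[of a b A B] a b by simp
qed

lemma cut_le_nonneg: "cut_le M U c \<Longrightarrow> 0 \<le> c"
  unfolding cut_le_def by (auto dest!: bspec[of _ _ "{}"])

text \<open>With all other coordinates fixed, \<open>a\<close> is a function of \<open>x i\<close> and \<open>b\<close> a function of \<open>x j\<close>. This is used both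
  for the counting lemma and for the expected 4-cycle density of a sample.\<close>

lemma pivot_bound:
  fixes a b :: "('i \<Rightarrow> 'a) \<Rightarrow> real"
  assumes M: "prob_space M" and I: "finite I" "i \<in> I" "j \<in> I" "i \<noteq> j"
    and [measurable]: "a \<in> borel_measurable (PiM I (\<lambda>_. M))" "b \<in> borel_measurable (PiM I (\<lambda>_. M))"
      "U \<in> borel_measurable (M \<Otimes>\<^sub>M M)"
    and U: "\<And>z. \<bar>U z\<bar> \<le> K" and a: "\<And>x. \<bar>a x\<bar> \<le> A" and b: "\<And>x. \<bar>b x\<bar> \<le> B"
    and c: "cut_le M U c"
    and aj: "\<And>x t. a (x(j := t)) = a x" and bi: "\<And>x s. b (x(i := s)) = b x"
  shows "\<bar>\<integral>x. a x * b x * U (x i, x j) \<partial>(PiM I (\<lambda>_. M))\<bar> \<le> 4 * A * B * c"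
proof -
  interpret M: prob_space M by fact
  interpret P: product_prob_space "\<lambda>_::'i. M" I ..
  interpret PP: pair_prob_space M M ..
  define J where "J = I - {i, j}"
  have IJ: "I = insert i (insert j J)" "finite J" "i \<notin> insert j J" "j \<notin> J" using I by (auto simp: J_def)
  define F where "F = (\<lambda>x. a x * b x * U (x i, x j))"
  have K0: "K \<ge> 0" "A \<ge> 0" "B \<ge> 0" using U[of undefined] a[of undefined] b[of undefined] by auto
  have [measurable]: "(\<lambda>x. x i) \<in> measurable (PiM I (\<lambda>_. M)) M" "(\<lambda>x. x j) \<in> measurable (PiM I (\<lambda>_. M)) M"
    using I by (auto intro: measurable_component_singleton)
  have Fm: "F \<in> borel_measurable (PiM I (\<lambda>_. M))" unfolding F_def by measurable
  have Fb: "\<bar>F x\<bar> \<le> A * B * K" for x unfolding F_def by (intro abs_mult_le a b U)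
  have QI: "prob_space (PiM I (\<lambda>_. M))" by (rule prob_space_PiM) (rule M)
  interpret QJ: prob_space "PiM J (\<lambda>_. M)" by (rule prob_space_PiM) (rule M)
  interpret Qj: prob_space "PiM (insert j J) (\<lambda>_. M)" by (rule prob_space_PiM) (rule M)
  have "integral\<^sup>L (PiM I (\<lambda>_. M)) F = (\<integral>x. (\<integral>s. F (x(i := s)) \<partial>M) \<partial>PiM (insert j J) (\<lambda>_. M))"
    using prob_space.integrable_bounded[OF QI Fm Fb] IJ by (subst IJ(1), intro P.product_integral_insert) auto
  also have "\<dots> = (\<integral>x. (\<integral>t. (\<integral>s. F (x(j := t, i := s)) \<partial>M) \<partial>M) \<partial>PiM J (\<lambda>_. M))"
  proof (rule P.product_integral_insert)
    have upd: "(\<lambda>(x, s). x(i := s)) \<in> measurable (PiM (insert j J) (\<lambda>_. M) \<Otimes>\<^sub>M M) (PiM I (\<lambda>_. M))"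
      using measurable_add_dim[of i "insert j J" "\<lambda>_. M"] IJ by simp
    have "(\<lambda>x. \<integral>s. F (x(i := s)) \<partial>M) \<in> borel_measurable (PiM (insert j J) (\<lambda>_. M))"
      using measurable_compose[OF upd Fm] by (intro M.borel_measurable_lebesgue_integral) (simp add: split_beta')
    moreover have "\<bar>\<integral>s. F (x(i := s)) \<partial>M\<bar> \<le> A * B * K" for x
      using Fb by (rule M.integral_abs_le_const)
    ultimately show "integrable (PiM (insert j J) (\<lambda>_. M)) (\<lambda>x. \<integral>s. F (x(i := s)) \<partial>M)"
      by (rule Qj.integrable_bounded)
  qed (use IJ in auto)
  finally have eq: "integral\<^sup>L (PiM I (\<lambda>_. M)) F = (\<integral>x. (\<integral>t. (\<integral>s. F (x(j := t, i := s)) \<partial>M) \<partial>M) \<partial>PiM J (\<lambda>_. M))" .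
  have "\<bar>\<integral>t. (\<integral>s. F (x(j := t, i := s)) \<partial>M) \<partial>M\<bar> \<le> 4 * A * B * c" if x: "x \<in> space (PiM J (\<lambda>_. M))" for x
  proof -
    \<comment> \<open>Any point serves as a placeholder: \<open>a\<close> ignores coordinate j and
      \<open>b\<close> ignores coordinate i, so freezing these at \<open>t0\<close> leaves a
      function \<open>a'\<close> of s and a function \<open>b'\<close> of t.\<close>
    obtain t0 where t0: "t0 \<in> space M" using M.not_empty by auto
    define a' where "a' = (\<lambda>s. a (x(j := t0, i := s)))"
    define b' where "b' = (\<lambda>t. b (x(j := t, i := t0)))"
    have *: "F (x(j := t, i := s)) = a' s * b' t * U (s, t)" for s t
    proof -
      have "a (x(j := t, i := s)) = a (x(j := t0, i := s))"
        using aj[of "x(i := s)" t] aj[of "x(i := s)" t0] I(4) by (simp add: fun_upd_twist)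
      moreover have "b (x(j := t, i := s)) = b (x(j := t, i := t0))"
        using bi[of "x(j := t)" s] bi[of "x(j := t)" t0] by simp
      ultimately show ?thesis unfolding F_def a'_def b'_def using I(4) by simp
    qed
    have xj: "x(j := t0) \<in> space (PiM (insert j J) (\<lambda>_. M))"
      using x t0 by (auto simp: space_PiM PiE_def extensional_def)
    have m1: "(\<lambda>s. x(j := t0, i := s)) \<in> measurable M (PiM I (\<lambda>_. M))"
      using measurable_component_update[OF xj] IJ by simp
    have m2: "(\<lambda>t. x(j := t, i := t0)) \<in> measurable M (PiM I (\<lambda>_. M))"
    proof -
      have xi: "x(i := t0) \<in> space (PiM (insert i J) (\<lambda>_. M))"
        using x t0 by (auto simp: space_PiM PiE_def extensional_def)
      have "(\<lambda>t. x(i := t0, j := t)) \<in> measurable M (PiM (insert j (insert i J)) (\<lambda>_. M))"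
        by (rule measurable_component_update[OF xi]) (use IJ in auto)
      moreover have "insert j (insert i J) = I" using IJ by auto
      moreover have "(\<lambda>t. x(i := t0, j := t)) = (\<lambda>t. x(j := t, i := t0))" using I(4) by (auto simp: fun_upd_twist)
      ultimately show ?thesis by simp
    qed
    have [measurable]: "a' \<in> borel_measurable M" "b' \<in> borel_measurable M"
      unfolding a'_def b'_def by (rule measurable_compose[OF m1] measurable_compose[OF m2], measurable)+
    have "integrable (M \<Otimes>\<^sub>M M) (\<lambda>(s, t). a' s * b' t * U (s, t))"
    proof (rule PP.integrable_bounded[where K="A * B * K"])
      show "(\<lambda>(x, y). a' x * b' y * U (x, y)) \<in> borel_measurable (M \<Otimes>\<^sub>M M)" by measurable
      show "\<bar>case z of (x, y) \<Rightarrow> a' x * b' y * U (x, y)\<bar> \<le> A * B * K" for z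
        by (cases z) (auto intro!: abs_mult_le a b U simp: a'_def b'_def)
    qed
    from PP.integral_snd[OF this] have "(\<integral>t. (\<integral>s. F (x(j := t, i := s)) \<partial>M) \<partial>M) =
        (\<integral>z. a' (fst z) * b' (snd z) * U z \<partial>(M \<Otimes>\<^sub>M M))"
      by (simp add: * split_beta')
    moreover have "\<bar>\<integral>z. a' (fst z) * b' (snd z) * U z \<partial>(M \<Otimes>\<^sub>M M)\<bar> \<le> 4 * A * B * c"
    proof (rule cut_bilinear[OF M _ _ _ U _ _ c])
      show "\<bar>a' x\<bar> \<le> A" "\<bar>b' x\<bar> \<le> B" for x by (simp_all add: a'_def b'_def a b)
    qed measurable
    ultimately show ?thesis by simp
  qed
  then have "\<bar>integral\<^sup>L (PiM I (\<lambda>_. M)) F\<bar> \<le> 4 * A * B * c" unfolding eq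
    by (rule QJ.integral_abs_le_const)
  then show ?thesis by (simp add: F_def)
qed

section \<open>Weak regularity\<close>

lemma borel_measurable_step [measurable (raw)]:
  fixes v :: "nat \<Rightarrow> nat \<Rightarrow> real"
  assumes [measurable]: "l \<in> measurable N (count_space UNIV)" "l' \<in> measurable N (count_space UNIV)"
  shows "(\<lambda>z. v (l z) (l' z)) \<in> borel_measurable N"
  by measurable

definition clamp :: "real \<Rightarrow> real \<Rightarrow> real \<Rightarrow> real" where
  "clamp a b x = max a (min b x)"

lemma clamp_in: "a \<le> b \<Longrightarrow> a \<le> clamp a b x \<and> clamp a b x \<le> b"
  by (auto simp: clamp_def)

lemma clamp_id: "a \<le> x \<Longrightarrow> x \<le> b \<Longrightarrow> clamp a b x = x"
  by (auto simp: clamp_def)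

lemma clamp_measurable [measurable]: "clamp a b \<in> borel_measurable borel"
  unfolding clamp_def by measurable

lemma clamp_closer: "a \<le> w \<Longrightarrow> w \<le> b \<Longrightarrow> (w - clamp a b x)\<^sup>2 \<le> (w - x)\<^sup>2"
  unfolding clamp_def by (intro abs_le_square_iff[THEN iffD1]) auto

text \<open>A label function with a matrix of values, rather than a partition: refinement, sampling
  and rearrangement then act on labels alone. The matrix may be asymmetric, since refining adds a
  rectangle without its mirror image.\<close>

definition step_labels :: "'a measure \<Rightarrow> nat \<Rightarrow> ('a \<Rightarrow> nat) \<Rightarrow> (nat \<Rightarrow> nat \<Rightarrow> real) \<Rightarrow> bool" where
  "step_labels M m l v \<longleftrightarrow> l \<in> measurable M (count_space UNIV) \<and> (\<forall>x. l x < m) \<and>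
     (\<forall>p q. 0 \<le> v p q \<and> v p q \<le> 1)"

text \<open>A rectangle violating the cut norm bound is added to the current step function with coefficient its
  discrepancy; truncating to \<open>[0, 1]\<close> only brings the step function closer to \<open>W\<close> in \<open>L\<^sup>2\<close>.\<close>

lemma energy_decrement:
  fixes W :: "'a \<times> 'a \<Rightarrow> real"
  assumes "prob_space M" and [measurable]: "W \<in> borel_measurable (M \<Otimes>\<^sub>M M)"
    and W: "\<And>z. 0 \<le> W z" "\<And>z. W z \<le> 1"
    and sa: "step_labels M m l v"
    and \<epsilon>: "0 < \<epsilon>" and nc: "\<not> cut_le M (\<lambda>z. W z - v (l (fst z)) (l (snd z))) \<epsilon>"
  shows "\<exists>l' v'. step_labels M (4 * m) l' v' \<and>
    (\<integral>z. (W z - v' (l' (fst z)) (l' (snd z)))\<^sup>2 \<partial>(M \<Otimes>\<^sub>M M)) \<le>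
    (\<integral>z. (W z - v (l (fst z)) (l (snd z)))\<^sup>2 \<partial>(M \<Otimes>\<^sub>M M)) - \<epsilon>\<^sup>2"
proof -
  interpret M: prob_space M by fact
  interpret P: pair_prob_space M M ..
  have l[measurable]: "l \<in> measurable M (count_space UNIV)" and lm: "\<And>x. l x < m"
    and v: "\<And>p q. 0 \<le> v p q" "\<And>p q. v p q \<le> 1"
    using sa by (auto simp: step_labels_def)
  define V where "V = (\<lambda>z. v (l (fst z)) (l (snd z)))"
  have V[measurable]: "V \<in> borel_measurable (M \<Otimes>\<^sub>M M)" unfolding V_def by measurable
  obtain S T where S[measurable]: "S \<in> sets M" and T[measurable]: "T \<in> sets M"
    and ST: "\<bar>\<integral>z. indicator S (fst z) * indicator T (snd z) * (W z - V z) \<partial>(M \<Otimes>\<^sub>M M)\<bar> > \<epsilon>"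
    using nc unfolding cut_le_def V_def by (auto simp: not_le)
  define I where "I = (\<lambda>z. indicator S (fst z) * indicator T (snd z) :: real)"
  have [measurable]: "I \<in> borel_measurable (M \<Otimes>\<^sub>M M)" unfolding I_def by measurable
  have I01: "0 \<le> I z" "I z \<le> 1" for z unfolding I_def by (auto simp: indicator_def)
  define \<alpha> where "\<alpha> = (\<integral>z. I z * (W z - V z) \<partial>(M \<Otimes>\<^sub>M M))"
  have \<alpha>: "\<bar>\<alpha>\<bar> > \<epsilon>" using ST by (simp add: \<alpha>_def I_def)
  \<comment> \<open>Base 4 coding: the quotient by 4 is the old label, the lowest bit records
    membership in S and the next bit membership in T, so parity of the first label and the residue
    of the second detect the rectangle.\<close>
  define l' where "l' = (\<lambda>x. 4 * l x + (if x \<in> S then 1 else 0) + (if x \<in> T then 2 else 0))"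
  define v' where "v' = (\<lambda>p q. clamp 0 1 (v (p div 4) (q div 4) + \<alpha> * (if odd p then 1 else 0) * (if q mod 4 \<ge> 2 then 1 else 0)))"
  have "l' \<in> measurable M (count_space UNIV)" unfolding l'_def by measurable
  moreover have "l' x < 4 * m" for x using lm[of x] by (auto simp: l'_def)
  ultimately have sa': "step_labels M (4 * m) l' v'"
    by (auto simp: step_labels_def v'_def clamp_in)
  have v'_eq: "v' (l' x) (l' y) = clamp 0 1 (V (x, y) + \<alpha> * I (x, y))" for x y
  proof -
    have "l' x div 4 = l x" "l' y div 4 = l y" "odd (l' x) \<longleftrightarrow> x \<in> S" "l' y mod 4 \<ge> 2 \<longleftrightarrow> y \<in> T"
      by (auto simp: l'_def) presburger+
    then show ?thesis by (simp add: v'_def V_def I_def indicator_def)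
  qed
  have bd: "\<bar>W z - V z\<bar> \<le> 1" for z using W[of z] v[of "l (fst z)" "l (snd z)"] by (auto simp: V_def)
  have i1: "integrable (M \<Otimes>\<^sub>M M) (\<lambda>z. (W z - V z)\<^sup>2)"
    using bd by (intro P.integrable_bounded[where K=1]) (auto simp: abs_square_le_1 power_le_one_iff)
  have i2: "integrable (M \<Otimes>\<^sub>M M) (\<lambda>z. I z * (W z - V z))"
    by (intro P.integrable_bounded[where K="1*1"] abs_mult_le bd) (auto simp: I01)
  \<comment> \<open>When the square is expanded, the linear term contributes -2 \<alpha>^2 and the
    quadratic one at most \<alpha>^2, because \<open>I\<close> is at most 1; the net loss is at
    least \<epsilon>^2.\<close>
  have "(\<integral>z. (W z - v' (l' (fst z)) (l' (snd z)))\<^sup>2 \<partial>(M \<Otimes>\<^sub>M M))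
     \<le> (\<integral>z. (W z - V z)\<^sup>2 - 2 * \<alpha> * (I z * (W z - V z)) + \<alpha>\<^sup>2 \<partial>(M \<Otimes>\<^sub>M M))"
  proof (rule integral_mono_AE)
    have "\<bar>W z - v' (l' (fst z)) (l' (snd z))\<bar> \<le> 1" for z
      using W[of z] clamp_in[of 0 1] unfolding v'_def by (smt (verit))
    then show "integrable (M \<Otimes>\<^sub>M M) (\<lambda>z. (W z - v' (l' (fst z)) (l' (snd z)))\<^sup>2)"
      using sa' by (intro P.integrable_bounded[where K=1]) (auto simp: abs_square_le_1 step_labels_def)
    show "integrable (M \<Otimes>\<^sub>M M) (\<lambda>z. (W z - V z)\<^sup>2 - 2 * \<alpha> * (I z * (W z - V z)) + \<alpha>\<^sup>2)"
      using i1 i2 by auto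
    show "AE z in M \<Otimes>\<^sub>M M. (W z - v' (l' (fst z)) (l' (snd z)))\<^sup>2 \<le> (W z - V z)\<^sup>2 - 2 * \<alpha> * (I z * (W z - V z)) + \<alpha>\<^sup>2"
    proof (rule AE_I2)
      fix z
      have "(W z - v' (l' (fst z)) (l' (snd z)))\<^sup>2 \<le> (W z - (V z + \<alpha> * I z))\<^sup>2"
        using clamp_closer W by (simp add: v'_eq)
      also have "\<dots> = (W z - V z)\<^sup>2 - 2 * \<alpha> * (I z * (W z - V z)) + \<alpha>\<^sup>2 * (I z)\<^sup>2"
        by (simp add: power2_eq_square algebra_simps)
      also have "\<dots> \<le> (W z - V z)\<^sup>2 - 2 * \<alpha> * (I z * (W z - V z)) + \<alpha>\<^sup>2 * 1"
        using I01[of z] by (intro add_left_mono mult_left_mono) (auto simp: power_le_one)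
      finally show "(W z - v' (l' (fst z)) (l' (snd z)))\<^sup>2 \<le> (W z - V z)\<^sup>2 - 2 * \<alpha> * (I z * (W z - V z)) + \<alpha>\<^sup>2" by simp
    qed
  qed
  also have "\<dots> = (\<integral>z. (W z - V z)\<^sup>2 \<partial>(M \<Otimes>\<^sub>M M)) - 2 * \<alpha> * \<alpha> + \<alpha>\<^sup>2"
    using i1 i2 P.prob_space unfolding \<alpha>_def by simp
  also have "\<dots> \<le> (\<integral>z. (W z - V z)\<^sup>2 \<partial>(M \<Otimes>\<^sub>M M)) - \<epsilon>\<^sup>2"
    using \<alpha> \<epsilon> abs_le_square_iff[of \<epsilon> \<alpha>] by (simp add: power2_eq_square)
  finally show ?thesis using sa' by (auto simp: V_def)
qed

text \<open>The squared L^2 distance to W starts at most at 1, loses \<epsilon>^2 at each failure of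
  the cut bound and stays nonnegative, so there cannot be n failures. Each one multiplies the number
  of labels by 4. In the induction, a labelling that already works is carried along
  unchanged.\<close>

lemma weak_regularity:
  fixes W :: "'a \<times> 'a \<Rightarrow> real"
  assumes M: "prob_space M" and W[measurable]: "W \<in> borel_measurable (M \<Otimes>\<^sub>M M)"
    and W01: "\<And>z. 0 \<le> W z" "\<And>z. W z \<le> 1"
    and \<epsilon>: "0 < \<epsilon>" and n: "1 < real n * \<epsilon>\<^sup>2"
  shows "\<exists>l v. step_labels M (4 ^ n) l v \<and> cut_le M (\<lambda>z. W z - v (l (fst z)) (l (snd z))) \<epsilon>"
proof -
  interpret M: prob_space M by fact
  interpret P: pair_prob_space M M ..
  have "(\<exists>l v. step_labels M (4 ^ i) l v \<and> cut_le M (\<lambda>z. W z - v (l (fst z)) (l (snd z))) \<epsilon>) \<or>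
    (\<exists>l v. step_labels M (4 ^ i) l v \<and>
      (\<integral>z. (W z - v (l (fst z)) (l (snd z)))\<^sup>2 \<partial>(M \<Otimes>\<^sub>M M)) \<le> 1 - i * \<epsilon>\<^sup>2)" for i :: nat
  proof (induction i)
    case 0
    have "step_labels M (4 ^ 0) (\<lambda>_. 0) (\<lambda>_ _. 0)" by (simp add: step_labels_def)
    moreover have "(\<integral>z. (W z - 0)\<^sup>2 \<partial>(M \<Otimes>\<^sub>M M)) \<le> 1"
    proof -
      have "\<bar>\<integral>z. (W z - 0)\<^sup>2 \<partial>(M \<Otimes>\<^sub>M M)\<bar> \<le> 1"
        using W01 by (intro P.integral_abs_le_const) (auto simp: power_le_one_iff abs_square_le_1)
      then show ?thesis by simp
    qed
    ultimately show ?case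
      by (intro disjI2 exI[of _ "\<lambda>_. 0"] exI[of _ "\<lambda>_ _. 0"]) simp
  next
    case (Suc i)
    have mono: "step_labels M (4 ^ Suc i) l v" if "step_labels M (4 ^ i) l v" for l v
    proof -
      have "l x < 4 ^ Suc i" for x
      proof -
        have "l x < 4 ^ i" using that by (auto simp: step_labels_def)
        also have "(4::nat) ^ i \<le> 4 ^ Suc i" by simp
        finally show ?thesis .
      qed
      with that show ?thesis by (auto simp: step_labels_def simp del: power_Suc)
    qed
    from Suc.IH show ?case
    proof
      assume "\<exists>l v. step_labels M (4 ^ i) l v \<and> cut_le M (\<lambda>z. W z - v (l (fst z)) (l (snd z))) \<epsilon>"
      with mono show ?thesis by blast
    next
      assume "\<exists>l v. step_labels M (4 ^ i) l v \<and>
        (\<integral>z. (W z - v (l (fst z)) (l (snd z)))\<^sup>2 \<partial>(M \<Otimes>\<^sub>M M)) \<le> 1 - i * \<epsilon>\<^sup>2"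
      then obtain l v where lv: "step_labels M (4 ^ i) l v"
        and e: "(\<integral>z. (W z - v (l (fst z)) (l (snd z)))\<^sup>2 \<partial>(M \<Otimes>\<^sub>M M)) \<le> 1 - i * \<epsilon>\<^sup>2" by blast
      show ?thesis
      proof (cases "cut_le M (\<lambda>z. W z - v (l (fst z)) (l (snd z))) \<epsilon>")
        case True
        with mono lv show ?thesis by blast
      next
        case False
        from energy_decrement[OF M W W01 lv \<epsilon> False] obtain l' v' where
          "step_labels M (4 * 4 ^ i) l' v'" and
          "(\<integral>z. (W z - v' (l' (fst z)) (l' (snd z)))\<^sup>2 \<partial>(M \<Otimes>\<^sub>M M)) \<le>
           (\<integral>z. (W z - v (l (fst z)) (l (snd z)))\<^sup>2 \<partial>(M \<Otimes>\<^sub>M M)) - \<epsilon>\<^sup>2" by blast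
        moreover have "1 - real i * \<epsilon>\<^sup>2 - \<epsilon>\<^sup>2 = 1 - real (Suc i) * \<epsilon>\<^sup>2" by (simp add: algebra_simps)
        ultimately show ?thesis using e by (intro disjI2 exI[of _ l'] exI[of _ v']) auto
      qed
    qed
  qed
  from this[of n] show ?thesis
  proof
    assume "\<exists>l v. step_labels M (4 ^ n) l v \<and>
      (\<integral>z. (W z - v (l (fst z)) (l (snd z)))\<^sup>2 \<partial>(M \<Otimes>\<^sub>M M)) \<le> 1 - n * \<epsilon>\<^sup>2"
    then obtain l v where "step_labels M (4 ^ n) l v \<and>
      (\<integral>z. (W z - v (l (fst z)) (l (snd z)))\<^sup>2 \<partial>(M \<Otimes>\<^sub>M M)) \<le> 1 - n * \<epsilon>\<^sup>2" by (elim exE)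
    moreover have "0 \<le> (\<integral>z. (W z - v (l (fst z)) (l (snd z)))\<^sup>2 \<partial>(M \<Otimes>\<^sub>M M))" by simp
    ultimately have False using n by linarith
    then show ?thesis ..
  qed
qed

section \<open>Measure-preserving rearrangements\<close>

text \<open>The uniform distribution on [0,1], but with \<open>UNIV\<close> as space and the Borel
  sets of the line as \<sigma>-algebra, so that functions and maps carry no domain
  conditions.\<close>

definition unif :: "real measure" where
  "unif = density lborel (indicator {0..1})"

lemma sets_unif [simp, measurable_cong]: "sets unif = sets borel"
  by (simp add: unif_def)

lemma space_unif [simp]: "space unif = UNIV"
  by (simp add: unif_def)

lemma emeasure_unif: "A \<in> sets borel \<Longrightarrow> emeasure unif A = emeasure lborel (A \<inter> {0..1})"
  unfolding unif_def by (subst emeasure_density) (auto simp: mult.commute nn_integral_indicator[symmetric] indicator_inter_arith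
     simp del: nn_integral_indicator intro!: nn_integral_cong)

lemma prob_space_unif: "prob_space unif"
  by (rule prob_spaceI) (simp add: emeasure_unif)

interpretation unif: prob_space unif by (rule prob_space_unif)

interpretation unif2: pair_prob_space unif unif ..

lemma AE_unif_iff: "(AE x in unif. P x) \<longleftrightarrow> (AE x in lborel. x \<in> {0..1} \<longrightarrow> P x)"
  unfolding unif_def by (subst AE_density) (auto simp: indicator_def intro!: AE_cong)

lemma AE_unif_interior: "AE x in unif. 0 < x \<and> x < 1"
  unfolding AE_unif_iff using AE_lborel_singleton[of 0] AE_lborel_singleton[of 1] by eventually_elim auto

lemma AE_unif_countable: "countable A \<Longrightarrow> AE x in unif. x \<notin> A"
  unfolding AE_unif_iff using emeasure_lborel_countable[of A]
  by (intro AE_I[where N=A]) (auto simp: sets.countable)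

text \<open>The open interval is where the quantile function of a real distribution inverts its
  distribution function; this form lets the quantile function transport \<open>unif\<close> to a
  given law.\<close>

lemma unif_eq_distr: "unif = distr (restrict_space lborel {0<..<1}) borel (\<lambda>x. x)"
proof (rule measure_eqI)
  fix A assume "A \<in> sets unif"
  then have [measurable]: "A \<in> sets borel" by simp
  have "emeasure unif A = emeasure lborel (A \<inter> {0..1})" by (simp add: emeasure_unif)
  also have "\<dots> = emeasure lborel (A \<inter> {0<..<1})"
  proof (rule emeasure_eq_AE)
    show "AE x in lborel. x \<in> A \<inter> {0..1} \<longleftrightarrow> x \<in> A \<inter> {0<..<1}"
      using AE_lborel_singleton[of 0] AE_lborel_singleton[of 1] by eventually_elim auto
  qed auto
  also have "\<dots> = emeasure (distr (restrict_space lborel {0<..<1}) borel (\<lambda>x. x)) A"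
    by (subst emeasure_distr) (auto simp: space_restrict_space emeasure_restrict_space measurable_restrict_space1 Int_commute)
  finally show "emeasure unif A = emeasure (distr (restrict_space lborel {0<..<1}) borel (\<lambda>x. x)) A" .
qed simp

lemma measure_unif_atMost: "0 \<le> a \<Longrightarrow> a \<le> 1 \<Longrightarrow> measure unif {..a} = a"
proof -
  assume "0 \<le> a" "a \<le> 1"
  then have "{..a} \<inter> {0..1} = {0..a}" by auto
  then show ?thesis using \<open>0 \<le> a\<close> by (simp add: measure_def emeasure_unif)
qed

definition mp :: "(real \<Rightarrow> real) \<Rightarrow> bool" where
  "mp \<phi> \<longleftrightarrow> \<phi> \<in> borel_measurable borel \<and> distr unif borel \<phi> = unif"

text \<open>Invertibility is expressed by a measure-preserving inverse almost everywhere instead of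
  a bijection between complements of null sets. In this form it is symmetric and composes without
  tracking exceptional sets.\<close>

definition mp_iso :: "(real \<Rightarrow> real) \<Rightarrow> bool" where
  "mp_iso \<phi> \<longleftrightarrow> mp \<phi> \<and> (\<exists>\<psi>. mp \<psi> \<and> (AE x in unif. \<psi> (\<phi> x) = x) \<and> (AE x in unif. \<phi> (\<psi> x) = x))"

lemma mp_measurable: "mp \<phi> \<Longrightarrow> \<phi> \<in> borel_measurable borel"
  by (simp add: mp_def)

lemma mp_iso_mp: "mp_iso \<phi> \<Longrightarrow> mp \<phi>"
  by (simp add: mp_iso_def)

lemma mp_AE:
  assumes "mp \<phi>" "AE x in unif. P x"
  shows "AE x in unif. P (\<phi> x)"
proof -
  have [measurable]: "\<phi> \<in> borel_measurable borel" by (rule mp_measurable) fact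
  have "\<phi> \<in> measurable unif borel" by measurable
  moreover have "distr unif borel \<phi> = unif" using assms by (simp add: mp_def)
  ultimately show ?thesis using AE_distrD[of \<phi> unif borel P] assms(2) by metis
qed

lemma mp_comp:
  assumes "mp \<phi>" "mp \<psi>"
  shows "mp (\<lambda>x. \<psi> (\<phi> x))"
proof -
  have [measurable]: "\<phi> \<in> borel_measurable borel" "\<psi> \<in> borel_measurable borel" using assms by (auto simp: mp_def)
  have "distr unif borel (\<psi> \<circ> \<phi>) = distr (distr unif borel \<phi>) borel \<psi>"
    by (subst distr_distr) auto
  with assms show ?thesis by (simp add: mp_def o_def)
qed

lemma mp_iso_comp:
  assumes "mp_iso \<phi>" "mp_iso \<psi>"
  shows "mp_iso (\<lambda>x. \<psi> (\<phi> x))"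
proof -
  obtain \<phi>' where 1: "mp \<phi>" "mp \<phi>'" "AE x in unif. \<phi>' (\<phi> x) = x" "AE x in unif. \<phi> (\<phi>' x) = x"
    using assms by (auto simp: mp_iso_def)
  obtain \<psi>' where 2: "mp \<psi>" "mp \<psi>'" "AE x in unif. \<psi>' (\<psi> x) = x" "AE x in unif. \<psi> (\<psi>' x) = x"
    using assms by (auto simp: mp_iso_def)
  have "AE x in unif. \<phi>' (\<psi>' (\<psi> (\<phi> x))) = x"
    using mp_AE[OF 1(1) 2(3)] 1(3) by eventually_elim simp
  moreover have "AE x in unif. \<psi> (\<phi> (\<phi>' (\<psi>' x))) = x"
    using mp_AE[OF 2(2) 1(4)] 2(4) by eventually_elim simp
  ultimately show ?thesis
    unfolding mp_iso_def using mp_comp[OF 1(1) 2(1)] mp_comp[OF 2(2) 1(2)]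
    by (intro conjI exI[of _ "\<lambda>x. \<phi>' (\<psi>' x)"]) auto
qed

lemma mp_distr_pair:
  assumes "mp \<phi>"
  shows "distr (unif \<Otimes>\<^sub>M unif) (borel \<Otimes>\<^sub>M borel) (\<lambda>z. (\<phi> (fst z), \<phi> (snd z))) = unif \<Otimes>\<^sub>M unif"
proof -
  have [measurable]: "\<phi> \<in> measurable unif borel" using assms by (simp add: mp_def cong: measurable_cong_sets)
  have "distr unif borel \<phi> \<Otimes>\<^sub>M distr unif borel \<phi> = distr (unif \<Otimes>\<^sub>M unif) (borel \<Otimes>\<^sub>M borel) (\<lambda>(x, y). (\<phi> x, \<phi> y))"
    using assms by (intro pair_measure_distr) (auto simp: mp_def unif.sigma_finite_measure_axioms)
  then show ?thesis using assms by (simp add: mp_def split_beta')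
qed

text \<open>The labelling \<open>l\<close> is encoded by the injective map \<open>x \<mapsto> l x + x\<close> on \<open>[0, 1)\<close>. Composing it with
  the distribution function of its law \<open>\<mu>\<close> gives \<open>\<phi>\<close>, which sorts the points by their labels; \<open>\<psi>\<close> is the
  fractional part of the quantile function of \<open>\<mu>\<close>.\<close>

lemma sort_by_label:
  fixes l :: "real \<Rightarrow> nat"
  assumes [measurable]: "l \<in> measurable borel (count_space UNIV)"
  shows "\<exists>\<phi> \<psi>. mp \<phi> \<and> mp \<psi> \<and> (AE x in unif. \<psi> (\<phi> x) = x) \<and> (AE x in unif. \<phi> (\<psi> x) = x) \<and>
    (AE y in unif. \<forall>j. l (\<psi> y) < j \<longleftrightarrow> y \<le> measure unif {x. l x < j})"
proof -
  define g where "g = (\<lambda>x. real (l x) + x)"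
  have [measurable]: "g \<in> borel_measurable borel" unfolding g_def by measurable
  define \<mu> where "\<mu> = distr unif borel g"
  have \<mu>: "real_distribution \<mu>" unfolding \<mu>_def by (rule unif.real_distribution_distr) simp
  interpret cdf_distribution \<mu> by (simp add: cdf_distribution_def \<mu>)
  \<comment> \<open>The equation \<open>g x = z\<close> leaves only the countably many candidates z
    - n for x.\<close>
  have noatom: "measure \<mu> {z} = 0" for z
  proof -
    have "AE x in unif. x \<notin> range (\<lambda>n::nat. z - n)" by (rule AE_unif_countable) simp
    then have "AE x in unif. \<not> g x = z"
      by eventually_elim (force simp: g_def)
    then have "emeasure unif {x. g x = z} = 0" using AE_iff_measurable[of "{x. g x = z}" unif "\<lambda>x. g x \<noteq> z"] by simp
    then show ?thesis by (simp add: \<mu>_def measure_distr measure_def vimage_def emeasure_distr)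
  qed
  have cont: "isCont (cdf \<mu>) z" for z using isCont_cdf noatom by simp
  \<comment> \<open>The quantile function matters only on (0, 1); the value 0 elsewhere makes it a
    total Borel function.\<close>
  define I' where "I' = (\<lambda>y. if y \<in> {0<..<1} then I y else 0)"
  have [measurable]: "I' \<in> borel_measurable borel"
    using measurable_CI measurable_restrict_space_iff[of "{0<..<1::real}" borel 0 borel I]
    unfolding I'_def by simp
  \<comment> \<open>In general the distribution function at the quantile of y is at least y. To the
    left of the quantile it is at most y, so continuity, that is absence of atoms, gives
    equality.\<close>
  have CI: "C (I' y) = y" if y: "0 < y" "y < 1" for y
  proof (rule antisym)
    have I'y: "I' y = I y" using y by (simp add: I'_def)
    show "y \<le> C (I' y)" using pseudoinverse[OF y, of "I y"] I'y by simp
    have "(C \<longlongrightarrow> C (I' y)) (at_left (I' y))"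
      using cont[of "I' y"] by (auto simp: isCont_def intro: tendsto_mono at_le)
    moreover have "\<forall>\<^sub>F z in at_left (I' y). C z \<le> y"
    proof (rule eventually_at_leftI[of "I' y - 1"])
      fix z assume "z \<in> {I' y - 1<..<I' y}"
      then have "\<not> I y \<le> z" using I'y by simp
      then show "C z \<le> y" using pseudoinverse[OF y, of z] by linarith
    qed simp
    ultimately show "C (I' y) \<le> y" by (rule tendsto_upperbound) simp
  qed
  have CIa: "AE y in unif. C (I' y) = y" using AE_unif_interior by eventually_elim (use CI in auto)
  have dI: "distr unif borel I' = \<mu>"
  proof -
    have "distr unif borel I' = distr (restrict_space lborel {0<..<1}) borel (I' \<circ> (\<lambda>x. x))"
      by (subst unif_eq_distr, subst distr_distr) (auto intro: measurable_restrict_space1)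
    also have "\<dots> = distr (restrict_space lborel {0<..<1}) borel I"
      by (intro distr_cong) (auto simp: space_restrict_space I'_def)
    finally show ?thesis using distr_I_eq_M by simp
  qed
  have AE\<mu>: "(AE z in \<mu>. P z) \<Longrightarrow> AE y in unif. P (I' y)" "(AE z in \<mu>. P z) \<Longrightarrow> AE x in unif. P (g x)" for P
    using AE_distrD[of I' unif borel P, unfolded dI] AE_distrD[of g unif borel P, folded \<mu>_def] by auto
  \<comment> \<open>Since \<mu> is the image of \<open>unif\<close> under \<open>I'\<close>, the
    identity has to be checked only at points \<open>I' y\<close>, where it follows from
    \<open>CI\<close>.\<close>
  have IC: "AE z in \<mu>. I' (C z) = z"
  proof -
    have "AE z in distr unif borel I'. I' (C z) = z"
    proof (subst AE_distr_iff)
      show "AE y in unif. I' (C (I' y)) = I' y" using CIa by eventually_elim simp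
    qed measurable
    then show ?thesis unfolding dI .
  qed
  have fr: "frac (g x) = x" if "0 < x" "x < 1" for x
    using that by (simp add: g_def frac_unique_iff)
  have frAE: "AE x in unif. frac (g x) = x" using AE_unif_interior by eventually_elim (simp add: fr)
  have [measurable]: "(frac :: real \<Rightarrow> real) \<in> borel_measurable borel"
    unfolding frac_def[abs_def] by measurable
  define \<phi> where "\<phi> = (\<lambda>x. C (g x))"
  define \<psi> where "\<psi> = (\<lambda>y. frac (I' y))"
  have [measurable]: "\<phi> \<in> borel_measurable borel" "\<psi> \<in> borel_measurable borel" unfolding \<phi>_def \<psi>_def by measurable
  have id: "distr unif borel (\<lambda>x. x) = unif" by (rule measure_eqI) (auto simp: emeasure_distr)
  have "distr unif borel \<phi> = distr (distr unif borel g) borel C"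
    by (subst distr_distr) (auto simp: \<phi>_def o_def)
  also have "\<dots> = distr (distr unif borel I') borel C" using dI by (simp add: \<mu>_def)
  also have "\<dots> = distr unif borel (\<lambda>y. C (I' y))" by (subst distr_distr) (auto simp: o_def)
  also have "\<dots> = distr unif borel (\<lambda>y. y)" by (rule distr_cong_AE) (use CIa in auto)
  finally have "mp \<phi>" by (simp add: mp_def id)
  moreover have "mp \<psi>"
  proof -
    have "distr unif borel \<psi> = distr (distr unif borel I') borel frac"
      by (subst distr_distr) (auto simp: \<psi>_def o_def)
    also have "\<dots> = distr (distr unif borel g) borel frac" using dI by (simp add: \<mu>_def)
    also have "\<dots> = distr unif borel (\<lambda>y. frac (g y))" by (subst distr_distr) (auto simp: o_def)
    also have "\<dots> = distr unif borel (\<lambda>y. y)" by (rule distr_cong_AE) (use frAE in auto)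
    finally show ?thesis by (simp add: mp_def id)
  qed
  moreover have "AE x in unif. \<psi> (\<phi> x) = x"
    using AE\<mu>(2)[OF IC] frAE by eventually_elim (simp add: \<psi>_def \<phi>_def)
  moreover have "AE x in unif. \<phi> (\<psi> x) = x"
  proof -
    have "AE z in \<mu>. g (frac z) = z" unfolding \<mu>_def
      by (subst AE_distr_iff) (use frAE in \<open>auto elim: eventually_mono\<close>)
    from AE\<mu>(1)[OF this] CIa show ?thesis by eventually_elim (simp add: \<psi>_def \<phi>_def)
  qed
  moreover have "AE y in unif. \<forall>j. l (\<psi> y) < j \<longleftrightarrow> y \<le> measure unif {x. l x < j}"
  proof -
    \<comment> \<open>The points of label n are placed in the interval (n, n + 1), so labels below j
      are exactly those placed at or below j.\<close>
    have gl: "l (frac (g x)) < j \<longleftrightarrow> g x \<le> j" if "0 < x" "x < 1" for x and j :: nat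
    proof
      assume "l (frac (g x)) < j"
      then have "real (l x) + 1 \<le> j" using fr[OF that] by simp
      then show "g x \<le> j" using that by (simp add: g_def)
    next
      assume "g x \<le> j"
      then have "real (l x) < j" using that by (simp add: g_def)
      then show "l (frac (g x)) < j" using fr[OF that] by simp
    qed
    have Cj: "C j = measure unif {x. l x < j}" for j :: nat
    proof -
      have "C j = measure unif {x. g x \<le> j}" by (simp add: cdf_def \<mu>_def measure_distr vimage_def)
      also have "\<dots> = measure unif {x. l x < j}"
      proof (rule measure_eq_AE)
        show "AE x in unif. x \<in> {x. g x \<le> real j} \<longleftrightarrow> x \<in> {x. l x < j}"
          using AE_unif_interior by eventually_elim (use gl fr in auto)
      qed auto
      finally show ?thesis .
    qed
    have "AE z in \<mu>. \<forall>j::nat. l (frac z) < j \<longleftrightarrow> z \<le> j" unfolding \<mu>_def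
    proof (subst AE_distr_iff)
      show "AE x in unif. \<forall>j::nat. l (frac (g x)) < j \<longleftrightarrow> g x \<le> j"
        using AE_unif_interior by eventually_elim (use gl in auto)
    qed measurable
    from AE\<mu>(1)[OF this] AE_unif_interior show ?thesis
    proof eventually_elim
      case (elim y)
      have "I' y \<le> j \<longleftrightarrow> y \<le> C j" for j using pseudoinverse[of y j] elim by (simp add: I'_def)
      with elim show ?case by (simp add: \<psi>_def Cj)
    qed
  qed
  ultimately show ?thesis by blast
qed

lemma sets_labels_neq:
  fixes f g :: "'a \<Rightarrow> nat"
  assumes [measurable]: "f \<in> measurable M (count_space UNIV)" "g \<in> measurable M (count_space UNIV)"
  shows "{x \<in> space M. f x \<noteq> g x} \<in> sets M"
proof -
  have "Measurable.pred M (\<lambda>x. f x \<noteq> g x)"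
    by (rule measurable_compose_countable[of "\<lambda>i x. f x \<noteq> i" M "count_space UNIV" g]) measurable
  then show ?thesis by (simp add: pred_def)
qed

text \<open>The map sends x to its position in the order sorted by \<open>l1\<close>, and then to
  the point with the same position in the order sorted by \<open>l2\<close>. At a given position the
  two labels can disagree only if it lies between the two cumulative measures for some threshold j,
  an interval whose length is the j-th summand.\<close>

lemma rearrange_labels:
  fixes l1 l2 :: "real \<Rightarrow> nat"
  assumes [measurable]: "l1 \<in> measurable borel (count_space UNIV)" "l2 \<in> measurable borel (count_space UNIV)"
    and l1: "\<And>x. l1 x < m" and l2: "\<And>x. l2 x < m"
  shows "\<exists>\<phi>. mp_iso \<phi> \<and> measure unif {x. l1 x \<noteq> l2 (\<phi> x)} \<le>
    (\<Sum>j<m. \<bar>measure unif {x. l1 x < j} - measure unif {x. l2 x < j}\<bar>)"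
proof -
  obtain \<phi>1 \<psi>1 where 1: "mp \<phi>1" "mp \<psi>1" "AE x in unif. \<psi>1 (\<phi>1 x) = x" "AE x in unif. \<phi>1 (\<psi>1 x) = x"
      "AE y in unif. \<forall>j. l1 (\<psi>1 y) < j \<longleftrightarrow> y \<le> measure unif {x. l1 x < j}"
    using sort_by_label[of l1] by auto
  obtain \<phi>2 \<psi>2 where 2: "mp \<phi>2" "mp \<psi>2" "AE x in unif. \<psi>2 (\<phi>2 x) = x" "AE x in unif. \<phi>2 (\<psi>2 x) = x"
      "AE y in unif. \<forall>j. l2 (\<psi>2 y) < j \<longleftrightarrow> y \<le> measure unif {x. l2 x < j}"
    using sort_by_label[of l2] by auto
  note [measurable] = 1(1,2)[THEN mp_measurable] 2(1,2)[THEN mp_measurable]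
  have "mp_iso (\<lambda>x. \<psi>2 (\<phi>1 x))"
    by (rule mp_iso_comp) (use 1 2 in \<open>auto simp: mp_iso_def\<close>)
  moreover have "measure unif {x. l1 x \<noteq> l2 (\<psi>2 (\<phi>1 x))} \<le>
    (\<Sum>j<m. \<bar>measure unif {x. l1 x < j} - measure unif {x. l2 x < j}\<bar>)"
  proof -
    define F1 where "F1 = (\<lambda>j. measure unif {x. l1 x < j})"
    define F2 where "F2 = (\<lambda>j. measure unif {x. l2 x < j})"
    have F: "0 \<le> F1 j" "F1 j \<le> 1" "0 \<le> F2 j" "F2 j \<le> 1" for j by (auto simp: F1_def F2_def)
    have "measure unif {x. l1 x \<noteq> l2 (\<psi>2 (\<phi>1 x))} = measure unif {x. l1 (\<psi>1 (\<phi>1 x)) \<noteq> l2 (\<psi>2 (\<phi>1 x))}"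
    proof (rule measure_eq_AE)
      show "AE x in unif. x \<in> {x. l1 x \<noteq> l2 (\<psi>2 (\<phi>1 x))} \<longleftrightarrow> x \<in> {x. l1 (\<psi>1 (\<phi>1 x)) \<noteq> l2 (\<psi>2 (\<phi>1 x))}"
        using 1(3) by (rule eventually_mono) simp
      have [measurable]: "(\<lambda>x. l1 (\<psi>1 (\<phi>1 x))) \<in> measurable borel (count_space UNIV)"
        "(\<lambda>x. l2 (\<psi>2 (\<phi>1 x))) \<in> measurable borel (count_space UNIV)" by measurable
      note sets_labels_neq[of l1 borel "\<lambda>x. l2 (\<psi>2 (\<phi>1 x))"]
        sets_labels_neq[of "\<lambda>x. l1 (\<psi>1 (\<phi>1 x))" borel "\<lambda>x. l2 (\<psi>2 (\<phi>1 x))"]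
      then show "{x. l1 x \<noteq> l2 (\<psi>2 (\<phi>1 x))} \<in> sets unif" "{x. l1 (\<psi>1 (\<phi>1 x)) \<noteq> l2 (\<psi>2 (\<phi>1 x))} \<in> sets unif"
        by (simp_all add: assms)
    qed
    also have "\<dots> = measure (distr unif borel \<phi>1) {y. l1 (\<psi>1 y) \<noteq> l2 (\<psi>2 y)}"
      using sets_labels_neq[of "\<lambda>y. l1 (\<psi>1 y)" borel "\<lambda>y. l2 (\<psi>2 y)"]
      by (subst measure_distr) (auto simp: vimage_def)
    also have "\<dots> = measure unif {y. l1 (\<psi>1 y) \<noteq> l2 (\<psi>2 y)}" using 1(1) by (simp add: mp_def)
    also have "\<dots> \<le> measure unif (\<Union>j<m. {min (F1 j) (F2 j)<..max (F1 j) (F2 j)})"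
    proof (rule unif.finite_measure_mono_AE)
      show "AE y in unif. y \<in> {y. l1 (\<psi>1 y) \<noteq> l2 (\<psi>2 y)} \<longrightarrow> y \<in> (\<Union>j<m. {min (F1 j) (F2 j)<..max (F1 j) (F2 j)})"
        using 1(5) 2(5)
      proof eventually_elim
        case (elim y)
        show ?case
        proof
          assume "y \<in> {y. l1 (\<psi>1 y) \<noteq> l2 (\<psi>2 y)}"
          then have ne: "l1 (\<psi>1 y) \<noteq> l2 (\<psi>2 y)" by simp
          \<comment> \<open>The larger of two distinct labels is a threshold that separates them,
            and as a label it is less than m.\<close>
          define j where "j = max (l1 (\<psi>1 y)) (l2 (\<psi>2 y))"
          have "j < m" using l1 l2 by (simp add: j_def)
          moreover have "(l1 (\<psi>1 y) < j) \<noteq> (l2 (\<psi>2 y) < j)" using ne by (auto simp: j_def max_def)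
          then have "(y \<le> F1 j) \<noteq> (y \<le> F2 j)" using elim by (simp add: F1_def F2_def)
          then have "y \<in> {min (F1 j) (F2 j)<..max (F1 j) (F2 j)}" by auto
          ultimately show "y \<in> (\<Union>j<m. {min (F1 j) (F2 j)<..max (F1 j) (F2 j)})" by blast
        qed
      qed
    qed auto
    also have "\<dots> \<le> (\<Sum>j<m. measure unif {min (F1 j) (F2 j)<..max (F1 j) (F2 j)})"
      by (rule unif.finite_measure_subadditive_finite) auto
    also have "\<dots> = (\<Sum>j<m. \<bar>F1 j - F2 j\<bar>)"
    proof (rule sum.cong)
      fix j
      have "{min (F1 j) (F2 j)<..max (F1 j) (F2 j)} = {..max (F1 j) (F2 j)} - {..min (F1 j) (F2 j)}" by auto
      then have "measure unif {min (F1 j) (F2 j)<..max (F1 j) (F2 j)} = max (F1 j) (F2 j) - min (F1 j) (F2 j)"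
        using F[of j] by (simp add: unif.finite_measure_Diff measure_unif_atMost)
      then show "measure unif {min (F1 j) (F2 j)<..max (F1 j) (F2 j)} = \<bar>F1 j - F2 j\<bar>" by auto
    qed simp
    finally show ?thesis by (simp add: F1_def F2_def)
  qed
  ultimately show ?thesis by blast
qed

section \<open>Closeness of Borel graphon-signals\<close>

lemma abs_abs_diff_le:
  fixes a b :: real
  assumes "\<bar>a\<bar> \<le> r" "\<bar>b\<bar> \<le> r"
  shows "\<bar>\<bar>a - b\<bar>\<bar> \<le> 2 * r"
  using assms by linarith

lemma cut_le_add:
  assumes "prob_space M"
    and [measurable]: "U \<in> borel_measurable (M \<Otimes>\<^sub>M M)" "V \<in> borel_measurable (M \<Otimes>\<^sub>M M)"
    and U: "\<And>z. \<bar>U z\<bar> \<le> K" and V: "\<And>z. \<bar>V z\<bar> \<le> L"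
    and c: "cut_le M U c" and d: "cut_le M V d"
  shows "cut_le M (\<lambda>z. U z + V z) (c + d)"
  unfolding cut_le_def
proof safe
  interpret prob_space M by fact
  interpret P: pair_prob_space M M ..
  fix S T assume S[measurable]: "S \<in> sets M" and T[measurable]: "T \<in> sets M"
  define I where "I = (\<lambda>z. indicator S (fst z) * indicator T (snd z) :: real)"
  have [measurable]: "I \<in> borel_measurable (M \<Otimes>\<^sub>M M)" unfolding I_def by measurable
  have I: "\<bar>I z\<bar> \<le> 1" for z by (auto simp: I_def indicator_def)
  have "integrable (M \<Otimes>\<^sub>M M) (\<lambda>z. I z * U z)" "integrable (M \<Otimes>\<^sub>M M) (\<lambda>z. I z * V z)"
    by (rule P.integrable_bounded[OF _ abs_mult_le[OF I U]] P.integrable_bounded[OF _ abs_mult_le[OF I V]], measurable)+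
  then have "(\<integral>z. I z * (U z + V z) \<partial>(M \<Otimes>\<^sub>M M)) = (\<integral>z. I z * U z \<partial>(M \<Otimes>\<^sub>M M)) + (\<integral>z. I z * V z \<partial>(M \<Otimes>\<^sub>M M))"
    by (simp add: distrib_left)
  moreover have "\<bar>\<integral>z. I z * U z \<partial>(M \<Otimes>\<^sub>M M)\<bar> \<le> c" "\<bar>\<integral>z. I z * V z \<partial>(M \<Otimes>\<^sub>M M)\<bar> \<le> d"
    using c d S T by (auto simp: cut_le_def I_def)
  ultimately show "\<bar>\<integral>z. indicator S (fst z) * indicator T (snd z) * (U z + V z) \<partial>(M \<Otimes>\<^sub>M M)\<bar> \<le> c + d"
    by (simp add: I_def)
qed

lemma cut_le_uminus: "cut_le M (\<lambda>z. - U z) c \<longleftrightarrow> cut_le M U c"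
  by (simp add: cut_le_def)

lemma cut_le_L1:
  assumes "prob_space M" and "integrable (M \<Otimes>\<^sub>M M) (\<lambda>z. \<bar>U z\<bar>)"
    and "(\<integral>z. \<bar>U z\<bar> \<partial>(M \<Otimes>\<^sub>M M)) \<le> c"
  shows "cut_le M U c"
  unfolding cut_le_def
proof safe
  fix S T
  have "\<bar>\<integral>z. indicator S (fst z) * indicator T (snd z) * U z \<partial>(M \<Otimes>\<^sub>M M)\<bar> \<le>
    (\<integral>z. \<bar>indicator S (fst z) * indicator T (snd z) * U z\<bar> \<partial>(M \<Otimes>\<^sub>M M))"
    by (rule integral_abs_bound)
  also have "\<dots> \<le> (\<integral>z. \<bar>U z\<bar> \<partial>(M \<Otimes>\<^sub>M M))"
    by (rule integral_mono_AE') (use assms in \<open>auto simp: indicator_def\<close>)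
  finally show "\<bar>\<integral>z. indicator S (fst z) * indicator T (snd z) * U z \<partial>(M \<Otimes>\<^sub>M M)\<bar> \<le> c" using assms by linarith
qed

lemma AE_unif2:
  assumes "AE x in unif. P x"
  shows "AE z in unif \<Otimes>\<^sub>M unif. P (fst z) \<and> P (snd z)"
proof -
  obtain N where N: "N \<in> null_sets unif" "{x. \<not> P x} \<subseteq> N" using assms by (auto simp: eventually_ae_filter)
  have "N \<times> UNIV \<in> null_sets (unif \<Otimes>\<^sub>M unif)" "UNIV \<times> N \<in> null_sets (unif \<Otimes>\<^sub>M unif)"
    using N by (auto simp: null_sets_def unif.emeasure_pair_measure_Times)
  then have "AE z in unif \<Otimes>\<^sub>M unif. z \<notin> N \<times> UNIV" "AE z in unif \<Otimes>\<^sub>M unif. z \<notin> UNIV \<times> N"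
    by (auto intro: AE_not_in)
  then show ?thesis by eventually_elim (use N in auto)
qed

lemma mp_integral2:
  fixes U :: "real \<times> real \<Rightarrow> real"
  assumes "mp \<phi>" and [measurable]: "U \<in> borel_measurable (borel \<Otimes>\<^sub>M borel)"
  shows "(\<integral>z. U (\<phi> (fst z), \<phi> (snd z)) \<partial>(unif \<Otimes>\<^sub>M unif)) = (\<integral>z. U z \<partial>(unif \<Otimes>\<^sub>M unif))"
proof -
  have [measurable]: "\<phi> \<in> borel_measurable borel" by (rule mp_measurable) fact
  have "(\<integral>z. U z \<partial>(distr (unif \<Otimes>\<^sub>M unif) (borel \<Otimes>\<^sub>M borel) (\<lambda>z. (\<phi> (fst z), \<phi> (snd z))))) =
    (\<integral>z. U (\<phi> (fst z), \<phi> (snd z)) \<partial>(unif \<Otimes>\<^sub>M unif))"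
    by (rule integral_distr) measurable
  then show ?thesis unfolding mp_distr_pair[OF assms(1)] by simp
qed

lemma mp_integral:
  fixes g :: "real \<Rightarrow> real"
  assumes "mp \<phi>" and [measurable]: "g \<in> borel_measurable borel"
  shows "(\<integral>x. g (\<phi> x) \<partial>unif) = (\<integral>x. g x \<partial>unif)"
proof -
  have [measurable]: "\<phi> \<in> borel_measurable borel" by (rule mp_measurable) fact
  have "(\<integral>x. g x \<partial>(distr unif borel \<phi>)) = (\<integral>x. g (\<phi> x) \<partial>unif)"
    by (subst integral_distr) auto
  then show ?thesis using assms by (simp add: mp_def)
qed

text \<open>The almost everywhere inverse \<psi> turns the indicator of S at x into the indicator of
  the \<psi>-preimage of S at \<phi> x. The integrand is then a function of the images under \<phi>
  alone, and \<phi> preserves the measure.\<close>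

lemma cut_le_mp_iso:
  fixes U :: "real \<times> real \<Rightarrow> real"
  assumes \<phi>: "mp_iso \<phi>" and [measurable]: "U \<in> borel_measurable (borel \<Otimes>\<^sub>M borel)" and c: "cut_le unif U c"
  shows "cut_le unif (\<lambda>z. U (\<phi> (fst z), \<phi> (snd z))) c"
  unfolding cut_le_def
proof safe
  fix S T assume "S \<in> sets unif" "T \<in> sets unif"
  then have [measurable]: "S \<in> sets borel" "T \<in> sets borel" by auto
  obtain \<psi> where \<psi>: "mp \<phi>" "mp \<psi>" "AE x in unif. \<psi> (\<phi> x) = x"
    using \<phi> by (auto simp: mp_iso_def)
  note [measurable] = \<psi>(1,2)[THEN mp_measurable]
  have "(\<integral>z. indicator S (fst z) * indicator T (snd z) * U (\<phi> (fst z), \<phi> (snd z)) \<partial>(unif \<Otimes>\<^sub>M unif)) =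
    (\<integral>z. indicator S (\<psi> (\<phi> (fst z))) * indicator T (\<psi> (\<phi> (snd z))) * U (\<phi> (fst z), \<phi> (snd z)) \<partial>(unif \<Otimes>\<^sub>M unif))"
  proof (rule integral_cong_AE)
    show "AE z in unif \<Otimes>\<^sub>M unif. indicator S (fst z) * indicator T (snd z) * U (\<phi> (fst z), \<phi> (snd z)) =
      indicator S (\<psi> (\<phi> (fst z))) * indicator T (\<psi> (\<phi> (snd z))) * U (\<phi> (fst z), \<phi> (snd z))"
      using AE_unif2[OF \<psi>(3)] by (rule eventually_mono) simp
  qed measurable
  also have "\<dots> = (\<integral>z. indicator S (\<psi> (fst z)) * indicator T (\<psi> (snd z)) * U z \<partial>(unif \<Otimes>\<^sub>M unif))"
    using mp_integral2[OF \<psi>(1), of "\<lambda>z. indicator S (\<psi> (fst z)) * indicator T (\<psi> (snd z)) * U z"] by simp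
  also have "\<dots> = (\<integral>z. indicator (\<psi> -` S) (fst z) * indicator (\<psi> -` T) (snd z) * U z \<partial>(unif \<Otimes>\<^sub>M unif))"
    by (simp add: indicator_def)
  finally show "\<bar>\<integral>z. indicator S (fst z) * indicator T (snd z) * U (\<phi> (fst z), \<phi> (snd z)) \<partial>(unif \<Otimes>\<^sub>M unif)\<bar> \<le> c"
    using c measurable_sets_borel[of \<psi> borel S] measurable_sets_borel[of \<psi> borel T] by (simp add: cut_le_def)
qed

text \<open>An upper bound for the cut distance, with the L^1 norm in place of the signal cut norm.
  A relation needs no discussion of whether an infimum is attained. The map always acts on the
  second pair, so symmetry is not built in; where both orders are wanted, both are stated.\<close>

definition dist_le :: "real \<Rightarrow> (real \<times> real \<Rightarrow> real) \<Rightarrow> (real \<Rightarrow> real) \<Rightarrow> (real \<times> real \<Rightarrow> real) \<Rightarrow> (real \<Rightarrow> real) \<Rightarrow> bool" where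
  "dist_le c W f V g \<longleftrightarrow> (\<exists>\<phi> c1. mp_iso \<phi> \<and> cut_le unif (\<lambda>z. W z - V (\<phi> (fst z), \<phi> (snd z))) c1 \<and>
     c1 + (\<integral>x. \<bar>f x - g (\<phi> x)\<bar> \<partial>unif) \<le> c)"

definition borel_gs :: "real \<Rightarrow> (real \<times> real \<Rightarrow> real) \<Rightarrow> (real \<Rightarrow> real) \<Rightarrow> bool" where
  "borel_gs r W f \<longleftrightarrow> W \<in> borel_measurable (borel \<Otimes>\<^sub>M borel) \<and> (\<forall>z. 0 \<le> W z \<and> W z \<le> 1) \<and>
     f \<in> borel_measurable borel \<and> (\<forall>x. \<bar>f x\<bar> \<le> r)"

lemma borel_gs_radius_nonneg: "borel_gs r W f \<Longrightarrow> 0 \<le> r"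
  by (auto simp: borel_gs_def dest: spec[of _ 0])

lemma dist_le_mono: "dist_le c W f V g \<Longrightarrow> c \<le> d \<Longrightarrow> dist_le d W f V g"
  unfolding dist_le_def by (meson order_trans)

lemma dist_le_nonneg: "dist_le c W f V g \<Longrightarrow> 0 \<le> c"
  unfolding dist_le_def using cut_le_nonneg
  by (smt (verit) Bochner_Integration.integral_nonneg)

lemma dist_le_trans:
  assumes 1: "borel_gs r W f" and 2: "borel_gs r V g" and 3: "borel_gs r X h"
    and d1: "dist_le c W f V g" and d2: "dist_le d V g X h"
  shows "dist_le (c + d) W f X h"
proof -
  obtain \<phi> c1 where \<phi>: "mp_iso \<phi>" "cut_le unif (\<lambda>z. W z - V (\<phi> (fst z), \<phi> (snd z))) c1"
    "c1 + (\<integral>x. \<bar>f x - g (\<phi> x)\<bar> \<partial>unif) \<le> c" using d1 by (auto simp: dist_le_def)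
  obtain \<psi> d1 where \<psi>: "mp_iso \<psi>" "cut_le unif (\<lambda>z. V z - X (\<psi> (fst z), \<psi> (snd z))) d1"
    "d1 + (\<integral>x. \<bar>g x - h (\<psi> x)\<bar> \<partial>unif) \<le> d" using d2 by (auto simp: dist_le_def)
  have mm: "mp \<phi>" "mp \<psi>" using \<phi> \<psi> by (auto simp: mp_iso_def)
  note [measurable] = mm[THEN mp_measurable]
  have [measurable]: "W \<in> borel_measurable (borel \<Otimes>\<^sub>M borel)" "V \<in> borel_measurable (borel \<Otimes>\<^sub>M borel)" "X \<in> borel_measurable (borel \<Otimes>\<^sub>M borel)"
    "f \<in> borel_measurable borel" "g \<in> borel_measurable borel" "h \<in> borel_measurable borel"
    using 1 2 3 by (auto simp: borel_gs_def)
  have b: "\<bar>W z\<bar> \<le> 1" "\<bar>V z\<bar> \<le> 1" "\<bar>X z\<bar> \<le> 1" for z using 1 2 3 by (auto simp: borel_gs_def simp del: split_paired_All)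
  have b': "\<bar>f x\<bar> \<le> r" "\<bar>g x\<bar> \<le> r" "\<bar>h x\<bar> \<le> r" for x using 1 2 3 by (auto simp: borel_gs_def)
  let ?\<chi> = "\<lambda>x. \<psi> (\<phi> x)"
  have VX: "cut_le unif (\<lambda>z. V (\<phi> (fst z), \<phi> (snd z)) - X (?\<chi> (fst z), ?\<chi> (snd z))) d1"
    using cut_le_mp_iso[OF \<phi>(1) _ \<psi>(2)] by simp
  have "cut_le unif (\<lambda>z. (W z - V (\<phi> (fst z), \<phi> (snd z))) + (V (\<phi> (fst z), \<phi> (snd z)) - X (?\<chi> (fst z), ?\<chi> (snd z)))) (c1 + d1)"
  proof (rule cut_le_add[where K=2 and L=2, OF prob_space_unif _ _ _ _ \<phi>(2) VX])
    fix z :: "real \<times> real"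
    show "\<bar>W z - V (\<phi> (fst z), \<phi> (snd z))\<bar> \<le> 2"
      "\<bar>V (\<phi> (fst z), \<phi> (snd z)) - X (?\<chi> (fst z), ?\<chi> (snd z))\<bar> \<le> 2"
      using b(1)[of z] b(2)[of "(\<phi> (fst z), \<phi> (snd z))"] b(3)[of "(?\<chi> (fst z), ?\<chi> (snd z))"] by linarith+
  qed measurable
  then have "cut_le unif (\<lambda>z. W z - X (?\<chi> (fst z), ?\<chi> (snd z))) (c1 + d1)" by simp
  moreover have "(\<integral>x. \<bar>f x - h (?\<chi> x)\<bar> \<partial>unif) \<le> (\<integral>x. \<bar>f x - g (\<phi> x)\<bar> \<partial>unif) + (\<integral>x. \<bar>g x - h (\<psi> x)\<bar> \<partial>unif)"
  proof -
    have i: "integrable unif (\<lambda>x. \<bar>f x - g (\<phi> x)\<bar>)" "integrable unif (\<lambda>x. \<bar>g (\<phi> x) - h (?\<chi> x)\<bar>)"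
       "integrable unif (\<lambda>x. \<bar>f x - h (?\<chi> x)\<bar>)"
      by (rule unif.integrable_bounded[where K="2*r"], measurable, rule abs_abs_diff_le, rule b', rule b')+
    have "(\<integral>x. \<bar>f x - h (?\<chi> x)\<bar> \<partial>unif) \<le> (\<integral>x. \<bar>f x - g (\<phi> x)\<bar> + \<bar>g (\<phi> x) - h (?\<chi> x)\<bar> \<partial>unif)"
      by (rule integral_mono) (use i in auto)
    also have "\<dots> = (\<integral>x. \<bar>f x - g (\<phi> x)\<bar> \<partial>unif) + (\<integral>x. \<bar>g (\<phi> x) - h (?\<chi> x)\<bar> \<partial>unif)"
      using i by simp
    also have "(\<integral>x. \<bar>g (\<phi> x) - h (?\<chi> x)\<bar> \<partial>unif) = (\<integral>x. \<bar>g x - h (\<psi> x)\<bar> \<partial>unif)"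
      by (rule mp_integral[OF mm(1)]) measurable
    finally show ?thesis .
  qed
  ultimately show ?thesis unfolding dist_le_def using mp_iso_comp[OF \<phi>(1) \<psi>(1)] \<phi>(3) \<psi>(3)
    by (intro exI[of _ ?\<chi>] exI[of _ "c1 + d1"]) auto
qed

text \<open>Both objects are near step functions with the same values \<open>v\<close> and
  \<open>s\<close> and differ only in their labellings. Once these are aligned they disagree on a
  set E of measure at most the sum. The kernels then differ only over E in one of the two variables,
  which costs twice that measure, and the signals differ by at most 2 R on E.\<close>

lemma dist_le_common_step:
  fixes lA lB :: "real \<Rightarrow> nat" and v :: "nat \<Rightarrow> nat \<Rightarrow> real" and s :: "nat \<Rightarrow> real"
  assumes A: "borel_gs r A a" and B: "borel_gs r B b"
    and lA: "step_labels borel m lA v" and lB: "step_labels borel m lB v"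
    and s: "\<And>i. \<bar>s i\<bar> \<le> R"
    and cA: "cut_le unif (\<lambda>z. A z - v (lA (fst z)) (lA (snd z))) \<alpha>"
    and cB: "cut_le unif (\<lambda>z. B z - v (lB (fst z)) (lB (snd z))) \<beta>"
    and sA: "\<And>x. \<bar>a x - s (lA x)\<bar> \<le> \<delta>" and sB: "\<And>x. \<bar>b x - s (lB x)\<bar> \<le> \<delta>"
  shows "dist_le (\<alpha> + \<beta> + 2 * \<delta> + (2 + 2 * R) * (\<Sum>j<m. \<bar>measure unif {x. lA x < j} - measure unif {x. lB x < j}\<bar>)) A a B b"
proof -
  define D where "D = (\<Sum>j<m. \<bar>measure unif {x. lA x < j} - measure unif {x. lB x < j}\<bar>)"
  have [measurable]: "lA \<in> measurable borel (count_space UNIV)" "lB \<in> measurable borel (count_space UNIV)"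
    and lt: "\<And>x. lA x < m" "\<And>x. lB x < m" and v: "\<And>p q. 0 \<le> v p q" "\<And>p q. v p q \<le> 1"
    using lA lB by (auto simp: step_labels_def)
  have [measurable]: "A \<in> borel_measurable (borel \<Otimes>\<^sub>M borel)" "B \<in> borel_measurable (borel \<Otimes>\<^sub>M borel)"
    "a \<in> borel_measurable borel" "b \<in> borel_measurable borel"
    using A B by (auto simp: borel_gs_def)
  have AB: "\<And>z. 0 \<le> A z" "\<And>z. A z \<le> 1" "\<And>z. 0 \<le> B z" "\<And>z. B z \<le> 1"
    and ab: "\<And>x. \<bar>a x\<bar> \<le> r" "\<And>x. \<bar>b x\<bar> \<le> r" using A B by (auto simp: borel_gs_def)
  have R0: "0 \<le> R" using s[of 0] by linarith
  obtain \<phi> where \<phi>: "mp_iso \<phi>" and D: "measure unif {x. lA x \<noteq> lB (\<phi> x)} \<le> D"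
    using rearrange_labels[of lA lB m] lt by (auto simp: D_def)
  have [measurable]: "\<phi> \<in> borel_measurable borel" using \<phi> by (intro mp_measurable mp_iso_mp)
  define E where "E = {x. lA x \<noteq> lB (\<phi> x)}"
  have [measurable]: "E \<in> sets borel" using sets_labels_neq[of lA borel "\<lambda>x. lB (\<phi> x)"] by (simp add: E_def)
  have DE: "(\<integral>x. indicator E x \<partial>unif) \<le> D" using D by (simp add: E_def)
  define VA where "VA = (\<lambda>z. v (lA (fst z)) (lA (snd z)))"
  define VB where "VB = (\<lambda>z. v (lB (fst z)) (lB (snd z)))"
  have [measurable]: "VA \<in> borel_measurable (borel \<Otimes>\<^sub>M borel)" "VB \<in> borel_measurable (borel \<Otimes>\<^sub>M borel)" unfolding VA_def VB_def by measurable
  have VAB: "\<And>z. 0 \<le> VA z" "\<And>z. VA z \<le> 1" "\<And>z. 0 \<le> VB z" "\<And>z. VB z \<le> 1" by (auto simp: VA_def VB_def v)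
  define \<Phi> where "\<Phi> = (\<lambda>z. (\<phi> (fst z), \<phi> (snd z)))"
  have [measurable]: "\<Phi> \<in> measurable (borel \<Otimes>\<^sub>M borel) (borel \<Otimes>\<^sub>M borel)" unfolding \<Phi>_def by measurable
  have c1: "cut_le unif (\<lambda>z. A z - VA z) \<alpha>" using cA by (simp add: VA_def)
  have c2: "cut_le unif (\<lambda>z. VA z - VB (\<Phi> z)) (2 * D)"
  proof (rule cut_le_L1[OF prob_space_unif])
    have bd: "\<bar>VA z - VB (\<Phi> z)\<bar> \<le> 1" for z using VAB(1,2)[of z] VAB(3,4)[of "\<Phi> z"] by auto
    then show i: "integrable (unif \<Otimes>\<^sub>M unif) (\<lambda>z. \<bar>VA z - VB (\<Phi> z)\<bar>)"
      by (intro unif2.integrable_bounded[where K=1]) auto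
    have ind: "\<bar>indicator E x :: real\<bar> \<le> 1" for x by (simp add: indicator_def)
    have ie1: "integrable (unif \<Otimes>\<^sub>M unif) (\<lambda>z. indicator E (fst z) :: real)" "integrable (unif \<Otimes>\<^sub>M unif) (\<lambda>z. indicator E (snd z) :: real)"
      by (rule unif2.integrable_bounded[OF _ ind], measurable)+
    have "(\<integral>z. \<bar>VA z - VB (\<Phi> z)\<bar> \<partial>(unif \<Otimes>\<^sub>M unif)) \<le> (\<integral>z. indicator E (fst z) + indicator E (snd z) \<partial>(unif \<Otimes>\<^sub>M unif))"
    proof (rule integral_mono[OF i])
      show "integrable (unif \<Otimes>\<^sub>M unif) (\<lambda>z. indicator E (fst z) + indicator E (snd z) :: real)" using ie1 by simp
      fix z :: "real \<times> real"
      show "\<bar>VA z - VB (\<Phi> z)\<bar> \<le> indicator E (fst z) + indicator E (snd z)"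
        using bd[of z] by (auto simp: indicator_def E_def VA_def VB_def \<Phi>_def)
    qed
    also have "\<dots> = (\<integral>z. indicator E (fst z) \<partial>(unif \<Otimes>\<^sub>M unif)) + (\<integral>z. indicator E (snd z) \<partial>(unif \<Otimes>\<^sub>M unif))"
      using ie1 by simp
    also have "(\<integral>z. indicator E (fst z) \<partial>(unif \<Otimes>\<^sub>M unif)) = (\<integral>x. indicator E x \<partial>unif :: real)"
      using unif2.integral_fst'[OF ie1(1)] unif.prob_space by simp
    also have "(\<integral>z. indicator E (snd z) \<partial>(unif \<Otimes>\<^sub>M unif)) = (\<integral>x. indicator E x \<partial>unif :: real)"
      using unif2.integral_fst'[OF ie1(2)] unif.prob_space by simp
    finally show "(\<integral>z. \<bar>VA z - VB (\<Phi> z)\<bar> \<partial>(unif \<Otimes>\<^sub>M unif)) \<le> 2 * D" using DE by linarith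
  qed
  have c3: "cut_le unif (\<lambda>z. VB (\<Phi> z) - B (\<Phi> z)) \<beta>"
  proof -
    have "cut_le unif (\<lambda>z. VB z - B z) \<beta>" using cB cut_le_uminus[of unif "\<lambda>z. B z - VB z" \<beta>] by (simp add: VB_def)
    from cut_le_mp_iso[OF \<phi> _ this] show ?thesis by (simp add: \<Phi>_def)
  qed
  have "cut_le unif (\<lambda>z. (A z - VA z) + (VA z - VB (\<Phi> z)) + (VB (\<Phi> z) - B (\<Phi> z))) (\<alpha> + 2 * D + \<beta>)"
  proof (rule cut_le_add[where K=1 and L=1, OF prob_space_unif _ _ _ _ cut_le_add[where K=1 and L=1, OF prob_space_unif _ _ _ _ c1 c2] c3])
    fix z
    show "\<bar>A z - VA z\<bar> \<le> 1" "\<bar>VA z - VB (\<Phi> z)\<bar> \<le> 1" "\<bar>VB (\<Phi> z) - B (\<Phi> z)\<bar> \<le> 1" "\<bar>A z - VA z + (VA z - VB (\<Phi> z))\<bar> \<le> 1"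
      using AB(1,2)[of z] AB(3,4)[of "\<Phi> z"] VAB(1,2)[of z] VAB(3,4)[of "\<Phi> z"] by linarith+
  qed measurable
  then have "cut_le unif (\<lambda>z. A z - B (\<phi> (fst z), \<phi> (snd z))) (\<alpha> + 2 * D + \<beta>)" by (simp add: \<Phi>_def)
  moreover have "(\<integral>x. \<bar>a x - b (\<phi> x)\<bar> \<partial>unif) \<le> 2 * \<delta> + 2 * R * D"
  proof -
    have ie: "integrable unif (indicator E :: real \<Rightarrow> real)" by (intro unif.integrable_bounded[where K=1]) (auto simp: indicator_def)
    have "(\<integral>x. \<bar>a x - b (\<phi> x)\<bar> \<partial>unif) \<le> (\<integral>x. 2 * \<delta> + 2 * R * indicator E x \<partial>unif)"
    proof (rule integral_mono)
      show "integrable unif (\<lambda>x. \<bar>a x - b (\<phi> x)\<bar>)"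
        by (rule unif.integrable_bounded[OF _ abs_abs_diff_le[OF ab]]) measurable
      show "integrable unif (\<lambda>x. 2 * \<delta> + 2 * R * indicator E x)" using ie by simp
      fix x
      have 1: "\<bar>s (lA x) - s (lB (\<phi> x))\<bar> \<le> 2 * R * indicator E x"
        using s[of "lA x"] s[of "lB (\<phi> x)"] by (auto simp: E_def indicator_def)
      show "\<bar>a x - b (\<phi> x)\<bar> \<le> 2 * \<delta> + 2 * R * indicator E x"
        using sA[of x] sB[of "\<phi> x"] 1 by linarith
    qed
    also have "\<dots> = 2 * \<delta> + 2 * R * (\<integral>x. indicator E x \<partial>unif)" using ie unif.prob_space by simp
    also have "\<dots> \<le> 2 * \<delta> + 2 * R * D" using DE R0 by (intro add_left_mono mult_left_mono) auto
    finally show ?thesis .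
  qed
  ultimately show ?thesis unfolding dist_le_def D_def[symmetric] using \<phi>
    by (intro exI[of _ \<phi>] exI[of _ "\<alpha> + 2 * D + \<beta>"]) (auto simp: algebra_simps)
qed

section \<open>Sampled graphs\<close>

definition vertex_pairs :: "nat \<Rightarrow> nat set set" where
  "vertex_pairs k = {e. e \<subseteq> {1..k} \<and> card e = 2}"

definition edge_weight :: "(real \<times> real \<Rightarrow> real) \<Rightarrow> (nat \<Rightarrow> real) \<Rightarrow> nat set \<Rightarrow> real" where
  "edge_weight W x e = W (x (Min e), x (Max e))"

text \<open>The probability that the random graph is exactly E, given the points x: pairs are joined
  independently, the pair e with probability \<open>edge_weight W x e\<close>. These weights on
  finitely many graphs stand in for a measure on graphs.\<close>

definition edge_prob :: "nat \<Rightarrow> (real \<times> real \<Rightarrow> real) \<Rightarrow> (nat \<Rightarrow> real) \<Rightarrow> nat set set \<Rightarrow> real" where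
  "edge_prob k W x E = (\<Prod>e\<in>E. edge_weight W x e) * (\<Prod>e\<in>vertex_pairs k - E. 1 - edge_weight W x e)"

lemma finite_vertex_pairs [simp]: "finite (vertex_pairs k)"
  by (rule finite_subset[of _ "Pow {1..k}"]) (auto simp: vertex_pairs_def)

lemma doubleton_in_vertex_pairs:
  "i \<in> {1..k} \<Longrightarrow> j \<in> {1..k} \<Longrightarrow> i \<noteq> j \<Longrightarrow> {i, j} \<in> vertex_pairs k"
  by (auto simp: vertex_pairs_def)

lemma edge_weight_doubleton:
  assumes "\<And>s t. W (s, t) = W (t, s)"
  shows "edge_weight W x {i, j} = W (x i, x j)"
  using assms by (cases "i \<le> j") (auto simp: edge_weight_def min_def max_def)

text \<open>Independence of the edges: with \<open>g e b\<close> the contribution of the pair e when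
  its status is b, the expectation of the product over pairs is the product of the
  expectations.\<close>

lemma sum_Pow_prod:
  fixes w :: "'a \<Rightarrow> real" and g :: "'a \<Rightarrow> bool \<Rightarrow> real"
  assumes "finite A"
  shows "(\<Sum>E\<in>Pow A. (\<Prod>e\<in>E. w e) * (\<Prod>e\<in>A - E. 1 - w e) * (\<Prod>e\<in>A. g e (e \<in> E))) =
    (\<Prod>e\<in>A. w e * g e True + (1 - w e) * g e False)"
proof -
  have "(\<Prod>e\<in>A. g e (e \<in> E)) = (\<Prod>e\<in>E. g e True) * (\<Prod>e\<in>A - E. g e False)" if "E \<subseteq> A" for E
  proof -
    have "(\<Prod>e\<in>A. g e (e \<in> E)) = (\<Prod>e\<in>A - E. g e (e \<in> E)) * (\<Prod>e\<in>E. g e (e \<in> E))"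
      by (rule prod.subset_diff) (use that assms in auto)
    also have "\<dots> = (\<Prod>e\<in>A - E. g e False) * (\<Prod>e\<in>E. g e True)"
      by (intro arg_cong2[of _ _ _ _ "(*)"] prod.cong) auto
    finally show ?thesis by simp
  qed
  then have "(\<Sum>E\<in>Pow A. (\<Prod>e\<in>E. w e) * (\<Prod>e\<in>A - E. 1 - w e) * (\<Prod>e\<in>A. g e (e \<in> E))) =
    (\<Sum>E\<in>Pow A. (\<Prod>e\<in>E. w e * g e True) * (\<Prod>e\<in>A - E. (1 - w e) * g e False))"
    by (intro sum.cong) (auto simp: prod.distrib)
  also have "\<dots> = (\<Prod>e\<in>A. w e * g e True + (1 - w e) * g e False)"
    using assms by (rule prod_add[symmetric])
  finally show ?thesis .
qed

lemma sum_edge_prob: "(\<Sum>E\<in>Pow (vertex_pairs k). edge_prob k W x E) = 1"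
  using sum_Pow_prod[of "vertex_pairs k" "edge_weight W x" "\<lambda>_ _. 1"] by (simp add: edge_prob_def)

lemma edge_prob_nonneg:
  assumes "\<And>z. 0 \<le> W z" "\<And>z. W z \<le> 1"
  shows "0 \<le> edge_prob k W x E"
  unfolding edge_prob_def using assms by (intro mult_nonneg_nonneg prod_nonneg) (auto simp: edge_weight_def)

definition adj_dev :: "(real \<Rightarrow> real \<Rightarrow> real) \<Rightarrow> (nat \<Rightarrow> real) \<Rightarrow> nat set set \<Rightarrow> nat \<Rightarrow> nat \<Rightarrow> real" where
  "adj_dev V x E i j = of_bool ({i, j} \<in> E) - V (x i) (x j)"

text \<open>Four distinct vertices give four distinct pairs, which are sampled independently, so the
  expectation factors and each factor becomes W - V. With coinciding vertices a pair could occur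
  twice; such tuples are later treated as an error term.\<close>

lemma sum_edge_prob_four_cycle:
  assumes sym: "\<And>s t. W (s, t) = W (t, s)"
    and ijpq: "i \<in> {1..k}" "j \<in> {1..k}" "p \<in> {1..k}" "q \<in> {1..k}" "distinct [i, j, p, q]"
  shows "(\<Sum>E\<in>Pow (vertex_pairs k). edge_prob k W x E *
      (adj_dev V x E i j * adj_dev V x E p j * adj_dev V x E i q * adj_dev V x E p q)) =
    (W (x i, x j) - V (x i) (x j)) * (W (x p, x j) - V (x p) (x j)) *
    (W (x i, x q) - V (x i) (x q)) * (W (x p, x q) - V (x p) (x q))"
proof -
  define C where "C = {{i, j}, {p, j}, {i, q}, {p, q}}"
  have C: "C \<subseteq> vertex_pairs k" using ijpq by (auto simp: C_def intro!: doubleton_in_vertex_pairs)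
  have ne: "{i, j} \<noteq> {p, j}" "{i, j} \<noteq> {i, q}" "{i, j} \<noteq> {p, q}" "{p, j} \<noteq> {i, q}" "{p, j} \<noteq> {p, q}" "{i, q} \<noteq> {p, q}"
    using ijpq(5) by (auto simp: doubleton_eq_iff)
  define g where "g = (\<lambda>e b. if e = {i, j} then of_bool b - V (x i) (x j) else
    if e = {p, j} then of_bool b - V (x p) (x j) else
    if e = {i, q} then of_bool b - V (x i) (x q) else
    if e = {p, q} then of_bool b - V (x p) (x q) else 1)"
  have red: "(\<Prod>e\<in>vertex_pairs k. h e) = h {i, j} * h {p, j} * h {i, q} * h {p, q}"
    if "\<And>e. e \<notin> C \<Longrightarrow> h e = 1" for h :: "nat set \<Rightarrow> real"
  proof -
    have "(\<Prod>e\<in>vertex_pairs k. h e) = (\<Prod>e\<in>C. h e)"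
      by (rule prod.mono_neutral_right) (use C that in auto)
    also have "\<dots> = h {i, j} * h {p, j} * h {i, q} * h {p, q}"
      unfolding C_def using ne by simp
    finally show ?thesis .
  qed
  have g1: "g e b = 1" if "e \<notin> C" for e b using that by (auto simp: g_def C_def)
  have gv: "g {i, j} b = of_bool b - V (x i) (x j)" "g {p, j} b = of_bool b - V (x p) (x j)"
    "g {i, q} b = of_bool b - V (x i) (x q)" "g {p, q} b = of_bool b - V (x p) (x q)" for b
    unfolding g_def using ne by simp_all
  have "(\<Sum>E\<in>Pow (vertex_pairs k). edge_prob k W x E *
      (adj_dev V x E i j * adj_dev V x E p j * adj_dev V x E i q * adj_dev V x E p q)) =
    (\<Sum>E\<in>Pow (vertex_pairs k). edge_prob k W x E * (\<Prod>e\<in>vertex_pairs k. g e (e \<in> E)))"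
    by (intro sum.cong refl) (simp add: red g1 gv adj_dev_def)
  also have "\<dots> = (\<Prod>e\<in>vertex_pairs k. edge_weight W x e * g e True + (1 - edge_weight W x e) * g e False)"
    unfolding edge_prob_def by (rule sum_Pow_prod) simp
  also have "\<dots> = (W (x i, x j) - V (x i) (x j)) * (W (x p, x j) - V (x p) (x j)) *
    (W (x i, x q) - V (x i) (x q)) * (W (x p, x q) - V (x p) (x q))"
    by (subst red) (simp_all add: g1 gv edge_weight_doubleton[of W, OF sym] algebra_simps)
  finally show ?thesis .
qed

section \<open>The 4-cycle density and bilinear forms of a matrix\<close>

text \<open>This is the trace of the square of \<open>A^T A\<close> divided by k^4, where A may be
  asymmetric; for symmetric A it is the homomorphism density of the 4-cycle.\<close>

definition cycle_density :: "nat \<Rightarrow> (nat \<Rightarrow> nat \<Rightarrow> real) \<Rightarrow> real" where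
  "cycle_density k A = (\<Sum>i\<in>{1..k}. \<Sum>p\<in>{1..k}. \<Sum>j\<in>{1..k}. \<Sum>q\<in>{1..k}. A i j * A p j * A i q * A p q) / k ^ 4"

text \<open>Cauchy-Schwarz twice: over i, which removes \<sigma>, and then over pairs (j, q), which
  removes \<tau> and leaves the squared entries of \<open>A^T A\<close>. The weights contribute 1/k
  to the square and then 1/k^2 to the fourth power.\<close>

lemma bilinear_le_cycle_density:
  fixes A :: "nat \<Rightarrow> nat \<Rightarrow> real"
  assumes k: "k > 0" and \<sigma>: "\<And>i. \<bar>\<sigma> i\<bar> \<le> 1 / k" and \<tau>: "\<And>i. \<bar>\<tau> i\<bar> \<le> 1 / k"
  shows "(\<Sum>i\<in>{1..k}. \<Sum>j\<in>{1..k}. A i j * \<sigma> i * \<tau> j) ^ 4 \<le> cycle_density k A"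
proof -
  let ?I = "{1..k}"
  define X where "X = (\<Sum>i\<in>?I. \<Sum>j\<in>?I. A i j * \<sigma> i * \<tau> j)"
  define y where "y = (\<lambda>i. \<Sum>j\<in>?I. A i j * \<tau> j)"
  define Y where "Y = (\<Sum>i\<in>?I. (y i)\<^sup>2)"
  define B where "B = (\<lambda>z. \<Sum>i\<in>?I. A i (fst z) * A i (snd z))"
  define t where "t = (\<lambda>z. \<tau> (fst z) * \<tau> (snd z))"
  have sq: "a\<^sup>2 \<le> c\<^sup>2" if "\<bar>a\<bar> \<le> c" for a c :: real using that by (simp add: abs_le_square_iff[symmetric])
  have tb: "\<bar>t z\<bar> \<le> 1 / k * (1 / k)" for z unfolding t_def by (intro abs_mult_le \<tau>)
  have X: "X = (\<Sum>i\<in>?I. \<sigma> i * y i)" unfolding X_def y_def sum_distrib_left by (simp add: mult_ac)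
  have "X\<^sup>2 \<le> (\<Sum>i\<in>?I. (\<sigma> i)\<^sup>2) * Y" unfolding X Y_def by (rule Cauchy_Schwarz_ineq_sum)
  also have "\<dots> \<le> (\<Sum>i\<in>?I. (1 / k)\<^sup>2) * Y"
    using \<sigma> by (intro mult_right_mono sum_mono sq) (auto simp: Y_def sum_nonneg)
  also have "\<dots> = Y / k" using k by (simp add: power2_eq_square)
  finally have X2: "X\<^sup>2 \<le> Y / k" .
  have Y: "Y = (\<Sum>z\<in>?I \<times> ?I. t z * B z)"
  proof -
    have "Y = (\<Sum>i\<in>?I. \<Sum>j\<in>?I. \<Sum>q\<in>?I. \<tau> j * \<tau> q * (A i j * A i q))"
      unfolding Y_def y_def power2_eq_square sum_product by (simp add: mult_ac)
    also have "\<dots> = (\<Sum>j\<in>?I. \<Sum>i\<in>?I. \<Sum>q\<in>?I. \<tau> j * \<tau> q * (A i j * A i q))" by (rule sum.swap)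
    also have "\<dots> = (\<Sum>j\<in>?I. \<Sum>q\<in>?I. \<Sum>i\<in>?I. \<tau> j * \<tau> q * (A i j * A i q))" by (intro sum.cong refl sum.swap)
    also have "\<dots> = (\<Sum>z\<in>?I \<times> ?I. t z * B z)"
      by (subst sum.cartesian_product) (simp add: t_def B_def sum_distrib_left split_beta')
    finally show ?thesis .
  qed
  have "Y\<^sup>2 \<le> (\<Sum>z\<in>?I \<times> ?I. (t z)\<^sup>2) * (\<Sum>z\<in>?I \<times> ?I. (B z)\<^sup>2)" unfolding Y by (rule Cauchy_Schwarz_ineq_sum)
  also have "\<dots> \<le> (\<Sum>z\<in>?I \<times> ?I. (1 / k * (1 / k))\<^sup>2) * (\<Sum>z\<in>?I \<times> ?I. (B z)\<^sup>2)"
    by (intro mult_right_mono sum_mono sum_nonneg sq[OF tb]) simp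
  also have "(\<Sum>z\<in>?I \<times> ?I. (1 / k * (1 / k))\<^sup>2) = 1 / k\<^sup>2"
    using k by (simp add: power2_eq_square)
  also have "(\<Sum>z\<in>?I \<times> ?I. (B z)\<^sup>2) = (\<Sum>i\<in>?I. \<Sum>p\<in>?I. \<Sum>j\<in>?I. \<Sum>q\<in>?I. A i j * A p j * A i q * A p q)"
  proof -
    have "(\<Sum>z\<in>?I \<times> ?I. (B z)\<^sup>2) = (\<Sum>j\<in>?I. \<Sum>q\<in>?I. (B (j, q))\<^sup>2)"
      by (simp add: sum.cartesian_product)
    also have "\<dots> = (\<Sum>j\<in>?I. \<Sum>q\<in>?I. \<Sum>i\<in>?I. \<Sum>p\<in>?I. A i j * A p j * A i q * A p q)"
      unfolding B_def power2_eq_square sum_product by (simp add: mult_ac)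
    also have "\<dots> = (\<Sum>j\<in>?I. \<Sum>i\<in>?I. \<Sum>q\<in>?I. \<Sum>p\<in>?I. A i j * A p j * A i q * A p q)" by (intro sum.cong refl sum.swap)
    also have "\<dots> = (\<Sum>i\<in>?I. \<Sum>j\<in>?I. \<Sum>q\<in>?I. \<Sum>p\<in>?I. A i j * A p j * A i q * A p q)" by (rule sum.swap)
    also have "\<dots> = (\<Sum>i\<in>?I. \<Sum>j\<in>?I. \<Sum>p\<in>?I. \<Sum>q\<in>?I. A i j * A p j * A i q * A p q)" by (intro sum.cong refl sum.swap)
    also have "\<dots> = (\<Sum>i\<in>?I. \<Sum>p\<in>?I. \<Sum>j\<in>?I. \<Sum>q\<in>?I. A i j * A p j * A i q * A p q)" by (intro sum.cong refl sum.swap)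
    finally show ?thesis .
  qed
  finally have Y2: "Y\<^sup>2 \<le> (\<Sum>i\<in>?I. \<Sum>p\<in>?I. \<Sum>j\<in>?I. \<Sum>q\<in>?I. A i j * A p j * A i q * A p q) / k\<^sup>2" by simp
  have "X ^ 4 = (X\<^sup>2)\<^sup>2" by simp
  also have "\<dots> \<le> (Y / k)\<^sup>2" by (intro power_mono X2) simp
  also have "\<dots> = Y\<^sup>2 / k\<^sup>2" by (simp add: power_divide)
  also have "\<dots> \<le> (\<Sum>i\<in>?I. \<Sum>p\<in>?I. \<Sum>j\<in>?I. \<Sum>q\<in>?I. A i j * A p j * A i q * A p q) / k\<^sup>2 / k\<^sup>2"
    by (intro divide_right_mono Y2) simp
  also have "\<dots> = cycle_density k A" unfolding cycle_density_def by (simp add: power_add[symmetric])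
  finally show ?thesis by (simp add: X_def)
qed

lemma cycle_density_nonneg: "0 \<le> cycle_density k A"
proof (cases "k > 0")
  case True
  then show ?thesis using bilinear_le_cycle_density[of k "\<lambda>_. 0" "\<lambda>_. 0" A] by simp
qed (simp add: cycle_density_def)

section \<open>Vertices blown up to cells of the unit interval\<close>

text \<open>The index i with s in ((i-1)/k, i/k]. Points outside (0, 1] form a null set and receive
  the index 1, so that every real number lies in some cell.\<close>

definition cell :: "nat \<Rightarrow> real \<Rightarrow> nat" where
  "cell k s = (if 0 < s \<and> s \<le> 1 then nat \<lceil>k * s\<rceil> else 1)"

lemma cell_measurable [measurable]: "cell k \<in> measurable borel (count_space UNIV)"
  unfolding cell_def by measurable

lemma cell_in: "k > 0 \<Longrightarrow> cell k s \<in> {1..k}"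
proof -
  assume k: "k > 0"
  have "1 \<le> nat \<lceil>k * s\<rceil> \<and> nat \<lceil>k * s\<rceil> \<le> k" if "0 < s" "s \<le> 1"
  proof
    have "0 < k * s" using k that by simp
    then show "1 \<le> nat \<lceil>k * s\<rceil>" by linarith
    have "k * s \<le> real k" using that k by (simp add: mult_left_le)
    then show "nat \<lceil>k * s\<rceil> \<le> k" by linarith
  qed
  with k show ?thesis unfolding cell_def atLeastAtMost_iff by simp
qed

lemma measure_cell:
  assumes k: "k > 0" and i: "i \<in> {1..k}"
  shows "measure unif {s. cell k s = i} = 1 / k"
proof -
  have "measure unif {s. cell k s = i} = measure unif {(real i - 1) / k<..real i / k}"
  proof (rule measure_eq_AE)
    show "AE s in unif. s \<in> {s. cell k s = i} \<longleftrightarrow> s \<in> {(real i - 1) / k<..real i / k}"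
      using AE_unif_interior
    proof eventually_elim
      case (elim s)
      have "cell k s = i \<longleftrightarrow> nat \<lceil>k * s\<rceil> = i" using elim by (simp add: cell_def)
      also have "\<dots> \<longleftrightarrow> real i - 1 < k * s \<and> k * s \<le> real i" using i by (simp; linarith)
      also have "\<dots> \<longleftrightarrow> (real i - 1) / k < s \<and> s \<le> real i / k" using k by (simp add: field_simps)
      finally show ?case by simp
    qed
    have "{s \<in> space borel. cell k s = i} \<in> sets borel" by measurable
    then show "{s. cell k s = i} \<in> sets unif" by simp
  qed simp
  also have "{(real i - 1) / k<..real i / k} = {..real i / k} - {..(real i - 1) / k}" by auto
  also have "measure unif \<dots> = real i / k - (real i - 1) / k"
    using i k by (subst unif.finite_measure_Diff) (auto simp: measure_unif_atMost divide_right_mono)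
  also have "\<dots> = 1 / k" by (simp add: diff_divide_distrib)
  finally show ?thesis .
qed

lemma comp_cell_eq_sum:
  assumes "k > 0"
  shows "F (cell k s) = (\<Sum>i\<in>{1..k}. F i * indicator {s. cell k s = i} s :: real)"
proof -
  have "(\<Sum>i\<in>{1..k}. F i * indicator {s. cell k s = i} s) = (\<Sum>i\<in>{1..k}. if i = cell k s then F i else 0)"
    by (intro sum.cong) (auto simp: indicator_def)
  then show ?thesis using cell_in[OF assms, of s] by simp
qed

lemma sets_cell [measurable]: "{s. cell k s = i} \<in> sets borel"
proof -
  have "{s \<in> space borel. cell k s = i} \<in> sets borel" by measurable
  then show ?thesis by simp
qed

lemma measure_comp_cell:
  assumes "k > 0"
  shows "measure unif {s. P (cell k s)} = (\<Sum>i\<in>{1..k}. of_bool (P i)) / k"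
proof -
  have "measure unif {s. P (cell k s)} = measure unif (\<Union>i\<in>{i\<in>{1..k}. P i}. {s. cell k s = i})"
    using cell_in[OF assms] by (intro arg_cong[of _ _ "measure unif"]) auto
  also have "\<dots> = (\<Sum>i\<in>{i\<in>{1..k}. P i}. measure unif {s. cell k s = i})"
    by (rule unif.finite_measure_finite_Union) (auto simp: disjoint_family_on_def)
  also have "\<dots> = (\<Sum>i\<in>{i\<in>{1..k}. P i}. 1 / k)"
    by (intro sum.cong refl measure_cell[OF assms]) auto
  also have "\<dots> = (\<Sum>i\<in>{1..k}. of_bool (P i)) / k"
    by (simp add: of_bool_def sum.If_cases Int_def)
  finally show ?thesis .
qed

text \<open>The fourth root of the cycle density is linearised by \<open>t \<le> \<epsilon> + t\<^sup>4 / \<epsilon>\<^sup>3\<close>, so that the bound can be averaged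
  over samples.\<close>

lemma cut_le_comp_cell:
  fixes A :: "nat \<Rightarrow> nat \<Rightarrow> real"
  assumes k: "k > 0" and \<epsilon>: "0 < \<epsilon>"
  shows "cut_le unif (\<lambda>z. A (cell k (fst z)) (cell k (snd z))) (\<epsilon> + cycle_density k A / \<epsilon> ^ 3)"
  unfolding cut_le_def
proof safe
  fix S T assume "S \<in> sets unif" "T \<in> sets unif"
  then have [measurable]: "S \<in> sets borel" "T \<in> sets borel" by auto
  \<comment> \<open>The weight \<sigma> R i is the measure of the part of R inside cell i, hence at
    most 1/k, as the bilinear bound demands.\<close>
  define \<sigma> :: "real set \<Rightarrow> nat \<Rightarrow> real"
    where "\<sigma> = (\<lambda>R i. \<integral>s. indicator R s * indicator {s. cell k s = i} s \<partial>unif)"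
  have \<sigma>: "\<bar>\<sigma> R i\<bar> \<le> 1 / k" if i: "i \<in> {1..k}" and [measurable]: "R \<in> sets borel" for R i
  proof -
    have "\<sigma> R i = measure unif (R \<inter> {s. cell k s = i})" unfolding \<sigma>_def by (simp add: indicator_inter_arith[symmetric])
    also have "\<dots> \<le> measure unif {s. cell k s = i}" by (rule unif.finite_measure_mono) auto
    finally have "\<sigma> R i \<le> 1 / k" using measure_cell[OF k i] by simp
    moreover have "\<sigma> R i \<ge> 0" unfolding \<sigma>_def by simp
    ultimately show ?thesis by simp
  qed
  define X where "X = (\<integral>z. indicator S (fst z) * indicator T (snd z) * A (cell k (fst z)) (cell k (snd z)) \<partial>(unif \<Otimes>\<^sub>M unif))"
  have ind: "\<bar>indicator R s * indicator Q s :: real\<bar> \<le> 1" for R Q and s :: real by (simp add: indicator_def)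
  have prod: "(\<integral>z. g (fst z) * h (snd z) \<partial>(unif \<Otimes>\<^sub>M unif)) = (\<integral>x. g x \<partial>unif) * (\<integral>x. h x \<partial>unif)"
      "integrable (unif \<Otimes>\<^sub>M unif) (\<lambda>z. g (fst z) * h (snd z))"
    if [measurable]: "g \<in> borel_measurable borel" "h \<in> borel_measurable borel" and "\<And>x. \<bar>g x\<bar> \<le> 1" "\<And>x. \<bar>h x\<bar> \<le> 1"
    for g h :: "real \<Rightarrow> real"
  proof -
    show i: "integrable (unif \<Otimes>\<^sub>M unif) (\<lambda>z. g (fst z) * h (snd z))"
      by (rule unif2.integrable_bounded[OF _ abs_mult_le[OF that(3,4)]]) measurable
    show "(\<integral>z. g (fst z) * h (snd z) \<partial>(unif \<Otimes>\<^sub>M unif)) = (\<integral>x. g x \<partial>unif) * (\<integral>x. h x \<partial>unif)"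
      using unif2.integral_fst'[OF i] by simp
  qed
  have "X = (\<integral>z. (\<Sum>i\<in>{1..k}. \<Sum>j\<in>{1..k}. A i j * ((indicator S (fst z) * indicator {s. cell k s = i} (fst z)) *
      (indicator T (snd z) * indicator {s. cell k s = j} (snd z)))) \<partial>(unif \<Otimes>\<^sub>M unif))"
    unfolding X_def
  proof (rule Bochner_Integration.integral_cong[OF refl])
    fix z :: "real \<times> real"
    define J :: "nat \<Rightarrow> real \<Rightarrow> real" where "J = (\<lambda>i s. indicator {s. cell k s = i} s)"
    have J: "F (cell k s) = (\<Sum>i\<in>{1..k}. F i * J i s)" for F s
      unfolding J_def by (rule comp_cell_eq_sum[OF k])
    have "A (cell k (fst z)) (cell k (snd z)) = (\<Sum>i\<in>{1..k}. (\<Sum>j\<in>{1..k}. A i j * J j (snd z)) * J i (fst z))"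
      by (subst J[of "\<lambda>i. A i (cell k (snd z))"], subst J[of "\<lambda>j. A _ j"]) (rule refl)
    then show "indicator S (fst z) * indicator T (snd z) * A (cell k (fst z)) (cell k (snd z)) =
      (\<Sum>i\<in>{1..k}. \<Sum>j\<in>{1..k}. A i j * ((indicator S (fst z) * indicator {s. cell k s = i} (fst z)) *
      (indicator T (snd z) * indicator {s. cell k s = j} (snd z))))"
      unfolding J_def[symmetric] fun_cong[OF fun_cong[OF J_def], symmetric]
      by (simp add: sum_distrib_left sum_distrib_right mult_ac)
  qed
  also have "\<dots> = (\<Sum>i\<in>{1..k}. \<Sum>j\<in>{1..k}. A i j * (\<sigma> S i * \<sigma> T j))"
  proof -
    have m: "(\<lambda>s. indicator R s * indicator {s. cell k s = i} s :: real) \<in> borel_measurable borel" if [measurable]: "R \<in> sets borel" for R i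
      by measurable
    show ?thesis
      by (subst Bochner_Integration.integral_sum, intro Bochner_Integration.integrable_sum integrable_mult_right prod(2) m ind, simp_all)
        (subst Bochner_Integration.integral_sum, intro integrable_mult_right prod(2) m ind,
         simp_all add: \<sigma>_def prod(1)[OF m m ind ind])
  qed
  \<comment> \<open>The bilinear bound asks for small weights at every natural index; setting them
    to 0 outside {1..k} does not change the sums.\<close>
  finally have X: "X = (\<Sum>i\<in>{1..k}. \<Sum>j\<in>{1..k}. A i j * (if i \<in> {1..k} then \<sigma> S i else 0) * (if j \<in> {1..k} then \<sigma> T j else 0))"
    by (simp add: mult.assoc)
  have X4: "X ^ 4 \<le> cycle_density k A"
    unfolding X by (rule bilinear_le_cycle_density[OF k]) (auto simp: \<sigma>)
  have "\<bar>X\<bar> \<le> \<epsilon> + cycle_density k A / \<epsilon> ^ 3"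
  proof (cases "\<bar>X\<bar> \<le> \<epsilon>")
    case True
    then show ?thesis using cycle_density_nonneg[of k A] \<epsilon> by (simp add: add_increasing2)
  next
    case False
    have "\<bar>X\<bar> * \<epsilon> ^ 3 \<le> \<bar>X\<bar> * \<bar>X\<bar> ^ 3" using False \<epsilon> by (intro mult_left_mono power_mono) auto
    also have "\<dots> = X ^ 4" by (simp add: power4_eq_xxxx power3_eq_cube abs_mult[symmetric] mult.assoc[symmetric])
    finally have "\<bar>X\<bar> \<le> cycle_density k A / \<epsilon> ^ 3" using X4 \<epsilon> by (simp add: pos_le_divide_eq)
    then show ?thesis using \<epsilon> by simp
  qed
  then show "\<bar>\<integral>z. indicator S (fst z) * indicator T (snd z) * A (cell k (fst z)) (cell k (snd z)) \<partial>(unif \<Otimes>\<^sub>M unif)\<bar>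
    \<le> \<epsilon> + cycle_density k A / \<epsilon> ^ 3" by (simp add: X_def)
qed

section \<open>Expectations over sample points and random edges\<close>

abbreviation sample_space :: "nat \<Rightarrow> (nat \<Rightarrow> real) measure" where
  "sample_space k \<equiv> PiM {1..k} (\<lambda>_. unif)"

definition sample_expect :: "nat \<Rightarrow> (real \<times> real \<Rightarrow> real) \<Rightarrow> (nat set set \<Rightarrow> (nat \<Rightarrow> real) \<Rightarrow> real) \<Rightarrow> real" where
  "sample_expect k W h = (\<integral>x. (\<Sum>E\<in>Pow (vertex_pairs k). edge_prob k W x E * h E x) \<partial>sample_space k)"

lemma prob_space_sample: "prob_space (sample_space k)"
  by (rule prob_space_PiM) (rule prob_space_unif)

lemma measurable_sample_component:
  "i \<in> {1..k} \<Longrightarrow> (\<lambda>x. x i) \<in> borel_measurable (sample_space k)"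
  using measurable_component_singleton[of i "{1..k}" "\<lambda>_. unif"] by (simp cong: measurable_cong_sets)

lemma integral_sum2:
  fixes f :: "'b \<Rightarrow> 'b \<Rightarrow> 'a \<Rightarrow> real"
  assumes "\<And>i j. i \<in> I \<Longrightarrow> j \<in> I \<Longrightarrow> integrable M (f i j)"
  shows "(\<integral>x. (\<Sum>i\<in>I. \<Sum>j\<in>I. f i j x) \<partial>M) = (\<Sum>i\<in>I. \<Sum>j\<in>I. \<integral>x. f i j x \<partial>M)"
proof -
  have "(\<integral>x. (\<Sum>i\<in>I. \<Sum>j\<in>I. f i j x) \<partial>M) = (\<Sum>i\<in>I. \<integral>x. (\<Sum>j\<in>I. f i j x) \<partial>M)"
    using assms by (intro Bochner_Integration.integral_sum Bochner_Integration.integrable_sum) auto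
  also have "\<dots> = (\<Sum>i\<in>I. \<Sum>j\<in>I. \<integral>x. f i j x \<partial>M)"
    using assms by (intro sum.cong refl Bochner_Integration.integral_sum) auto
  finally show ?thesis .
qed

lemma vertex_pairs_Min_Max:
  assumes "e \<in> vertex_pairs k"
  shows "Min e \<in> {1..k}" "Max e \<in> {1..k}" "Min e \<noteq> Max e" "e = {Min e, Max e}"
proof -
  obtain i j where "e = {i, j}" "i \<noteq> j" using assms by (auto simp: vertex_pairs_def card_2_iff)
  then show "Min e \<in> {1..k}" "Max e \<in> {1..k}" "Min e \<noteq> Max e" "e = {Min e, Max e}"
    using assms by (auto simp: vertex_pairs_def min_def max_def)
qed

lemma measurable_edge_weight:
  assumes [measurable]: "W \<in> borel_measurable (borel \<Otimes>\<^sub>M borel)" and e: "e \<in> vertex_pairs k"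
  shows "(\<lambda>x. edge_weight W x e) \<in> borel_measurable (sample_space k)"
proof -
  have [measurable]: "(\<lambda>x. x (Min e)) \<in> borel_measurable (sample_space k)" "(\<lambda>x. x (Max e)) \<in> borel_measurable (sample_space k)"
    using vertex_pairs_Min_Max[OF e] by (blast intro: measurable_sample_component)+
  show ?thesis unfolding edge_weight_def by measurable
qed

lemma measurable_edge_prob:
  assumes "W \<in> borel_measurable (borel \<Otimes>\<^sub>M borel)" "E \<in> Pow (vertex_pairs k)"
  shows "(\<lambda>x. edge_prob k W x E) \<in> borel_measurable (sample_space k)"
  unfolding edge_prob_def using assms measurable_edge_weight[OF assms(1)]
  by (intro borel_measurable_times borel_measurable_prod borel_measurable_diff borel_measurable_const) auto

lemma sum_edge_prob_abs_le:
  assumes "\<And>z. 0 \<le> W z" "\<And>z. W z \<le> 1" and "\<And>E. E \<in> Pow (vertex_pairs k) \<Longrightarrow> \<bar>h E\<bar> \<le> K"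
  shows "\<bar>\<Sum>E\<in>Pow (vertex_pairs k). edge_prob k W x E * h E\<bar> \<le> K"
proof -
  have "\<bar>\<Sum>E\<in>Pow (vertex_pairs k). edge_prob k W x E * h E\<bar> \<le> (\<Sum>E\<in>Pow (vertex_pairs k). edge_prob k W x E * K)"
  proof (rule order_trans[OF sum_abs], rule sum_mono)
    fix E assume "E \<in> Pow (vertex_pairs k)"
    then show "\<bar>edge_prob k W x E * h E\<bar> \<le> edge_prob k W x E * K"
      using assms(3) edge_prob_nonneg[OF assms(1,2), where k=k and x=x and E=E] by (simp add: abs_mult mult_left_mono)
  qed
  also have "\<dots> = K" using sum_edge_prob[of k W x] by (simp add: sum_distrib_right[symmetric])
  finally show ?thesis .
qed

lemma integrable_edge_sum:
  assumes W: "W \<in> borel_measurable (borel \<Otimes>\<^sub>M borel)" "\<And>z. 0 \<le> W z" "\<And>z. W z \<le> 1"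
    and h: "\<And>E. E \<in> Pow (vertex_pairs k) \<Longrightarrow> h E \<in> borel_measurable (sample_space k)"
    and K: "\<And>E x. E \<in> Pow (vertex_pairs k) \<Longrightarrow> \<bar>h E x\<bar> \<le> K"
  shows "integrable (sample_space k) (\<lambda>x. \<Sum>E\<in>Pow (vertex_pairs k). edge_prob k W x E * h E x)"
proof (rule prob_space.integrable_bounded[OF prob_space_sample])
  show "(\<lambda>x. \<Sum>E\<in>Pow (vertex_pairs k). edge_prob k W x E * h E x) \<in> borel_measurable (sample_space k)"
    by (intro borel_measurable_sum borel_measurable_times measurable_edge_prob W h)
  show "\<bar>\<Sum>E\<in>Pow (vertex_pairs k). edge_prob k W x E * h E x\<bar> \<le> K" for x
    by (rule sum_edge_prob_abs_le) (use W K in auto)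
qed

lemma sample_expect_affine:
  assumes W: "W \<in> borel_measurable (borel \<Otimes>\<^sub>M borel)" "\<And>z. 0 \<le> W z" "\<And>z. W z \<le> 1"
    and h: "\<And>E. E \<in> Pow (vertex_pairs k) \<Longrightarrow> h E \<in> borel_measurable (sample_space k)"
    and K: "\<And>E x. E \<in> Pow (vertex_pairs k) \<Longrightarrow> \<bar>h E x\<bar> \<le> K"
    and g: "integrable (sample_space k) g"
  shows "sample_expect k W (\<lambda>E x. c * h E x + g x) = c * sample_expect k W h + (\<integral>x. g x \<partial>sample_space k)"
proof -
  have "(\<Sum>E\<in>Pow (vertex_pairs k). edge_prob k W x E * (c * h E x + g x)) =
    c * (\<Sum>E\<in>Pow (vertex_pairs k). edge_prob k W x E * h E x) + g x" for x
  proof -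
    have "(\<Sum>E\<in>Pow (vertex_pairs k). edge_prob k W x E * (c * h E x + g x)) =
      c * (\<Sum>E\<in>Pow (vertex_pairs k). edge_prob k W x E * h E x) + (\<Sum>E\<in>Pow (vertex_pairs k). edge_prob k W x E) * g x"
      by (simp add: distrib_left sum.distrib sum_distrib_left sum_distrib_right mult_ac)
    then show ?thesis by (simp add: sum_edge_prob)
  qed
  then show ?thesis unfolding sample_expect_def
    using integrable_edge_sum[OF W h K] g by simp
qed

lemma abs_adj_dev_le:
  assumes "\<And>s t. 0 \<le> V s t" "\<And>s t. V s t \<le> 1"
  shows "\<bar>adj_dev V x E i j\<bar> \<le> 1"
  using assms(1,2)[of "x i" "x j"] by (auto simp: adj_dev_def)

lemma abs_cycle_density_le:
  assumes "\<And>i j. \<bar>A i j\<bar> \<le> 1"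
  shows "\<bar>cycle_density k A\<bar> \<le> 1"
proof -
  have "cycle_density k A \<le> (\<Sum>i\<in>{1..k}. \<Sum>p\<in>{1..k}. \<Sum>j\<in>{1..k}. \<Sum>q\<in>{1..k}. 1) / k ^ 4"
    unfolding cycle_density_def
  proof (intro divide_right_mono sum_mono)
    fix i p j q
    have "\<bar>A i j * A p j * A i q * A p q\<bar> \<le> 1 * 1 * 1 * 1" by (intro abs_mult_le assms)
    then show "A i j * A p j * A i q * A p q \<le> 1" by simp
  qed simp
  also have "\<dots> \<le> 1" by (simp add: power4_eq_xxxx)
  finally show ?thesis using cycle_density_nonneg[of k A] by simp
qed

text \<open>For distinct indices the average over the edges is a product of four values of U = W -
  V. With U(x i, x j) as pivot, two of the other factors are free of x j and the third is free of x
  i, so the integral is at most 4 c. Each of the six possible coincidences of two indices occurs for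
  k^3 of the k^4 tuples, where the integrand is at most 1; this gives 6/k.\<close>

lemma sample_expect_cycle_density:
  assumes W[measurable]: "W \<in> borel_measurable (borel \<Otimes>\<^sub>M borel)" and W01: "\<And>z. 0 \<le> W z" "\<And>z. W z \<le> 1"
    and sym: "\<And>s t. W (s, t) = W (t, s)"
    and V[measurable]: "(\<lambda>z. V (fst z) (snd z)) \<in> borel_measurable (borel \<Otimes>\<^sub>M borel)"
    and V01: "\<And>s t. 0 \<le> V s t" "\<And>s t. V s t \<le> 1"
    and c: "cut_le unif (\<lambda>z. W z - V (fst z) (snd z)) c"
    and k: "k > 0"
  shows "sample_expect k W (\<lambda>E x. cycle_density k (adj_dev V x E)) \<le> 4 * c + 6 / k"
proof -
  let ?I = "{1..k}"
  interpret S: prob_space "sample_space k" by (rule prob_space_sample)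
  define T where "T = (\<lambda>i p j q E x. adj_dev V x E i j * adj_dev V x E p j * adj_dev V x E i q * adj_dev V x E p q)"
  define G where "G = (\<lambda>i p j q x. \<Sum>E\<in>Pow (vertex_pairs k). edge_prob k W x E * T i p j q E x)"
  have Vm: "(\<lambda>x. V (x i) (x j)) \<in> borel_measurable (sample_space k)" if "i \<in> ?I" "j \<in> ?I" for i j
  proof -
    note [measurable] = measurable_sample_component[OF that(1)] measurable_sample_component[OF that(2)]
    have "(\<lambda>x. (x i, x j)) \<in> measurable (sample_space k) (borel \<Otimes>\<^sub>M borel)" by measurable
    from measurable_compose[OF this V] show ?thesis by simp
  qed
  have Tm: "T i p j q E \<in> borel_measurable (sample_space k)" if "i \<in> ?I" "p \<in> ?I" "j \<in> ?I" "q \<in> ?I" for i p j q E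
    unfolding T_def adj_dev_def using that
    by (intro borel_measurable_times borel_measurable_diff borel_measurable_const Vm)
  have Tb: "\<bar>T i p j q E x\<bar> \<le> 1" for i p j q E x
  proof -
    have "\<bar>T i p j q E x\<bar> \<le> 1 * 1 * 1 * 1" unfolding T_def by (intro abs_mult_le abs_adj_dev_le V01)
    then show ?thesis by simp
  qed
  have Gi: "integrable (sample_space k) (G i p j q)" if "i \<in> ?I" "p \<in> ?I" "j \<in> ?I" "q \<in> ?I" for i p j q
    unfolding G_def by (rule integrable_edge_sum[OF W W01, where K=1]) (use Tm that Tb in auto)
  have Gb: "\<bar>\<integral>x. G i p j q x \<partial>sample_space k\<bar> \<le> 1" for i p j q
    by (rule S.integral_abs_le_const, unfold G_def, rule sum_edge_prob_abs_le) (use W01 Tb in auto)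
  have c0: "0 \<le> c" by (rule cut_le_nonneg) fact
  have bound: "(\<integral>x. G i p j q x \<partial>sample_space k) \<le> 4 * c + of_bool (i = p) + of_bool (i = j) + of_bool (i = q)
      + of_bool (p = j) + of_bool (p = q) + of_bool (j = q)"
    if I: "i \<in> ?I" "p \<in> ?I" "j \<in> ?I" "q \<in> ?I" for i p j q
  proof (cases "distinct [i, j, p, q]")
    case True
    define U where "U = (\<lambda>z. W z - V (fst z) (snd z))"
    have [measurable]: "U \<in> borel_measurable (borel \<Otimes>\<^sub>M borel)" unfolding U_def by measurable
    have U1: "\<bar>U z\<bar> \<le> 1" for z using W01[of z] V01[of "fst z" "snd z"] by (auto simp: U_def)
    note [measurable] = I[THEN measurable_sample_component]
    have "G i p j q x = (U (x p, x q) * U (x i, x q)) * U (x p, x j) * U (x i, x j)" for x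
      unfolding G_def T_def using sum_edge_prob_four_cycle[of W i k j p q x V] sym I True
      by (simp add: U_def mult_ac)
    moreover have "\<bar>\<integral>x. (U (x p, x q) * U (x i, x q)) * U (x p, x j) * U (x i, x j) \<partial>sample_space k\<bar> \<le> 4 * (1 * 1) * 1 * c"
    proof (rule pivot_bound[OF prob_space_unif _ I(1,3)])
      show "(\<lambda>x. U (x p, x q) * U (x i, x q)) \<in> borel_measurable (sample_space k)" by measurable
      show "(\<lambda>x. U (x p, x j)) \<in> borel_measurable (sample_space k)" by measurable
      show "U \<in> borel_measurable (unif \<Otimes>\<^sub>M unif)" by measurable
      show "cut_le unif U c" using c by (simp add: U_def)
      show "\<bar>U (x p, x q) * U (x i, x q)\<bar> \<le> 1 * 1" for x by (intro abs_mult_le U1)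
    qed (use True U1 in auto)
    ultimately have "(\<integral>x. G i p j q x \<partial>sample_space k) \<le> 4 * c" by simp
    then show ?thesis using True by simp
  next
    case False
    then show ?thesis using Gb[of i p j q] c0 by (auto simp: abs_le_iff of_bool_def)
  qed
  have "sample_expect k W (\<lambda>E x. cycle_density k (adj_dev V x E)) =
    (\<integral>x. (\<Sum>i\<in>?I. \<Sum>p\<in>?I. \<Sum>j\<in>?I. \<Sum>q\<in>?I. G i p j q x) / k ^ 4 \<partial>sample_space k)"
    unfolding sample_expect_def
  proof (rule Bochner_Integration.integral_cong[OF refl])
    fix x
    let ?P = "Pow (vertex_pairs k)" and ?e = "edge_prob k W x"
    have "(\<Sum>E\<in>?P. ?e E * cycle_density k (adj_dev V x E)) =
      (\<Sum>E\<in>?P. \<Sum>i\<in>?I. \<Sum>p\<in>?I. \<Sum>j\<in>?I. \<Sum>q\<in>?I. ?e E * T i p j q E x) / k ^ 4"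
      unfolding cycle_density_def T_def by (simp add: sum_distrib_left sum_divide_distrib)
    also have "(\<Sum>E\<in>?P. \<Sum>i\<in>?I. \<Sum>p\<in>?I. \<Sum>j\<in>?I. \<Sum>q\<in>?I. ?e E * T i p j q E x) =
      (\<Sum>i\<in>?I. \<Sum>E\<in>?P. \<Sum>p\<in>?I. \<Sum>j\<in>?I. \<Sum>q\<in>?I. ?e E * T i p j q E x)" by (rule sum.swap)
    also have "\<dots> = (\<Sum>i\<in>?I. \<Sum>p\<in>?I. \<Sum>E\<in>?P. \<Sum>j\<in>?I. \<Sum>q\<in>?I. ?e E * T i p j q E x)" by (intro sum.cong refl sum.swap)
    also have "\<dots> = (\<Sum>i\<in>?I. \<Sum>p\<in>?I. \<Sum>j\<in>?I. \<Sum>E\<in>?P. \<Sum>q\<in>?I. ?e E * T i p j q E x)" by (intro sum.cong refl sum.swap)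
    also have "\<dots> = (\<Sum>i\<in>?I. \<Sum>p\<in>?I. \<Sum>j\<in>?I. \<Sum>q\<in>?I. \<Sum>E\<in>?P. ?e E * T i p j q E x)" by (intro sum.cong refl sum.swap)
    finally show "(\<Sum>E\<in>?P. ?e E * cycle_density k (adj_dev V x E)) =
      (\<Sum>i\<in>?I. \<Sum>p\<in>?I. \<Sum>j\<in>?I. \<Sum>q\<in>?I. G i p j q x) / k ^ 4" by (simp add: G_def)
  qed
  also have "\<dots> = (\<Sum>i\<in>?I. \<Sum>p\<in>?I. \<Sum>j\<in>?I. \<Sum>q\<in>?I. (\<integral>x. G i p j q x \<partial>sample_space k)) / k ^ 4"
  proof -
    have "(\<integral>x. (\<Sum>i\<in>?I. \<Sum>p\<in>?I. \<Sum>j\<in>?I. \<Sum>q\<in>?I. G i p j q x) \<partial>sample_space k) =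
      (\<Sum>i\<in>?I. \<Sum>p\<in>?I. \<integral>x. (\<Sum>j\<in>?I. \<Sum>q\<in>?I. G i p j q x) \<partial>sample_space k)"
      by (intro integral_sum2 Bochner_Integration.integrable_sum Gi)
    also have "\<dots> = (\<Sum>i\<in>?I. \<Sum>p\<in>?I. \<Sum>j\<in>?I. \<Sum>q\<in>?I. (\<integral>x. G i p j q x \<partial>sample_space k))"
      by (intro sum.cong refl integral_sum2 Gi)
    finally show ?thesis by simp
  qed
  also have "\<dots> \<le> (\<Sum>i\<in>?I. \<Sum>p\<in>?I. \<Sum>j\<in>?I. \<Sum>q\<in>?I. 4 * c + of_bool (i = p) + of_bool (i = j) + of_bool (i = q)
      + of_bool (p = j) + of_bool (p = q) + of_bool (j = q)) / k ^ 4"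
    by (intro divide_right_mono sum_mono bound) auto
  also have "(\<Sum>i\<in>?I. \<Sum>p\<in>?I. \<Sum>j\<in>?I. \<Sum>q\<in>?I. 4 * c + of_bool (i = p) + of_bool (i = j) + of_bool (i = q)
      + of_bool (p = j) + of_bool (p = q) + of_bool (j = q)) = 4 * c * k ^ 4 + 6 * k ^ 3"
  proof -
    have 1: "(\<Sum>q\<in>?I. of_bool (i = q) :: real) = 1" if "i \<in> ?I" for i
    proof -
      have "(\<Sum>q\<in>?I. of_bool (i = q) :: real) = (\<Sum>q\<in>?I. if q = i then 1 else 0)" by (intro sum.cong) auto
      then show ?thesis using that by simp
    qed
    have 2: "(\<Sum>i\<in>?I. \<Sum>q\<in>?I. of_bool (i = q) :: real) = k"
      by (subst sum.cong[OF refl 1]) auto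
    show ?thesis
      by (simp add: sum.distrib 2 sum_distrib_left[symmetric] power4_eq_xxxx power3_eq_cube
        del: sum_of_bool_eq One_nat_def) (simp add: algebra_simps)
  qed
  also have "(4 * c * k ^ 4 + 6 * k ^ 3) / k ^ 4 = 4 * c + 6 / k"
    using k by (simp add: add_divide_distrib power4_eq_xxxx power3_eq_cube)
  finally show ?thesis .
qed

section \<open>Empirical frequencies\<close>

definition count_dev :: "nat \<Rightarrow> real set \<Rightarrow> (nat \<Rightarrow> real) \<Rightarrow> real" where
  "count_dev k S x = (\<Sum>i\<in>{1..k}. indicator S (x i)) / k - measure unif S"

lemma measurable_count_dev:
  "S \<in> sets borel \<Longrightarrow> count_dev k S \<in> borel_measurable (sample_space k)"
  unfolding count_dev_def[abs_def]
  by (intro borel_measurable_diff borel_measurable_divide borel_measurable_sum borel_measurable_const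
    measurable_compose[OF measurable_sample_component] borel_measurable_indicator) auto

lemma abs_count_dev_le: "\<bar>count_dev k S x\<bar> \<le> 1"
proof -
  have "(\<Sum>i\<in>{1..k}. indicator S (x i) :: real) \<le> (\<Sum>i\<in>{1..k}. 1)" by (intro sum_mono) (auto simp: indicator_def)
  then have "(\<Sum>i\<in>{1..k}. indicator S (x i)) / k \<le> 1" by (cases "k = 0") (auto simp: divide_le_eq_1)
  moreover have "0 \<le> (\<Sum>i\<in>{1..k}. indicator S (x i)) / k" by (intro divide_nonneg_nonneg sum_nonneg) auto
  moreover have "0 \<le> measure unif S" "measure unif S \<le> 1" by auto
  ultimately show ?thesis unfolding count_dev_def by linarith
qed

text \<open>The variance of an empirical mean: centred indicators at different sample points are
  independent, so only the k diagonal terms survive, each at most 1.\<close>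

lemma integral_count_dev_square:
  assumes [measurable]: "S \<in> sets borel" and k: "k > 0"
  shows "(\<integral>x. (count_dev k S x)\<^sup>2 \<partial>sample_space k) \<le> 1 / k"
proof -
  interpret S: prob_space "sample_space k" by (rule prob_space_sample)
  interpret P: product_prob_space "\<lambda>_::nat. unif" "{1..k}" ..
  define y where "y = (\<lambda>s. indicator S s - measure unif S)"
  have [measurable]: "y \<in> borel_measurable borel" unfolding y_def by measurable
  have mb: "0 \<le> measure unif S" "measure unif S \<le> 1" by auto
  have yb: "\<bar>y s\<bar> \<le> 1" for s using mb by (auto simp: y_def indicator_def)
  have iy: "integrable unif y" by (rule unif.integrable_bounded[OF _ yb]) measurable
  have y0: "(\<integral>s. y s \<partial>unif) = 0"
  proof -
    have "integrable unif (indicator S :: real \<Rightarrow> real)"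
      by (rule unif.integrable_bounded[where K=1]) (auto simp: indicator_def)
    then show ?thesis unfolding y_def using unif.prob_space by simp
  qed
  have cd: "count_dev k S x = (\<Sum>i\<in>{1..k}. y (x i)) / k" for x
    using k by (simp add: count_dev_def y_def sum_subtractf diff_divide_distrib)
  have yi: "integrable (sample_space k) (\<lambda>x. y (x i) * y (x j))" if "i \<in> {1..k}" "j \<in> {1..k}" for i j
  proof (rule S.integrable_bounded[OF _ abs_mult_le[OF yb yb]])
    note [measurable] = that[THEN measurable_sample_component]
    show "(\<lambda>x. y (x i) * y (x j)) \<in> borel_measurable (sample_space k)" by measurable
  qed
  have off: "(\<integral>x. y (x i) * y (x j) \<partial>sample_space k) = 0" if ij: "i \<in> {1..k}" "j \<in> {1..k}" "i \<noteq> j" for i j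
  proof -
    \<comment> \<open>Padding with the constant 1 at the other coordinates writes the mixed term as
      a full product, to which the integral formula for product measures applies; the factor at i
      then vanishes.\<close>
    define f where "f = (\<lambda>m. if m = i \<or> m = j then y else (\<lambda>_. 1))"
    have "(\<Prod>m\<in>{1..k}. f m (x m)) = y (x i) * y (x j)" for x
    proof -
      have "(\<Prod>m\<in>{1..k}. f m (x m)) = (\<Prod>m\<in>{i, j}. f m (x m))"
        by (rule prod.mono_neutral_right) (use ij in \<open>auto simp: f_def\<close>)
      then show ?thesis using ij by (simp add: f_def)
    qed
    then have "(\<integral>x. y (x i) * y (x j) \<partial>sample_space k) = (\<integral>x. (\<Prod>m\<in>{1..k}. f m (x m)) \<partial>sample_space k)" by simp
    also have "\<dots> = (\<Prod>m\<in>{1..k}. integral\<^sup>L unif (f m))"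
      by (rule P.product_integral_prod) (auto simp: f_def iy)
    also have "\<dots> = 0" using ij y0 by (auto simp: f_def)
    finally show ?thesis .
  qed
  have "(\<integral>x. (count_dev k S x)\<^sup>2 \<partial>sample_space k) = (\<integral>x. (\<Sum>i\<in>{1..k}. \<Sum>j\<in>{1..k}. y (x i) * y (x j)) / k\<^sup>2 \<partial>sample_space k)"
    by (simp add: cd power_divide power2_eq_square sum_product)
  also have "\<dots> = (\<Sum>i\<in>{1..k}. \<Sum>j\<in>{1..k}. (\<integral>x. y (x i) * y (x j) \<partial>sample_space k)) / k\<^sup>2"
    using integral_sum2[of "{1..k}" "sample_space k" "\<lambda>i j x. y (x i) * y (x j)"] yi by simp
  also have "\<dots> \<le> (\<Sum>i\<in>{1..k}. \<Sum>j\<in>{1..k}. if i = j then 1 else 0) / k\<^sup>2"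
  proof (intro divide_right_mono sum_mono)
    fix i j assume ij: "i \<in> {1..k}" "j \<in> {1..k}"
    show "(\<integral>x. y (x i) * y (x j) \<partial>sample_space k) \<le> (if i = j then 1 else 0)"
    proof (cases "i = j")
      case True
      have "\<bar>\<integral>x. y (x i) * y (x j) \<partial>sample_space k\<bar> \<le> 1 * 1"
        by (rule S.integral_abs_le_const) (intro abs_mult_le yb)
      then show ?thesis using True by (simp add: abs_le_iff)
    qed (use off[OF ij] in simp)
  qed simp
  also have "(\<Sum>i\<in>{1..k}. \<Sum>j\<in>{1..k}. if i = j then 1 else 0) = (\<Sum>i\<in>{1..k}. 1 :: real)"
    by (intro sum.cong) auto
  also have "\<dots> / k\<^sup>2 = 1 / k" using k by (simp add: power2_eq_square)
  finally show ?thesis .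
qed

section \<open>Distance of a graphon-signal from its sample\<close>

text \<open>The graph as a step graphon in which each vertex occupies a cell of length 1/k; when E
  consists of pairs, the diagonal blocks are 0.\<close>

definition step_graph :: "nat \<Rightarrow> nat set set \<Rightarrow> real \<times> real \<Rightarrow> real" where
  "step_graph k E z = of_bool ({cell k (fst z), cell k (snd z)} \<in> E)"

definition step_signal :: "nat \<Rightarrow> (nat \<Rightarrow> real) \<Rightarrow> real \<Rightarrow> real" where
  "step_signal k a s = a (cell k s)"

lemma borel_gs_step:
  assumes "\<And>i. \<bar>a i\<bar> \<le> r"
  shows "borel_gs r (step_graph k E) (step_signal k a)"
proof -
  have "(\<lambda>z. of_bool ({cell k (fst z), cell k (snd z)} \<in> E) :: real) \<in> borel_measurable (borel \<Otimes>\<^sub>M borel)"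
    by (rule borel_measurable_step) measurable
  moreover have "(\<lambda>s. a (cell k s)) \<in> borel_measurable borel"
    by (rule measurable_compose[OF cell_measurable]) simp
  ultimately show ?thesis using assms
    by (simp add: borel_gs_def step_graph_def[abs_def] step_signal_def[abs_def])
qed

text \<open>Cell i of the sample inherits the label of the sample point x i, so the graphon-signal
  and its sample are near step functions with common values. The sampled graph deviates from its
  step function by an amount controlled by the 4-cycle density, and the label measures deviate by
  the empirical count deviations.\<close>

lemma dist_le_sample:
  fixes l :: "real \<Rightarrow> nat"
  assumes gs: "borel_gs r W f" and l: "step_labels borel m l v"
    and s: "\<And>i. \<bar>s i\<bar> \<le> R" and f: "\<And>x. \<bar>f x - s (l x)\<bar> \<le> \<delta>"
    and c: "cut_le unif (\<lambda>z. W z - v (l (fst z)) (l (snd z))) c"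
    and pos: "k > 0" "0 < \<epsilon>" "0 < \<kappa>"
    and B: "c + (\<epsilon> + cycle_density k (adj_dev (\<lambda>s t. v (l s) (l t)) x E) / \<epsilon> ^ 3) + 2 * \<delta> +
      (2 + 2 * R) * (\<Sum>j<m. \<kappa> + (count_dev k {s. l s < j} x)\<^sup>2 / \<kappa>) \<le> B"
  shows "dist_le B W f (step_graph k E) (step_signal k (\<lambda>i. f (x i)))"
    and "dist_le B (step_graph k E) (step_signal k (\<lambda>i. f (x i))) W f"
proof -
  define lB where "lB = (\<lambda>s. l (x (cell k s)))"
  have lB: "step_labels borel m lB v"
  proof -
    have "lB \<in> measurable borel (count_space UNIV)" unfolding lB_def
      by (rule measurable_compose[OF cell_measurable]) simp
    then show ?thesis using l by (auto simp: step_labels_def lB_def)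
  qed
  have gsB: "borel_gs r (step_graph k E) (step_signal k (\<lambda>i. f (x i)))"
    by (rule borel_gs_step) (use gs in \<open>auto simp: borel_gs_def\<close>)
  let ?\<beta> = "\<epsilon> + cycle_density k (adj_dev (\<lambda>s t. v (l s) (l t)) x E) / \<epsilon> ^ 3"
  have cB: "cut_le unif (\<lambda>z. step_graph k E z - v (lB (fst z)) (lB (snd z))) ?\<beta>"
    using cut_le_comp_cell[OF pos(1,2), of "adj_dev (\<lambda>s t. v (l s) (l t)) x E"]
    by (simp add: adj_dev_def step_graph_def lB_def)
  have sB: "\<bar>step_signal k (\<lambda>i. f (x i)) u - s (lB u)\<bar> \<le> \<delta>" for u
    using f by (simp add: step_signal_def lB_def)
  have R0: "0 \<le> R" using s[of 0] by linarith
  \<comment> \<open>Linearising |u| by \<kappa> + u^2 / \<kappa> makes the bound depend on second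
    moments only.\<close>
  have dev: "\<bar>measure unif {s. l s < j} - measure unif {s. lB s < j}\<bar> \<le> \<kappa> + (count_dev k {s. l s < j} x)\<^sup>2 / \<kappa>" for j
  proof -
    have "measure unif {s. lB s < j} - measure unif {s. l s < j} = count_dev k {s. l s < j} x"
      using measure_comp_cell[OF pos(1), of "\<lambda>i. l (x i) < j"] by (simp add: count_dev_def lB_def indicator_def)
    moreover have "\<bar>u\<bar> \<le> \<kappa> + u\<^sup>2 / \<kappa>" for u :: real
    proof (cases "\<bar>u\<bar> \<le> \<kappa>")
      case False
      then have "\<bar>u\<bar> * \<kappa> \<le> \<bar>u\<bar> * \<bar>u\<bar>" by (intro mult_left_mono) auto
      then have "\<bar>u\<bar> \<le> u\<^sup>2 / \<kappa>" using pos by (simp add: pos_le_divide_eq power2_eq_square)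
      then show ?thesis using pos by simp
    qed (use pos in \<open>simp add: add_increasing2\<close>)
    ultimately show ?thesis by (metis abs_minus_commute)
  qed
  have le: "(\<Sum>j<m. \<bar>measure unif {s. l s < j} - measure unif {s. lB s < j}\<bar>) \<le>
    (\<Sum>j<m. \<kappa> + (count_dev k {s. l s < j} x)\<^sup>2 / \<kappa>)" by (intro sum_mono dev)
  then have le2: "(2 + 2 * R) * (\<Sum>j<m. \<bar>measure unif {s. l s < j} - measure unif {s. lB s < j}\<bar>) \<le>
    (2 + 2 * R) * (\<Sum>j<m. \<kappa> + (count_dev k {s. l s < j} x)\<^sup>2 / \<kappa>)" using R0 by (intro mult_left_mono) auto
  show "dist_le B W f (step_graph k E) (step_signal k (\<lambda>i. f (x i)))"
    by (rule dist_le_mono[OF dist_le_common_step[OF gs gsB l lB s c cB f sB]]) (use le2 B in linarith)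
  show "dist_le B (step_graph k E) (step_signal k (\<lambda>i. f (x i))) W f"
    by (rule dist_le_mono[OF dist_le_common_step[OF gsB gs lB l s cB c sB f]])
      (use le2 B in \<open>simp add: abs_minus_commute\<close>)
qed

text \<open>The number k depends only on \<eta> and r, which later allows one k for a whole
  sequence. Instead of the distance itself, a measurable bounded majorant B is averaged, and B may
  depend on W and f.\<close>

lemma sampling:
  assumes \<eta>: "0 < \<eta>" and r: "0 \<le> r"
  shows "\<exists>k>0. \<forall>W f. borel_gs r W f \<longrightarrow> (\<forall>s t. W (s, t) = W (t, s)) \<longrightarrow>
    (\<exists>B K. (\<forall>E\<in>Pow (vertex_pairs k). B E \<in> borel_measurable (sample_space k) \<and> (\<forall>x. \<bar>B E x\<bar> \<le> K)) \<and>
      sample_expect k W B \<le> \<eta> \<and>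
      (\<forall>E x. dist_le (B E x) W f (step_graph k E) (step_signal k (\<lambda>i. f (x i))) \<and>
        dist_le (B E x) (step_graph k E) (step_signal k (\<lambda>i. f (x i))) W f))"
proof -
  \<comment> \<open>Error budget: c from regularity, \<epsilon> from linearising the fourth root, 2
    \<epsilon> from rounding the two signals, \<epsilon> from the averaged cycle density and 2
    \<epsilon> from the label frequencies. As c <= \<epsilon>, the total is at most 7
    \<epsilon>.\<close>
  define \<epsilon> where "\<epsilon> = min 1 (\<eta> / 8)"
  have \<epsilon>: "0 < \<epsilon>" "\<epsilon> \<le> 1" "8 * \<epsilon> \<le> \<eta>" using \<eta> by (auto simp: \<epsilon>_def)
  \<comment> \<open>Chosen so that the cut error enters the averaged cycle density, after division
    by \<epsilon>^3, as 4 c / \<epsilon>^3 = \<epsilon> / 2.\<close>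
  define c where "c = \<epsilon> ^ 4 / 8"
  have c: "0 < c" using \<epsilon> by (simp add: c_def)
  have ce: "c \<le> \<epsilon>"
  proof -
    have "\<epsilon> ^ 4 \<le> \<epsilon> ^ 1" using \<epsilon> by (intro power_decreasing) auto
    then show ?thesis using \<epsilon> by (simp add: c_def)
  qed
  obtain n :: nat where n: "1 < real n * c\<^sup>2"
    using ex_less_of_nat_mult[of "c\<^sup>2" 1] c by auto
  define m1 :: nat where "m1 = 4 ^ n"
  have m1: "m1 > 0" by (simp add: m1_def)
  \<comment> \<open>The number of levels of width \<epsilon> that cover the signal range
    [-r, r].\<close>
  define m2 where "m2 = nat \<lfloor>2 * r / \<epsilon>\<rfloor> + 1"
  define m where "m = m1 * m2"
  have m: "m > 0" using m1 by (simp add: m_def m2_def)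
  \<comment> \<open>D collects the prefactor of the label term and its m thresholds. The averaged
    term is then at most D \<kappa> + D / (k \<kappa>); \<kappa> makes the first summand \<epsilon>,
    and k makes the second at most \<epsilon>.\<close>
  define D where "D = (2 + 2 * r) * m"
  have D: "D > 0" using r m by (simp add: D_def)
  define \<kappa> where "\<kappa> = \<epsilon> / D"
  have \<kappa>: "\<kappa> > 0" using \<epsilon> D by (simp add: \<kappa>_def)
  obtain k :: nat where k: "real k > max (12 / \<epsilon> ^ 4) (D / (\<epsilon> * \<kappa>))"
    using reals_Archimedean2 by blast
  have k0: "k > 0"
  proof -
    have "0 < 12 / \<epsilon> ^ 4" using \<epsilon> by simp
    then have "0 < real k" using k by linarith
    then show ?thesis by simp
  qed
  have k1: "6 / (k * \<epsilon> ^ 3) \<le> \<epsilon> / 2"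
  proof -
    have "12 \<le> k * \<epsilon> ^ 4" using k \<epsilon> by (simp add: pos_divide_less_eq less_imp_le)
    also have "\<epsilon> ^ 4 = \<epsilon> * \<epsilon> ^ 3" by (simp add: power_Suc[symmetric])
    finally show ?thesis using \<epsilon> k0 by (simp add: divide_simps mult_ac)
  qed
  have k2: "D * (1 / (k * \<kappa>)) \<le> \<epsilon>"
  proof -
    have "D \<le> k * (\<epsilon> * \<kappa>)" using k \<epsilon> \<kappa> by (simp add: pos_divide_less_eq less_imp_le)
    then show ?thesis using \<epsilon> k0 \<kappa> by (simp add: divide_simps mult_ac)
  qed
  show ?thesis
  proof (intro exI[of _ k] conjI allI impI)
    fix W :: "real \<times> real \<Rightarrow> real" and f :: "real \<Rightarrow> real"
    assume gs: "borel_gs r W f" and sym: "\<forall>s t. W (s, t) = W (t, s)"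
    have W[measurable]: "W \<in> borel_measurable (borel \<Otimes>\<^sub>M borel)" and W01: "\<And>z. 0 \<le> W z" "\<And>z. W z \<le> 1"
      and f[measurable]: "f \<in> borel_measurable borel" and fr: "\<And>x. \<bar>f x\<bar> \<le> r"
      using gs unfolding borel_gs_def by blast+
    have "W \<in> borel_measurable (unif \<Otimes>\<^sub>M unif)" by measurable
    from weak_regularity[OF prob_space_unif this W01 c n]
    obtain l0 v0 where l0: "step_labels unif m1 l0 v0" and c0: "cut_le unif (\<lambda>z. W z - v0 (l0 (fst z)) (l0 (snd z))) c"
      unfolding m1_def by blast
    define b where "b = (\<lambda>x. nat \<lfloor>(f x + r) / \<epsilon>\<rfloor>)"
    \<comment> \<open>One label carries both data: its residue modulo m1 is the label from weak
      regularity, its quotient the level of the signal. Accordingly \<open>v\<close> reads residues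
      and \<open>s\<close> reads quotients, where the minimum keeps \<open>s\<close> in [-r, r] for
      labels that do not occur.\<close>
    define l where "l = (\<lambda>x. l0 x + m1 * b x)"
    define v where "v = (\<lambda>p q. v0 (p mod m1) (q mod m1))"
    define s where "s = (\<lambda>i. min r (real (i div m1) * \<epsilon> - r))"
    have [measurable]: "l0 \<in> measurable borel (count_space UNIV)" and l0m: "\<And>x. l0 x < m1"
      and v0: "\<And>p q. 0 \<le> v0 p q \<and> v0 p q \<le> 1"
      using l0 by (auto simp: step_labels_def cong: measurable_cong_sets)
    have [measurable]: "b \<in> measurable borel (count_space UNIV)" unfolding b_def by measurable
    have [measurable]: "l \<in> measurable borel (count_space UNIV)" unfolding l_def by measurable
    have lmod: "l x mod m1 = l0 x" "l x div m1 = b x" for x using l0m[of x] by (simp_all add: l_def)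
    have bm: "b x < m2" for x
    proof -
      have "(f x + r) / \<epsilon> \<le> 2 * r / \<epsilon>" using fr[of x] \<epsilon> by (intro divide_right_mono) auto
      then have "nat \<lfloor>(f x + r) / \<epsilon>\<rfloor> \<le> nat \<lfloor>2 * r / \<epsilon>\<rfloor>" by (intro nat_mono floor_mono)
      then show ?thesis by (simp add: b_def m2_def)
    qed
    have lm: "l x < m" for x
    proof -
      have "l x < m1 * (b x + 1)" using l0m[of x] by (simp add: l_def)
      also have "\<dots> \<le> m" unfolding m_def using bm[of x] by (intro mult_le_mono2) simp
      finally show ?thesis .
    qed
    have ls: "step_labels borel m l v" using lm v0 by (simp add: step_labels_def v_def)
    have vl: "v (l x) (l y) = v0 (l0 x) (l0 y)" for x y by (simp add: v_def lmod)
    have cl: "cut_le unif (\<lambda>z. W z - v (l (fst z)) (l (snd z))) c" using c0 by (simp add: vl)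
    have sr: "\<bar>s i\<bar> \<le> r" for i
    proof -
      have "0 \<le> real (i div m1) * \<epsilon>" using \<epsilon> by simp
      then show ?thesis using r unfolding s_def min_def by auto
    qed
    have fs: "\<bar>f x - s (l x)\<bar> \<le> \<epsilon>" for x
    proof -
      have "0 \<le> (f x + r) / \<epsilon>" using fr[of x] \<epsilon> by simp
      then have "real (b x) \<le> (f x + r) / \<epsilon>" "(f x + r) / \<epsilon> < real (b x) + 1" unfolding b_def by linarith+
      then have "real (b x) * \<epsilon> \<le> f x + r" "f x + r < (real (b x) + 1) * \<epsilon>"
        using \<epsilon> by (simp_all add: pos_le_divide_eq pos_divide_less_eq)
      moreover have "s (l x) = min r (real (b x) * \<epsilon> - r)" by (simp add: s_def lmod)
      moreover have "(real (b x) + 1) * \<epsilon> = real (b x) * \<epsilon> + \<epsilon>" by (simp add: algebra_simps)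
      ultimately show ?thesis using fr[of x] by linarith
    qed
    define Q where "Q = (\<lambda>E x. cycle_density k (adj_dev (\<lambda>s t. v (l s) (l t)) x E))"
    define N where "N = (\<lambda>x. \<Sum>j<m. \<kappa> + (count_dev k {s. l s < j} x)\<^sup>2 / \<kappa>)"
    define g where "g = (\<lambda>x. c + \<epsilon> + 2 * \<epsilon> + (2 + 2 * r) * N x)"
    define B where "B = (\<lambda>E x. 1 / \<epsilon> ^ 3 * Q E x + g x)"
    have [measurable]: "{s. l s < j} \<in> sets borel" for j
    proof -
      have "{s \<in> space borel. l s < j} \<in> sets borel" by measurable
      then show ?thesis by simp
    qed
    have cdm: "count_dev k {s. l s < j} \<in> borel_measurable (sample_space k)" for j by (rule measurable_count_dev) measurable
    have gm: "g \<in> borel_measurable (sample_space k)"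
      unfolding g_def N_def
      by (intro borel_measurable_add borel_measurable_const borel_measurable_times borel_measurable_sum borel_measurable_divide borel_measurable_power cdm)
    define Kg where "Kg = c + \<epsilon> + 2 * \<epsilon> + (2 + 2 * r) * (\<Sum>j<m. \<kappa> + 1 / \<kappa>)"
    have gb: "\<bar>g x\<bar> \<le> Kg" for x
    proof -
      have sq: "(count_dev k {s. l s < j} x)\<^sup>2 \<le> 1" for j
        using abs_count_dev_le[of k "{s. l s < j}" x] by (simp add: abs_square_le_1)
      have "N x \<le> (\<Sum>j<m. \<kappa> + 1 / \<kappa>)"
        unfolding N_def using \<kappa> sq by (intro sum_mono add_left_mono divide_right_mono) auto
      moreover have "0 \<le> N x" unfolding N_def using \<kappa> by (intro sum_nonneg) auto
      ultimately have "(2 + 2 * r) * N x \<le> (2 + 2 * r) * (\<Sum>j<m. \<kappa> + 1 / \<kappa>)" "0 \<le> (2 + 2 * r) * N x"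
        using r by (auto intro!: mult_left_mono mult_nonneg_nonneg)
      then show ?thesis using c \<epsilon> unfolding g_def Kg_def by linarith
    qed
    have Vm: "(\<lambda>z. v (l (fst z)) (l (snd z))) \<in> borel_measurable (borel \<Otimes>\<^sub>M borel)" by measurable
    have v01: "\<And>p q. 0 \<le> v p q" "\<And>p q. v p q \<le> 1" using v0 by (simp_all add: v_def)
    have Qm: "Q E \<in> borel_measurable (sample_space k)" for E
    proof -
      have Vij: "(\<lambda>x. v (l (x i)) (l (x j))) \<in> borel_measurable (sample_space k)"
        if ij: "i \<in> {1..k}" "j \<in> {1..k}" for i j
      proof -
        have "(\<lambda>x. (x i, x j)) \<in> measurable (sample_space k) (borel \<Otimes>\<^sub>M borel)"
          using ij[THEN measurable_sample_component] by measurable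
        from measurable_compose[OF this Vm] show ?thesis by simp
      qed
      show ?thesis unfolding Q_def cycle_density_def adj_dev_def
        by (intro borel_measurable_divide borel_measurable_const borel_measurable_sum
          borel_measurable_times borel_measurable_diff Vij)
    qed
    have Qb: "\<bar>Q E x\<bar> \<le> 1" for E x
      unfolding Q_def by (intro abs_cycle_density_le abs_adj_dev_le v01)
    have gi: "integrable (sample_space k) g"
      by (rule prob_space.integrable_bounded[OF prob_space_sample gm gb])
    show "\<exists>B K. (\<forall>E\<in>Pow (vertex_pairs k). B E \<in> borel_measurable (sample_space k) \<and> (\<forall>x. \<bar>B E x\<bar> \<le> K)) \<and>
      sample_expect k W B \<le> \<eta> \<and>
      (\<forall>E x. dist_le (B E x) W f (step_graph k E) (step_signal k (\<lambda>i. f (x i))) \<and>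
        dist_le (B E x) (step_graph k E) (step_signal k (\<lambda>i. f (x i))) W f)"
    proof (intro exI[of _ B] exI[of _ "1 / \<epsilon> ^ 3 * 1 + Kg"] conjI ballI allI)
      fix E x
      show "B E \<in> borel_measurable (sample_space k)" unfolding B_def
        by (intro borel_measurable_add borel_measurable_times borel_measurable_const Qm gm)
      have "\<bar>1 / \<epsilon> ^ 3 * Q E x\<bar> \<le> 1 / \<epsilon> ^ 3 * 1" using \<epsilon> by (intro abs_mult_le Qb) simp
      then show "\<bar>B E x\<bar> \<le> 1 / \<epsilon> ^ 3 * 1 + Kg" unfolding B_def using gb[of x] by linarith
      have le: "c + (\<epsilon> + cycle_density k (adj_dev (\<lambda>s t. v (l s) (l t)) x E) / \<epsilon> ^ 3) + 2 * \<epsilon> +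
        (2 + 2 * r) * (\<Sum>j<m. \<kappa> + (count_dev k {s. l s < j} x)\<^sup>2 / \<kappa>) \<le> B E x"
        by (simp add: B_def Q_def g_def N_def)
      show "dist_le (B E x) W f (step_graph k E) (step_signal k (\<lambda>i. f (x i)))"
        "dist_le (B E x) (step_graph k E) (step_signal k (\<lambda>i. f (x i))) W f"
        by (rule dist_le_sample[OF gs ls sr fs cl k0 \<epsilon>(1) \<kappa> le])+
    next
      have "sample_expect k W B = 1 / \<epsilon> ^ 3 * sample_expect k W Q + (\<integral>x. g x \<partial>sample_space k)"
        unfolding B_def by (rule sample_expect_affine[OF W W01 Qm Qb gi])
      also have "sample_expect k W Q \<le> 4 * c + 6 / k"
        unfolding Q_def
        by (rule sample_expect_cycle_density[OF W W01 _ Vm _ _ cl k0]) (use sym v01 in auto)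
      then have "1 / \<epsilon> ^ 3 * sample_expect k W Q \<le> 1 / \<epsilon> ^ 3 * (4 * c + 6 / k)"
        using \<epsilon> by (intro mult_left_mono) auto
      also have "\<dots> = \<epsilon> / 2 + 6 / (k * \<epsilon> ^ 3)"
        using \<epsilon> k0 by (simp add: c_def field_simps power4_eq_xxxx power3_eq_cube)
      also have "\<dots> \<le> \<epsilon>" using k1 by linarith
      also have "(\<integral>x. g x \<partial>sample_space k) \<le> c + 5 * \<epsilon>"
      proof -
        interpret S: prob_space "sample_space k" by (rule prob_space_sample)
        have i: "integrable (sample_space k) (\<lambda>x. (count_dev k {s. l s < j} x)\<^sup>2)" for j
          by (rule S.integrable_bounded[where K=1])
            (use abs_count_dev_le cdm in \<open>auto simp: abs_square_le_1\<close>)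
        have i': "integrable (sample_space k) (\<lambda>x. \<kappa> + (count_dev k {s. l s < j} x)\<^sup>2 / \<kappa>)" for j
          by (intro Bochner_Integration.integrable_add S.integrable_const integrable_divide i)
        have "(\<integral>x. N x \<partial>sample_space k) = (\<Sum>j<m. \<kappa> + (\<integral>x. (count_dev k {s. l s < j} x)\<^sup>2 \<partial>sample_space k) / \<kappa>)"
        proof -
          have "(\<integral>x. N x \<partial>sample_space k) = (\<Sum>j<m. \<integral>x. \<kappa> + (count_dev k {s. l s < j} x)\<^sup>2 / \<kappa> \<partial>sample_space k)"
            unfolding N_def by (rule Bochner_Integration.integral_sum) (rule i')
          also have "\<dots> = (\<Sum>j<m. \<kappa> + (\<integral>x. (count_dev k {s. l s < j} x)\<^sup>2 \<partial>sample_space k) / \<kappa>)"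
            using S.prob_space by (intro sum.cong refl, subst Bochner_Integration.integral_add[OF S.integrable_const integrable_divide[OF i]]) simp
          finally show ?thesis .
        qed
        also have "\<dots> \<le> (\<Sum>j<m. \<kappa> + (1 / k) / \<kappa>)"
          using \<kappa> by (intro sum_mono add_left_mono divide_right_mono integral_count_dev_square k0) auto
        also have "\<dots> = m * (\<kappa> + 1 / (k * \<kappa>))" by simp
        finally have "(2 + 2 * r) * (\<integral>x. N x \<partial>sample_space k) \<le> (2 + 2 * r) * (m * (\<kappa> + 1 / (k * \<kappa>)))"
          using r by (intro mult_left_mono) auto
        also have "\<dots> = D * \<kappa> + D * (1 / (k * \<kappa>))" by (simp add: D_def algebra_simps)
        also have "\<dots> \<le> \<epsilon> + \<epsilon>" using k2 D by (simp add: \<kappa>_def)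
        finally have *: "(2 + 2 * r) * (\<integral>x. N x \<partial>sample_space k) \<le> 2 * \<epsilon>" by simp
        have "integrable (sample_space k) N" unfolding N_def by (rule Bochner_Integration.integrable_sum) (rule i')
        then have "(\<integral>x. g x \<partial>sample_space k) = c + \<epsilon> + 2 * \<epsilon> + (2 + 2 * r) * (\<integral>x. N x \<partial>sample_space k)"
          unfolding g_def using S.prob_space
          by (subst Bochner_Integration.integral_add[OF S.integrable_const integrable_mult_right]) auto
        then show ?thesis using * by linarith
      qed
      finally show "sample_expect k W B \<le> \<eta>" using ce \<epsilon> by linarith
    qed
  qed (rule k0)
qed

section \<open>Counting lemma\<close>

definition hom_dens :: "nat \<Rightarrow> nat set set \<Rightarrow> (nat \<Rightarrow> nat) \<Rightarrow> (real \<times> real \<Rightarrow> real) \<Rightarrow> (real \<Rightarrow> real) \<Rightarrow> real" where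
  "hom_dens k E d W f = (\<integral>x. (\<Prod>i\<in>{1..k}. f (x i) ^ d i) * (\<Prod>e\<in>E. edge_weight W x e) \<partial>sample_space k)"

lemma abs_prod_le_1:
  fixes f :: "'a \<Rightarrow> real"
  assumes "\<And>i. i \<in> A \<Longrightarrow> \<bar>f i\<bar> \<le> 1"
  shows "\<bar>\<Prod>i\<in>A. f i\<bar> \<le> 1"
  unfolding abs_prod using assms by (intro prod_le_1) auto

lemma integral_sample_component:
  fixes h :: "real \<Rightarrow> real"
  assumes [measurable]: "h \<in> borel_measurable borel" and i: "i \<in> {1..k}"
  shows "(\<integral>x. h (x i) \<partial>sample_space k) = (\<integral>s. h s \<partial>unif)"
proof -
  have "(\<integral>s. h s \<partial>unif) = (\<integral>s. h s \<partial>distr (sample_space k) unif (\<lambda>x. x i))"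
    using distr_PiM_component[of "{1..k}" "\<lambda>_. unif" i] prob_space_unif i by simp
  also have "\<dots> = (\<integral>x. h (x i) \<partial>sample_space k)"
    by (rule integral_distr) (use i in \<open>auto intro: measurable_component_singleton\<close>)
  finally show ?thesis by simp
qed

lemma measurable_signal_prod:
  assumes "f \<in> borel_measurable borel" "A \<subseteq> {1..k}"
  shows "(\<lambda>x. \<Prod>i\<in>A. f (x i) ^ d i :: real) \<in> borel_measurable (sample_space k)"
  using assms by (intro borel_measurable_prod borel_measurable_power measurable_compose[OF measurable_sample_component]) auto

lemma measurable_edge_prod:
  assumes "\<And>e. e \<in> E \<Longrightarrow> W e \<in> borel_measurable (borel \<Otimes>\<^sub>M borel)" "E \<subseteq> vertex_pairs k"
  shows "(\<lambda>x. \<Prod>e\<in>E. edge_weight (W e) x e) \<in> borel_measurable (sample_space k)"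
  using assms by (intro borel_measurable_prod measurable_edge_weight) auto

text \<open>The edges are switched from V to W one at a time; \<open>Z F\<close> uses W on F and V
  elsewhere. At the switched edge e = {i, j}, every factor involving x j goes into \<open>b\<close>
  and all others into \<open>a\<close>. No further edge joins i and j, so \<open>b\<close> is free
  of x i, and the pivot bound gives 4 c per edge.\<close>

lemma hom_dens_edge_swap:
  assumes gs: "borel_gs 1 W f" "borel_gs 1 V g" and E: "E \<subseteq> vertex_pairs k"
    and c: "cut_le unif (\<lambda>z. W z - V z) c"
  shows "\<bar>hom_dens k E d W g - hom_dens k E d V g\<bar> \<le> real (card E) * (4 * c)"
proof -
  have finE: "finite E" using E finite_vertex_pairs finite_subset by blast
  have W[measurable]: "W \<in> borel_measurable (borel \<Otimes>\<^sub>M borel)" "V \<in> borel_measurable (borel \<Otimes>\<^sub>M borel)"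
    and g[measurable]: "g \<in> borel_measurable borel"
    and b: "\<And>z. 0 \<le> W z" "\<And>z. W z \<le> 1" "\<And>z. 0 \<le> V z" "\<And>z. V z \<le> 1" "\<And>x. \<bar>g x\<bar> \<le> 1"
    using gs by (auto simp: borel_gs_def)
  define Z :: "nat set set \<Rightarrow> nat set \<Rightarrow> real \<times> real \<Rightarrow> real" where "Z = (\<lambda>F e. if e \<in> F then W else V)"
  have Zm: "Z F e \<in> borel_measurable (borel \<Otimes>\<^sub>M borel)" for F e by (simp add: Z_def)
  have Zb: "\<bar>Z F e z\<bar> \<le> 1" for F e z using b(1,2)[of z] b(3,4)[of z] by (auto simp: Z_def)
  define H where "H = (\<lambda>F x. (\<Prod>i\<in>{1..k}. g (x i) ^ d i) * (\<Prod>e\<in>E. edge_weight (Z F e) x e))"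
  have gb: "\<bar>\<Prod>i\<in>A. g (x i) ^ d i\<bar> \<le> 1" for A and x :: "nat \<Rightarrow> real"
    by (rule abs_prod_le_1) (use b(5) in \<open>simp add: power_abs power_le_one\<close>)
  have eb: "\<bar>\<Prod>e\<in>A. edge_weight (Z F e) x e\<bar> \<le> 1" for A F x
    by (rule abs_prod_le_1) (simp add: edge_weight_def Zb)
  have Hi: "integrable (sample_space k) (H F)" for F
  proof (rule prob_space.integrable_bounded[OF prob_space_sample])
    show "H F \<in> borel_measurable (sample_space k)" unfolding H_def
      by (intro borel_measurable_times measurable_signal_prod measurable_edge_prod Zm g E order_refl)
    show "\<bar>H F x\<bar> \<le> 1 * 1" for x unfolding H_def by (intro abs_mult_le gb eb)
  qed
  have swap: "\<bar>(\<integral>x. H (insert e F) x \<partial>sample_space k) - (\<integral>x. H F x \<partial>sample_space k)\<bar> \<le> 4 * c"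
    if e: "e \<in> E" "e \<notin> F" for e F
  proof -
    define i where "i = Min e"
    define j where "j = Max e"
    have ij: "i \<in> {1..k}" "j \<in> {1..k}" "i \<noteq> j" "e = {i, j}"
      using vertex_pairs_Min_Max[of e k] e E by (auto simp: i_def j_def)
    define Ej where "Ej = {e' \<in> E - {e}. j \<in> e'}"
    define Er where "Er = {e' \<in> E - {e}. j \<notin> e'}"
    have Esplit: "E - {e} = Ej \<union> Er" "Ej \<inter> Er = {}" by (auto simp: Ej_def Er_def)
    have finj: "finite Ej" "finite Er" using finE by (auto simp: Ej_def Er_def)
    have Ejp: "Ej \<subseteq> vertex_pairs k" "Er \<subseteq> vertex_pairs k" using E by (auto simp: Ej_def Er_def)
    define a where "a = (\<lambda>x. (\<Prod>m\<in>{1..k} - {j}. g (x m) ^ d m) * (\<Prod>e'\<in>Er. edge_weight (Z F e') x e'))"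
    define b where "b = (\<lambda>x. (\<Prod>m\<in>{j}. g (x m) ^ d m) * (\<Prod>e'\<in>Ej. edge_weight (Z F e') x e'))"
    \<comment> \<open>Here simplicity of the graph enters: an edge containing both i and j equals
      e.\<close>
    have iEj: "i \<notin> e'" if "e' \<in> Ej" for e'
    proof
      assume "i \<in> e'"
      have "e' \<in> vertex_pairs k" "e' \<noteq> e" "j \<in> e'" using that Ejp by (auto simp: Ej_def)
      then have "card e' = 2" "{i, j} \<subseteq> e'" "finite e'" using \<open>i \<in> e'\<close>
        by (auto simp: vertex_pairs_def intro: finite_subset[of _ "{1..k}"])
      then have "{i, j} = e'" using ij(3) by (intro card_subset_eq) auto
      then show False using \<open>e' \<noteq> e\<close> ij by simp
    qed
    have mm: "Min e' \<in> e'" "Max e' \<in> e'" if "e' \<in> vertex_pairs k" for e'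
      using vertex_pairs_Min_Max(4)[OF that] by auto
    have ew: "edge_weight X (x(m := t)) e' = edge_weight X x e'" if "e' \<in> vertex_pairs k" "m \<notin> e'" for X x m t e'
      using mm[OF that(1)] that(2) unfolding edge_weight_def by (metis fun_upd_other)
    have diff: "H (insert e F) x - H F x = a x * b x * (W (x i, x j) - V (x i, x j))" for x
    proof -
      have E1: "(\<Prod>e'\<in>E. edge_weight (Z G e') x e') = edge_weight (Z G e) x e * ((\<Prod>e'\<in>Er. edge_weight (Z F e') x e') * (\<Prod>e'\<in>Ej. edge_weight (Z F e') x e'))"
        if G: "G = F \<or> G = insert e F" for G
      proof -
        have "(\<Prod>e'\<in>E. edge_weight (Z G e') x e') = edge_weight (Z G e) x e * (\<Prod>e'\<in>E - {e}. edge_weight (Z G e') x e')"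
          by (rule prod.remove[OF finE e(1)])
        also have "(\<Prod>e'\<in>E - {e}. edge_weight (Z G e') x e') = (\<Prod>e'\<in>E - {e}. edge_weight (Z F e') x e')"
          by (intro prod.cong refl) (use G in \<open>auto simp: Z_def\<close>)
        also have "\<dots> = (\<Prod>e'\<in>Er. edge_weight (Z F e') x e') * (\<Prod>e'\<in>Ej. edge_weight (Z F e') x e')"
          unfolding Esplit(1) by (subst prod.union_disjoint[OF finj Esplit(2)]) (simp add: mult.commute)
        finally show ?thesis .
      qed
      have g1: "(\<Prod>m\<in>{1..k}. g (x m) ^ d m) = g (x j) ^ d j * (\<Prod>m\<in>{1..k} - {j}. g (x m) ^ d m)"
        by (rule prod.remove) (use ij in auto)
      have "edge_weight (Z (insert e F) e) x e = W (x i, x j)" "edge_weight (Z F e) x e = V (x i, x j)"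
        using e by (auto simp: Z_def edge_weight_def i_def j_def)
      then show ?thesis unfolding H_def a_def b_def g1 E1[OF disjI1[OF refl]] E1[OF disjI2[OF refl]]
        by (simp add: algebra_simps)
    qed
    have "(\<integral>x. H (insert e F) x \<partial>sample_space k) - (\<integral>x. H F x \<partial>sample_space k) =
      (\<integral>x. a x * b x * (W (x i, x j) - V (x i, x j)) \<partial>sample_space k)"
      using Hi by (simp add: diff[symmetric] del: One_nat_def)
    moreover have "\<bar>\<integral>x. a x * b x * (\<lambda>z. W z - V z) (x i, x j) \<partial>sample_space k\<bar> \<le> 4 * (1 * 1) * (1 * 1) * c"
    proof (rule pivot_bound[OF prob_space_unif _ ij(1-3), where K=1])
      show "a \<in> borel_measurable (sample_space k)" "b \<in> borel_measurable (sample_space k)"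
        unfolding a_def b_def using ij Ejp
        by (intro borel_measurable_times measurable_signal_prod measurable_edge_prod Zm g; force)+
      show "(\<lambda>z. W z - V z) \<in> borel_measurable (unif \<Otimes>\<^sub>M unif)" by measurable
      show "\<bar>W z - V z\<bar> \<le> 1" for z
        using gs unfolding borel_gs_def by (smt (verit))
      show "\<bar>a x\<bar> \<le> 1 * 1" "\<bar>b x\<bar> \<le> 1 * 1" for x
        unfolding a_def b_def by (intro abs_mult_le gb eb)+
      show "a (x(j := t)) = a x" for x t
        unfolding a_def using ew[of _ j] Ejp(2) by (intro arg_cong2[of _ _ _ _ "(*)"] prod.cong refl) (auto simp: Er_def subset_iff)
      show "b (x(i := s)) = b x" for x s
        unfolding b_def using ew[of _ i] Ejp(1) iEj ij(3) by (intro arg_cong2[of _ _ _ _ "(*)"] prod.cong refl) auto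
    qed (use c in auto)
    ultimately show ?thesis by simp
  qed
  have "\<bar>(\<integral>x. H F x \<partial>sample_space k) - (\<integral>x. H {} x \<partial>sample_space k)\<bar> \<le> real (card F) * (4 * c)"
    if "F \<subseteq> E" for F
    using finite_subset[OF that finE] that
  proof (induction F rule: finite_induct)
    case (insert e F)
    then have "\<bar>(\<integral>x. H (insert e F) x \<partial>sample_space k) - (\<integral>x. H F x \<partial>sample_space k)\<bar> \<le> 4 * c"
      by (intro swap) auto
    with insert show ?case by (simp add: algebra_simps)
  qed simp
  from this[of E] show ?thesis
    unfolding hom_dens_def H_def Z_def by (simp cong: prod.cong)
qed

text \<open>On [-1, 1] the power t^d is d-Lipschitz, which yields the weight \<open>d i\<close>;
  each sample coordinate is uniformly distributed, which turns the averaged difference at x i into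
  the L^1 distance.\<close>

lemma hom_dens_signal_swap:
  assumes gs: "borel_gs 1 W f" "borel_gs 1 V g" and E: "E \<subseteq> vertex_pairs k"
  shows "\<bar>hom_dens k E d W f - hom_dens k E d W g\<bar> \<le> real (\<Sum>i\<in>{1..k}. d i) * (\<integral>x. \<bar>f x - g x\<bar> \<partial>unif)"
proof -
  have W[measurable]: "W \<in> borel_measurable (borel \<Otimes>\<^sub>M borel)"
    and fg[measurable]: "f \<in> borel_measurable borel" "g \<in> borel_measurable borel"
    and b: "\<And>z. 0 \<le> W z" "\<And>z. W z \<le> 1" "\<And>x. \<bar>f x\<bar> \<le> 1" "\<And>x. \<bar>g x\<bar> \<le> 1"
    using gs by (auto simp: borel_gs_def)
  define P where "P = (\<lambda>x. \<Prod>e\<in>E. edge_weight W x e)"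
  have Pm: "P \<in> borel_measurable (sample_space k)" unfolding P_def by (intro measurable_edge_prod W E)
  have Pb: "\<bar>P x\<bar> \<le> 1" for x
    unfolding P_def by (rule abs_prod_le_1) (use b in \<open>simp add: edge_weight_def\<close>)
  have gb: "\<bar>\<Prod>i\<in>A. h (x i) ^ d i\<bar> \<le> 1" if "\<And>x. \<bar>h x\<bar> \<le> 1" for A and h :: "real \<Rightarrow> real" and x :: "nat \<Rightarrow> real"
    by (rule abs_prod_le_1) (use that in \<open>simp add: power_abs power_le_one\<close>)
  have i: "integrable (sample_space k) (\<lambda>x. (\<Prod>i\<in>{1..k}. h (x i) ^ d i) * P x)"
    if "h \<in> borel_measurable borel" "\<And>x. \<bar>h x\<bar> \<le> 1" for h :: "real \<Rightarrow> real"
  proof (rule prob_space.integrable_bounded[OF prob_space_sample])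
    show "(\<lambda>x. (\<Prod>i\<in>{1..k}. h (x i) ^ d i) * P x) \<in> borel_measurable (sample_space k)"
      by (intro borel_measurable_times measurable_signal_prod Pm that order_refl)
    show "\<bar>(\<Prod>i\<in>{1..k}. h (x i) ^ d i) * P x\<bar> \<le> 1 * 1" for x by (intro abs_mult_le gb Pb that)
  qed
  have fgi: "integrable (sample_space k) (\<lambda>x. d i * \<bar>f (x i) - g (x i)\<bar>)" if "i \<in> {1..k}" for i
  proof (rule prob_space.integrable_bounded[OF prob_space_sample])
    show "(\<lambda>x. d i * \<bar>f (x i) - g (x i)\<bar>) \<in> borel_measurable (sample_space k)"
      by (rule measurable_compose[OF measurable_sample_component[OF that]]) measurable
    show "\<bar>d i * \<bar>f (x i) - g (x i)\<bar>\<bar> \<le> real (d i) * (2 * 1)" for x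
      by (intro abs_mult_le abs_abs_diff_le b) simp
  qed
  have "hom_dens k E d W f - hom_dens k E d W g =
    (\<integral>x. (\<Prod>i\<in>{1..k}. f (x i) ^ d i) * P x - (\<Prod>i\<in>{1..k}. g (x i) ^ d i) * P x \<partial>sample_space k)"
    unfolding hom_dens_def fun_cong[OF P_def, symmetric]
    using i[OF fg(1) b(3)] i[OF fg(2) b(4)] by (rule Bochner_Integration.integral_diff[symmetric])
  also have "\<bar>\<dots>\<bar> \<le> (\<integral>x. \<bar>(\<Prod>i\<in>{1..k}. f (x i) ^ d i) * P x - (\<Prod>i\<in>{1..k}. g (x i) ^ d i) * P x\<bar> \<partial>sample_space k)"
    by (rule integral_abs_bound)
  also have "\<dots> \<le> (\<integral>x. (\<Sum>i\<in>{1..k}. d i * \<bar>f (x i) - g (x i)\<bar>) \<partial>sample_space k)"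
  proof (rule integral_mono)
    show "integrable (sample_space k) (\<lambda>x. \<bar>(\<Prod>i\<in>{1..k}. f (x i) ^ d i) * P x - (\<Prod>i\<in>{1..k}. g (x i) ^ d i) * P x\<bar>)"
      by (intro integrable_abs Bochner_Integration.integrable_diff i b fg)
    show "integrable (sample_space k) (\<lambda>x. \<Sum>i\<in>{1..k}. d i * \<bar>f (x i) - g (x i)\<bar>)"
      by (intro Bochner_Integration.integrable_sum fgi)
    fix x
    have "\<bar>(\<Prod>i\<in>{1..k}. f (x i) ^ d i) * P x - (\<Prod>i\<in>{1..k}. g (x i) ^ d i) * P x\<bar> =
      \<bar>(\<Prod>i\<in>{1..k}. f (x i) ^ d i) - (\<Prod>i\<in>{1..k}. g (x i) ^ d i)\<bar> * \<bar>P x\<bar>"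
      by (simp only: left_diff_distrib[symmetric] abs_mult)
    also have "\<dots> \<le> \<bar>(\<Prod>i\<in>{1..k}. f (x i) ^ d i) - (\<Prod>i\<in>{1..k}. g (x i) ^ d i)\<bar>"
      using Pb[of x] by (simp add: mult_left_le)
    also have "\<dots> \<le> (\<Sum>i\<in>{1..k}. \<bar>f (x i) ^ d i - g (x i) ^ d i\<bar>)"
      using norm_prod_diff[of "{1..k}" "\<lambda>i. f (x i) ^ d i" "\<lambda>i. g (x i) ^ d i"] b
      by (simp add: power_abs power_le_one)
    also have "\<dots> \<le> (\<Sum>i\<in>{1..k}. d i * \<bar>f (x i) - g (x i)\<bar>)"
      using norm_power_diff[of "f (x i)" "g (x i)" "d i" for i] b by (intro sum_mono) simp
    finally show "\<bar>(\<Prod>i\<in>{1..k}. f (x i) ^ d i) * P x - (\<Prod>i\<in>{1..k}. g (x i) ^ d i) * P x\<bar> \<le> (\<Sum>i\<in>{1..k}. d i * \<bar>f (x i) - g (x i)\<bar>)" .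
  qed
  also have "\<dots> = (\<Sum>i\<in>{1..k}. \<integral>x. d i * \<bar>f (x i) - g (x i)\<bar> \<partial>sample_space k)"
    by (rule Bochner_Integration.integral_sum) (rule fgi)
  also have "\<dots> = (\<Sum>i\<in>{1..k}. d i * (\<integral>s. \<bar>f s - g s\<bar> \<partial>unif))"
  proof (intro sum.cong refl)
    fix i assume "i \<in> {1..k}"
    then show "(\<integral>x. d i * \<bar>f (x i) - g (x i)\<bar> \<partial>sample_space k) = d i * (\<integral>s. \<bar>f s - g s\<bar> \<partial>unif)"
      using integral_sample_component[of "\<lambda>s. d i * \<bar>f s - g s\<bar>" i k] by simp
  qed
  finally show ?thesis by (simp add: sum_distrib_right)
qed

lemma hom_dens_scale:
  "hom_dens k E d W (\<lambda>x. c * f x) = c ^ (\<Sum>i\<in>{1..k}. d i) * hom_dens k E d W f"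
  unfolding hom_dens_def
  by (simp add: power_mult_distrib prod.distrib power_sum[symmetric] mult.assoc)

text \<open>Dividing the signals by \<open>\<rho>\<close> reduces the counting lemma to signals with values in \<open>[-1, 1]\<close>,
  for which products and powers are 1-Lipschitz in each factor.\<close>

lemma counting_lemma:
  assumes \<rho>: "1 \<le> \<rho>" and gs: "borel_gs \<rho> W f" "borel_gs \<rho> V g" and E: "E \<subseteq> vertex_pairs k"
    and c: "cut_le unif (\<lambda>z. W z - V z) c"
  shows "\<bar>hom_dens k E d W f - hom_dens k E d V g\<bar> \<le>
    \<rho> ^ (\<Sum>i\<in>{1..k}. d i) * (real (card E) * (4 * c) + real (\<Sum>i\<in>{1..k}. d i) * (\<integral>x. \<bar>f x - g x\<bar> \<partial>unif))"
proof -
  let ?D = "\<Sum>i\<in>{1..k}. d i"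
  define f' where "f' = (\<lambda>x. f x / \<rho>)"
  define g' where "g' = (\<lambda>x. g x / \<rho>)"
  have gs': "borel_gs 1 W f'" "borel_gs 1 V g'" using gs \<rho> by (auto simp: borel_gs_def f'_def g'_def)
  have ff: "f = (\<lambda>x. \<rho> * f' x)" "g = (\<lambda>x. \<rho> * g' x)" using \<rho> by (auto simp: f'_def g'_def)
  have "\<bar>hom_dens k E d W f' - hom_dens k E d W g'\<bar> \<le> real ?D * (\<integral>x. \<bar>f' x - g' x\<bar> \<partial>unif)"
    by (rule hom_dens_signal_swap[OF gs' E])
  moreover have "\<bar>hom_dens k E d W g' - hom_dens k E d V g'\<bar> \<le> real (card E) * (4 * c)"
    by (rule hom_dens_edge_swap[OF gs' E c])
  moreover have "real ?D * (\<integral>x. \<bar>f' x - g' x\<bar> \<partial>unif) \<le> real ?D * (\<integral>x. \<bar>f x - g x\<bar> \<partial>unif)"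
  proof (intro mult_left_mono)
    have "(\<integral>x. \<bar>f' x - g' x\<bar> \<partial>unif) = (\<integral>x. \<bar>f x - g x\<bar> \<partial>unif) / \<rho>"
      using \<rho> by (simp add: f'_def g'_def diff_divide_distrib[symmetric])
    also have "\<dots> \<le> (\<integral>x. \<bar>f x - g x\<bar> \<partial>unif) / 1" using \<rho> by (intro divide_left_mono) auto
    finally show "(\<integral>x. \<bar>f' x - g' x\<bar> \<partial>unif) \<le> (\<integral>x. \<bar>f x - g x\<bar> \<partial>unif)" by simp
  qed (simp add: sum_nonneg)
  ultimately have "\<bar>hom_dens k E d W f' - hom_dens k E d V g'\<bar> \<le> real (card E) * (4 * c) + real ?D * (\<integral>x. \<bar>f x - g x\<bar> \<partial>unif)"
    by linarith
  then have "\<rho> ^ ?D * \<bar>hom_dens k E d W f' - hom_dens k E d V g'\<bar> \<le> \<rho> ^ ?D * (real (card E) * (4 * c) + real ?D * (\<integral>x. \<bar>f x - g x\<bar> \<partial>unif))"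
    using \<rho> by (intro mult_left_mono) auto
  moreover have "\<bar>hom_dens k E d W f - hom_dens k E d V g\<bar> = \<rho> ^ ?D * \<bar>hom_dens k E d W f' - hom_dens k E d V g'\<bar>"
    unfolding ff hom_dens_scale using \<rho> by (simp add: right_diff_distrib[symmetric] abs_mult)
  ultimately show ?thesis by simp
qed

section \<open>Inverse counting lemma\<close>

lemma mp_iso_id: "mp_iso (\<lambda>x. x)"
proof -
  have "distr unif borel (\<lambda>x. x) = unif" by (rule measure_eqI) (auto simp: emeasure_distr)
  then have "mp (\<lambda>x. x)" by (simp add: mp_def)
  then show ?thesis by (auto simp: mp_iso_def intro!: exI[of _ "\<lambda>x. x"])
qed

text \<open>The identity map with L^1 bounds is a witness; this makes the infimum in
  \<open>sample_dist\<close> range over a nonempty set.\<close>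

lemma dist_le_exists:
  assumes "borel_gs r W f" "borel_gs r' V g"
  shows "\<exists>c. dist_le c W f V g"
proof -
  have [measurable]: "W \<in> borel_measurable (borel \<Otimes>\<^sub>M borel)" "V \<in> borel_measurable (borel \<Otimes>\<^sub>M borel)"
    and b: "\<And>z. 0 \<le> W z" "\<And>z. W z \<le> 1" "\<And>z. 0 \<le> V z" "\<And>z. V z \<le> 1"
    using assms by (auto simp: borel_gs_def)
  have b1: "\<bar>\<bar>W z - V z\<bar>\<bar> \<le> 1" for z using b(1,2)[of z] b(3,4)[of z] by auto
  have "cut_le unif (\<lambda>z. W z - V z) (\<integral>z. \<bar>W z - V z\<bar> \<partial>(unif \<Otimes>\<^sub>M unif))"
    by (rule cut_le_L1[OF prob_space_unif unif2.integrable_bounded[OF _ b1]]) auto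
  then have "dist_le ((\<integral>z. \<bar>W z - V z\<bar> \<partial>(unif \<Otimes>\<^sub>M unif)) + (\<integral>x. \<bar>f x - g x\<bar> \<partial>unif)) W f V g"
    unfolding dist_le_def using mp_iso_id by (intro exI[of _ "\<lambda>x. x"]) auto
  then show ?thesis by blast
qed

text \<open>Clamping makes the distance a globally Lipschitz function of the sampled signal values.\<close>

definition sample_dist :: "real \<Rightarrow> nat \<Rightarrow> (real \<times> real \<Rightarrow> real) \<Rightarrow> (real \<Rightarrow> real) \<Rightarrow> nat set set \<Rightarrow> (nat \<Rightarrow> real) \<Rightarrow> real" where
  "sample_dist r k W f E a = Inf {c. dist_le c (step_graph k E) (step_signal k (\<lambda>i. clamp (- r) r (a i))) W f}"

context
  fixes r :: real and k :: nat and W :: "real \<times> real \<Rightarrow> real" and f :: "real \<Rightarrow> real"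
  assumes gs: "borel_gs r W f" and k: "k > 0"
begin

lemma borel_gs_clamp: "borel_gs r (step_graph k E) (step_signal k (\<lambda>i. clamp (- r) r (a i)))"
  using clamp_in[of "-r" r] borel_gs_radius_nonneg[OF gs] by (intro borel_gs_step) (auto simp: abs_le_iff minus_le_iff)

lemma sample_dist_le:
  assumes "dist_le c (step_graph k E) (step_signal k (\<lambda>i. clamp (- r) r (a i))) W f"
  shows "sample_dist r k W f E a \<le> c"
  unfolding sample_dist_def using assms by (intro cInf_lower) (auto intro: bdd_belowI[of _ 0] dist_le_nonneg)

lemma sample_dist_nonneg: "0 \<le> sample_dist r k W f E a"
  unfolding sample_dist_def using dist_le_exists[OF borel_gs_clamp gs]
  by (intro cInf_greatest) (auto intro: dist_le_nonneg)

lemma dist_le_of_sample_dist: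
  assumes "sample_dist r k W f E a < c"
  shows "dist_le c (step_graph k E) (step_signal k (\<lambda>i. clamp (- r) r (a i))) W f"
proof -
  have "{c. dist_le c (step_graph k E) (step_signal k (\<lambda>i. clamp (- r) r (a i))) W f} \<noteq> {}"
    using dist_le_exists[OF borel_gs_clamp gs] by auto
  from cInf_lessD[OF this assms[unfolded sample_dist_def]] show ?thesis by (auto intro: dist_le_mono)
qed

text \<open>A nearly optimal map for \<open>b\<close> also serves for \<open>a\<close>: the graph
  part does not involve the signal, and clamping is 1-Lipschitz.\<close>

lemma sample_dist_lipschitz_le: "sample_dist r k W f E a \<le> sample_dist r k W f E b + (\<Sum>i\<in>{1..k}. \<bar>a i - b i\<bar>)"
proof (rule field_le_epsilon)
  fix e :: real assume e: "0 < e"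
  let ?A = "step_signal k (\<lambda>i. clamp (- r) r (a i))" and ?B = "step_signal k (\<lambda>i. clamp (- r) r (b i))"
  let ?s = "\<Sum>i\<in>{1..k}. \<bar>a i - b i\<bar>" and ?d = "sample_dist r k W f E b + e"
  have "dist_le ?d (step_graph k E) ?B W f"
    using e by (intro dist_le_of_sample_dist) simp
  then obtain \<phi> c1 where \<phi>: "mp_iso \<phi>" "cut_le unif (\<lambda>z. step_graph k E z - W (\<phi> (fst z), \<phi> (snd z))) c1"
    "c1 + (\<integral>x. \<bar>?B x - f (\<phi> x)\<bar> \<partial>unif) \<le> ?d" by (auto simp: dist_le_def)
  have [measurable]: "\<phi> \<in> borel_measurable borel" using \<phi>(1) by (intro mp_measurable mp_iso_mp)
  have [measurable]: "?A \<in> borel_measurable borel" "?B \<in> borel_measurable borel" "f \<in> borel_measurable borel"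
    and bd: "\<And>x. \<bar>?A x\<bar> \<le> r" "\<And>x. \<bar>?B x\<bar> \<le> r" "\<And>x. \<bar>f x\<bar> \<le> r"
    using borel_gs_clamp[of E a] borel_gs_clamp[of E b] gs unfolding borel_gs_def by blast+
  have iA: "integrable unif (\<lambda>x. \<bar>?A x - f (\<phi> x)\<bar>)"
    by (rule unif.integrable_bounded[OF _ abs_abs_diff_le[OF bd(1,3)]]) measurable
  have iB: "integrable unif (\<lambda>x. \<bar>?B x - f (\<phi> x)\<bar>)"
    by (rule unif.integrable_bounded[OF _ abs_abs_diff_le[OF bd(2,3)]]) measurable
  have "(\<integral>x. \<bar>?A x - f (\<phi> x)\<bar> \<partial>unif) \<le> (\<integral>x. \<bar>?B x - f (\<phi> x)\<bar> + ?s \<partial>unif)"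
  proof (rule integral_mono[OF iA])
    show "integrable unif (\<lambda>x. \<bar>?B x - f (\<phi> x)\<bar> + ?s)" using iB by simp
    fix x
    have "\<bar>?A x - ?B x\<bar> \<le> \<bar>a (cell k x) - b (cell k x)\<bar>" by (auto simp: step_signal_def clamp_def)
    also have "\<dots> \<le> ?s" using cell_in[OF k, of x] by (intro member_le_sum) auto
    finally show "\<bar>?A x - f (\<phi> x)\<bar> \<le> \<bar>?B x - f (\<phi> x)\<bar> + ?s" by linarith
  qed
  also have "\<dots> = (\<integral>x. \<bar>?B x - f (\<phi> x)\<bar> \<partial>unif) + ?s" using iB unif.prob_space by simp
  finally have "dist_le (?d + ?s) (step_graph k E) ?A W f"
    unfolding dist_le_def using \<phi> by (intro exI[of _ \<phi>] exI[of _ c1]) auto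
  from sample_dist_le[OF this] show "sample_dist r k W f E a \<le> sample_dist r k W f E b + ?s + e" by simp
qed

text \<open>The Lipschitz bound involves only k coordinates, so it yields continuity in the product
  topology on sequences.\<close>

lemma continuous_sample_dist: "continuous_on UNIV (sample_dist r k W f E)"
proof (clarsimp simp: continuous_on_eq_continuous_at isCont_def)
  fix a :: "nat \<Rightarrow> real"
  have "((\<lambda>b. \<Sum>i\<in>{1..k}. \<bar>b i - a i\<bar>) \<longlongrightarrow> (\<Sum>i\<in>{1..k}. \<bar>a i - a i\<bar>)) (at a)"
  proof (rule tendsto_sum, rule tendsto_rabs, rule tendsto_diff[OF _ tendsto_const])
    fix i
    have "continuous_on UNIV (\<lambda>b::nat \<Rightarrow> real. b i)" by (rule continuous_on_product_coordinates)
    then show "((\<lambda>b. b i) \<longlongrightarrow> a i) (at a)"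
      unfolding continuous_on_def by blast
  qed
  then have lim: "((\<lambda>b. \<Sum>i\<in>{1..k}. \<bar>b i - a i\<bar>) \<longlongrightarrow> 0) (at a)" by simp
  have bound: "norm (sample_dist r k W f E b - sample_dist r k W f E a) \<le> (\<Sum>i\<in>{1..k}. \<bar>b i - a i\<bar>)" for b
    using sample_dist_lipschitz_le[of E a b] sample_dist_lipschitz_le[of E b a]
    by (simp add: abs_minus_commute[of "a _"] abs_le_iff)
  have "((\<lambda>b. sample_dist r k W f E b - sample_dist r k W f E a) \<longlongrightarrow> 0) (at a)"
    by (rule Lim_null_comparison[OF always_eventually lim]) (rule allI, rule bound)
  then show "sample_dist r k W f E \<midarrow>a\<rightarrow> sample_dist r k W f E a" by (simp add: LIM_zero_iff)
qed

end

section \<open>Polynomial tests of the sampled signal\<close>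

definition sampled_signal :: "nat \<Rightarrow> (real \<Rightarrow> real) \<Rightarrow> (nat \<Rightarrow> real) \<Rightarrow> nat \<Rightarrow> real" where
  "sampled_signal k f x i = (if i \<in> {1..k} then f (x i) else 0)"

lemma measurable_sampled_signal:
  assumes "f \<in> borel_measurable borel"
  shows "sampled_signal k f \<in> borel_measurable (sample_space k)"
proof (rule measurable_coordinatewise_then_product)
  fix i
  show "(\<lambda>x. sampled_signal k f x i) \<in> borel_measurable (sample_space k)"
    unfolding sampled_signal_def
    using measurable_compose[OF measurable_sample_component assms, of i k] by (cases "i \<in> {1..k}") auto
qed

text \<open>The real polynomials in the coordinates 1 to k, generated so that statements linear in
  the polynomial reduce to monomials, which correspond to homomorphism densities.\<close>

inductive_set monomial_span :: "nat \<Rightarrow> ((nat \<Rightarrow> real) \<Rightarrow> real) set" for k where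
  monomial: "(\<lambda>a. \<Prod>i\<in>{1..k}. a i ^ d i) \<in> monomial_span k"
| scale: "p \<in> monomial_span k \<Longrightarrow> (\<lambda>a. c * p a) \<in> monomial_span k"
| add: "p \<in> monomial_span k \<Longrightarrow> q \<in> monomial_span k \<Longrightarrow> (\<lambda>a. p a + q a) \<in> monomial_span k"

lemma monomial_span_mult:
  assumes "p \<in> monomial_span k" "q \<in> monomial_span k"
  shows "(\<lambda>a. p a * q a) \<in> monomial_span k"
  using assms(1)
proof induction
  case (monomial d)
  from assms(2) show ?case
  proof induction
    case (monomial d')
    have "(\<lambda>a. (\<Prod>i\<in>{1..k}. a i ^ d i) * (\<Prod>i\<in>{1..k}. a i ^ d' i)) = (\<lambda>a :: nat \<Rightarrow> real. \<Prod>i\<in>{1..k}. a i ^ (d i + d' i))"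
      by (simp add: power_add prod.distrib)
    then show ?case using monomial_span.monomial[where d="\<lambda>i. d i + d' i"] by simp
  next
    case (scale q c)
    from monomial_span.scale[OF scale.IH, of c] show ?case by (simp add: mult_ac)
  next
    case (add q q')
    from monomial_span.add[OF add.IH] show ?case by (simp add: distrib_left)
  qed
next
  case (scale p c)
  from monomial_span.scale[OF scale.IH, of c] show ?case by (simp add: mult_ac)
next
  case (add p p')
  from monomial_span.add[OF add.IH] show ?case by (simp add: distrib_right)
qed

lemma continuous_monomial_span: "p \<in> monomial_span k \<Longrightarrow> continuous_on UNIV p"
  by (induction rule: monomial_span.induct)
    (intro continuous_intros continuous_on_product_coordinates | assumption)+

text \<open>Pinning the coordinates outside {1..k} to 0 makes the cube compact as a set of
  sequences, and makes distinct points differ at a coordinate visible to the polynomials; both are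
  hypotheses of the Stone-Weierstrass theorem.\<close>

definition signal_cube :: "real \<Rightarrow> nat \<Rightarrow> (nat \<Rightarrow> real) set" where
  "signal_cube r k = (\<Pi>\<^sub>E i\<in>UNIV. if i \<in> {1..k} then {-r..r} else {0})"

lemma compact_signal_cube: "compact (signal_cube r k)"
proof -
  have "compactin (product_topology (\<lambda>_::nat. euclidean :: real topology) UNIV) (signal_cube r k)"
    unfolding signal_cube_def by (subst compactin_PiE) auto
  then show ?thesis by (simp add: euclidean_product_topology)
qed

lemma sampled_signal_in_cube:
  assumes "\<And>x. \<bar>f x\<bar> \<le> r"
  shows "sampled_signal k f x \<in> signal_cube r k"
  using assms by (auto simp: sampled_signal_def signal_cube_def abs_le_iff minus_le_iff)

lemma monomial_span_dense:
  assumes "continuous_on UNIV h" "0 < e"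
  shows "\<exists>p\<in>monomial_span k. \<forall>a\<in>signal_cube r k. \<bar>h a - p a\<bar> < e"
proof -
  have ring: "function_ring_on (monomial_span k) (signal_cube r k)"
  proof
    show "compact (signal_cube r k)" by (rule compact_signal_cube)
    show "continuous_on (signal_cube r k) p" if "p \<in> monomial_span k" for p
      using continuous_monomial_span[OF that] by (rule continuous_on_subset) simp
    show "(\<lambda>_. c) \<in> monomial_span k" for c
      using monomial_span.scale[OF monomial_span.monomial[where d="\<lambda>_. 0" and k=k], of c] by simp
    fix a b assume ab: "a \<in> signal_cube r k" "b \<in> signal_cube r k" "a \<noteq> b"
    then obtain i where i: "a i \<noteq> b i" by auto
    have out: "x i = 0" if "x \<in> signal_cube r k" "i \<notin> {1..k}" for x
    proof -
      have "x i \<in> (if i \<in> {1..k} then {- r..r} else {0})"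
        using that(1) unfolding signal_cube_def by (rule PiE_mem) simp
      then show ?thesis unfolding if_not_P[OF that(2)] by simp
    qed
    have ik: "i \<in> {1..k}" using out[OF ab(1)] out[OF ab(2)] i by metis
    have "(\<Prod>m\<in>{1..k}. x m ^ (if m = i then 1 else 0)) = x i" for x :: "nat \<Rightarrow> real"
    proof -
      have "(\<Prod>m\<in>{1..k}. x m ^ (if m = i then 1 else 0)) = (\<Prod>m\<in>{1..k}. if m = i then x m else 1)"
        by (intro prod.cong) auto
      then show ?thesis using ik by simp
    qed
    then have "(\<lambda>x. x i) \<in> monomial_span k"
      using monomial_span.monomial[where d="\<lambda>m. if m = i then 1 else 0" and k=k] by simp
    then show "\<exists>p\<in>monomial_span k. p a \<noteq> p b" using i by (intro bexI[of _ "\<lambda>x. x i"])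
  qed (auto intro: monomial_span.add monomial_span_mult)
  show ?thesis
    using function_ring_on.Stone_Weierstrass_basic[OF ring continuous_on_subset[OF assms(1)] assms(2)] by blast
qed

text \<open>Given the points, the product of edge weights is the probability that the random graph
  contains E; so this is the expectation of h at the sampled signal, restricted to that event. For a
  monomial h it is a homomorphism density.\<close>

definition signal_test :: "nat \<Rightarrow> nat set set \<Rightarrow> ((nat \<Rightarrow> real) \<Rightarrow> real) \<Rightarrow> (real \<times> real \<Rightarrow> real) \<Rightarrow> (real \<Rightarrow> real) \<Rightarrow> real" where
  "signal_test k E h W f = (\<integral>x. (\<Prod>e\<in>E. edge_weight W x e) * h (sampled_signal k f x) \<partial>sample_space k)"

lemma continuous_signal_cube_bounded:
  fixes h :: "(nat \<Rightarrow> real) \<Rightarrow> real"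
  assumes "continuous_on UNIV h"
  shows "\<exists>K. \<forall>a\<in>signal_cube r k. \<bar>h a\<bar> \<le> K"
proof -
  have "compact (h ` signal_cube r k)"
    by (rule compact_continuous_image[OF continuous_on_subset[OF assms] compact_signal_cube]) simp
  then have "bounded (h ` signal_cube r k)" by (rule compact_imp_bounded)
  then show ?thesis by (auto simp: bounded_iff)
qed

lemma integrable_signal_test:
  assumes gs: "borel_gs r W f" and h: "continuous_on UNIV h" and E: "E \<subseteq> vertex_pairs k"
  shows "integrable (sample_space k) (\<lambda>x. (\<Prod>e\<in>E. edge_weight W x e) * h (sampled_signal k f x))"
proof -
  obtain K where K: "\<And>a. a \<in> signal_cube r k \<Longrightarrow> \<bar>h a\<bar> \<le> K"
    using continuous_signal_cube_bounded[OF h] by blast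
  have W: "W \<in> borel_measurable (borel \<Otimes>\<^sub>M borel)" "\<And>z. 0 \<le> W z" "\<And>z. W z \<le> 1" "\<And>x. \<bar>f x\<bar> \<le> r"
    and f: "f \<in> borel_measurable borel"
    using gs by (auto simp: borel_gs_def)
  show ?thesis
  proof (rule prob_space.integrable_bounded[OF prob_space_sample, where K="1 * K"])
    have "(\<lambda>x. h (sampled_signal k f x)) \<in> borel_measurable (sample_space k)"
      by (rule measurable_compose[OF measurable_sampled_signal[OF f] borel_measurable_continuous_onI[OF h]])
    then show "(\<lambda>x. (\<Prod>e\<in>E. edge_weight W x e) * h (sampled_signal k f x)) \<in> borel_measurable (sample_space k)"
      by (intro borel_measurable_times measurable_edge_prod W E)
    fix x
    show "\<bar>(\<Prod>e\<in>E. edge_weight W x e) * h (sampled_signal k f x)\<bar> \<le> 1 * K"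
    proof (rule abs_mult_le)
      show "\<bar>\<Prod>e\<in>E. edge_weight W x e\<bar> \<le> 1"
        by (rule abs_prod_le_1) (simp add: edge_weight_def W)
      show "\<bar>h (sampled_signal k f x)\<bar> \<le> K"
        by (intro K sampled_signal_in_cube W)
    qed
  qed
qed

lemma signal_test_diff_le:
  assumes gs: "borel_gs r W f" and h: "continuous_on UNIV h" "continuous_on UNIV p" and E: "E \<subseteq> vertex_pairs k"
    and e: "\<And>a. a \<in> signal_cube r k \<Longrightarrow> \<bar>h a - p a\<bar> < e"
  shows "\<bar>signal_test k E h W f - signal_test k E p W f\<bar> \<le> e"
proof -
  let ?P = "\<lambda>x. \<Prod>e\<in>E. edge_weight W x e"
  have "signal_test k E h W f - signal_test k E p W f =
    (\<integral>x. ?P x * h (sampled_signal k f x) - ?P x * p (sampled_signal k f x) \<partial>sample_space k)"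
    unfolding signal_test_def
    by (rule Bochner_Integration.integral_diff[symmetric]; rule integrable_signal_test[OF gs _ E]; rule h)
  also have "\<bar>\<dots>\<bar> \<le> e"
  proof (rule prob_space.integral_abs_le_const[OF prob_space_sample])
    fix x
    have "\<bar>?P x\<bar> \<le> 1"
      by (rule abs_prod_le_1) (use gs in \<open>auto simp: edge_weight_def borel_gs_def\<close>)
    moreover have "\<bar>h (sampled_signal k f x) - p (sampled_signal k f x)\<bar> \<le> e"
      by (rule less_imp_le, rule e, rule sampled_signal_in_cube) (use gs in \<open>auto simp: borel_gs_def\<close>)
    ultimately have "\<bar>?P x * (h (sampled_signal k f x) - p (sampled_signal k f x))\<bar> \<le> 1 * e"
      by (rule abs_mult_le)
    then show "\<bar>?P x * h (sampled_signal k f x) - ?P x * p (sampled_signal k f x)\<bar> \<le> e"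
      by (simp add: right_diff_distrib)
  qed
  finally show ?thesis .
qed

section \<open>From convergence of densities to convergence in distance\<close>

context
  fixes r :: real and Wn :: "nat \<Rightarrow> real \<times> real \<Rightarrow> real" and fn :: "nat \<Rightarrow> real \<Rightarrow> real"
    and W :: "real \<times> real \<Rightarrow> real" and f :: "real \<Rightarrow> real"
  assumes gsn: "\<And>n. borel_gs r (Wn n) (fn n)" and gs: "borel_gs r W f"
    and conv: "\<And>k E d. E \<subseteq> vertex_pairs k \<Longrightarrow> (\<lambda>n. hom_dens k E d (Wn n) (fn n)) \<longlonglongrightarrow> hom_dens k E d W f"
begin

lemma signal_test_monomial_span_tendsto:
  assumes "p \<in> monomial_span k" and E: "E \<subseteq> vertex_pairs k"
  shows "(\<lambda>n. signal_test k E p (Wn n) (fn n)) \<longlonglongrightarrow> signal_test k E p W f"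
  using assms(1)
proof induction
  case (monomial d)
  have "signal_test k E (\<lambda>a. \<Prod>i\<in>{1..k}. a i ^ d i) V g = hom_dens k E d V g" for V g
    unfolding signal_test_def hom_dens_def
  proof (intro Bochner_Integration.integral_cong refl)
    fix x
    have "(\<Prod>i\<in>{1..k}. sampled_signal k g x i ^ d i) = (\<Prod>i\<in>{1..k}. g (x i) ^ d i)"
      by (intro prod.cong) (auto simp: sampled_signal_def)
    then show "(\<Prod>e\<in>E. edge_weight V x e) * (\<Prod>i\<in>{1..k}. sampled_signal k g x i ^ d i) =
      (\<Prod>i\<in>{1..k}. g (x i) ^ d i) * (\<Prod>e\<in>E. edge_weight V x e)" by simp
  qed
  then show ?case using conv[OF E] by simp
next
  case (scale p c)
  have "signal_test k E (\<lambda>a. c * p a) V g = c * signal_test k E p V g" for V g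
    unfolding signal_test_def by (simp add: mult.left_commute del: One_nat_def)
  then show ?case using scale.IH by (simp add: tendsto_mult_left)
next
  case (add p q)
  have "signal_test k E (\<lambda>a. p a + q a) V g = signal_test k E p V g + signal_test k E q V g"
    if "borel_gs r V g" for V g
    unfolding signal_test_def distrib_left
    by (rule Bochner_Integration.integral_add; rule integrable_signal_test[OF that _ E]; rule continuous_monomial_span; rule add.hyps)
  then show ?case using tendsto_add[OF add.IH] gsn gs by simp
qed

lemma signal_test_tendsto:
  assumes h: "continuous_on UNIV h" and E: "E \<subseteq> vertex_pairs k"
  shows "(\<lambda>n. signal_test k E h (Wn n) (fn n)) \<longlonglongrightarrow> signal_test k E h W f"
proof (rule LIMSEQ_I)
  fix e :: real assume "0 < e"
  then have e3: "0 < e / 3" by simp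
  obtain p where p: "p \<in> monomial_span k" and hp: "\<And>a. a \<in> signal_cube r k \<Longrightarrow> \<bar>h a - p a\<bar> < e / 3"
    using monomial_span_dense[OF h e3] by blast
  have pc: "continuous_on UNIV p" by (rule continuous_monomial_span) fact
  obtain N where N: "\<And>n. n \<ge> N \<Longrightarrow> norm (signal_test k E p (Wn n) (fn n) - signal_test k E p W f) < e / 3"
    using LIMSEQ_D[OF signal_test_monomial_span_tendsto[OF p E] e3] by blast
  show "\<exists>N. \<forall>n\<ge>N. norm (signal_test k E h (Wn n) (fn n) - signal_test k E h W f) < e"
  proof (intro exI[of _ N] allI impI)
    fix n assume "n \<ge> N"
    from N[OF this] signal_test_diff_le[OF gsn[of n] h pc E hp] signal_test_diff_le[OF gs h pc E hp]
    show "norm (signal_test k E h (Wn n) (fn n) - signal_test k E h W f) < e"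
      unfolding real_norm_def by linarith
  qed
qed

text \<open>The event that the graph is exactly E is expressed by inclusion-exclusion through the
  events that it contains E and a set X of further pairs. These have the form of
  \<open>signal_test\<close>, with signs independent of the graphon.\<close>

lemma sample_expect_tendsto:
  assumes h: "\<And>E. continuous_on UNIV (h E)"
  shows "(\<lambda>n. sample_expect k (Wn n) (\<lambda>E x. h E (sampled_signal k (fn n) x))) \<longlonglongrightarrow>
    sample_expect k W (\<lambda>E x. h E (sampled_signal k f x))"
proof -
  let ?P = "vertex_pairs k"
  have ep: "edge_prob k V x E = (\<Sum>X\<in>Pow (?P - E). (- 1) ^ card X * (\<Prod>e\<in>E \<union> X. edge_weight V x e))"
    if E: "E \<in> Pow ?P" for E x V
  proof -
    have fin: "finite (?P - E)" "finite E" using E finite_subset[OF _ finite_vertex_pairs] by auto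
    have "(\<Prod>e\<in>?P - E. 1 - edge_weight V x e) = (\<Prod>e\<in>?P - E. - edge_weight V x e + 1)" by simp
    also have "\<dots> = (\<Sum>X\<in>Pow (?P - E). (\<Prod>e\<in>X. - edge_weight V x e) * (\<Prod>e\<in>?P - E - X. 1))"
      by (rule prod_add[OF fin(1)])
    also have "\<dots> = (\<Sum>X\<in>Pow (?P - E). (- 1) ^ card X * (\<Prod>e\<in>X. edge_weight V x e))"
      by (simp add: prod_uminus)
    finally have "edge_prob k V x E = (\<Sum>X\<in>Pow (?P - E). (- 1) ^ card X * ((\<Prod>e\<in>E. edge_weight V x e) * (\<Prod>e\<in>X. edge_weight V x e)))"
      unfolding edge_prob_def by (simp add: sum_distrib_left mult_ac)
    also have "\<dots> = (\<Sum>X\<in>Pow (?P - E). (- 1) ^ card X * (\<Prod>e\<in>E \<union> X. edge_weight V x e))"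
    proof (intro sum.cong refl)
      fix X assume "X \<in> Pow (?P - E)"
      then have "finite X" "E \<inter> X = {}" using finite_subset[OF _ fin(1), of X] by auto
      then show "(- 1) ^ card X * ((\<Prod>e\<in>E. edge_weight V x e) * (\<Prod>e\<in>X. edge_weight V x e)) = (- 1) ^ card X * (\<Prod>e\<in>E \<union> X. edge_weight V x e)"
        using fin(2) by (simp add: prod.union_disjoint)
    qed
    finally show ?thesis .
  qed
  have eq: "sample_expect k V (\<lambda>E x. h E (sampled_signal k g x)) =
    (\<Sum>E\<in>Pow ?P. \<Sum>X\<in>Pow (?P - E). (- 1) ^ card X * signal_test k (E \<union> X) (h E) V g)"
    if V: "borel_gs r V g" for V g
  proof -
    have i: "integrable (sample_space k) (\<lambda>x. (- 1) ^ card X * ((\<Prod>e\<in>E \<union> X. edge_weight V x e) * h E (sampled_signal k g x)))"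
      if "E \<in> Pow ?P" "X \<in> Pow (?P - E)" for E X
      by (rule integrable_mult_right, rule integrable_signal_test[OF V h]) (use that in auto)
    have "sample_expect k V (\<lambda>E x. h E (sampled_signal k g x)) =
      (\<integral>x. (\<Sum>E\<in>Pow ?P. \<Sum>X\<in>Pow (?P - E). (- 1) ^ card X * ((\<Prod>e\<in>E \<union> X. edge_weight V x e) * h E (sampled_signal k g x))) \<partial>sample_space k)"
      unfolding sample_expect_def
      by (intro Bochner_Integration.integral_cong refl sum.cong) (simp add: ep sum_distrib_right mult.assoc)
    also have "\<dots> = (\<Sum>E\<in>Pow ?P. \<integral>x. (\<Sum>X\<in>Pow (?P - E). (- 1) ^ card X * ((\<Prod>e\<in>E \<union> X. edge_weight V x e) * h E (sampled_signal k g x))) \<partial>sample_space k)"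
      by (intro Bochner_Integration.integral_sum Bochner_Integration.integrable_sum i)
    also have "\<dots> = (\<Sum>E\<in>Pow ?P. \<Sum>X\<in>Pow (?P - E). \<integral>x. (- 1) ^ card X * ((\<Prod>e\<in>E \<union> X. edge_weight V x e) * h E (sampled_signal k g x)) \<partial>sample_space k)"
      by (intro sum.cong refl Bochner_Integration.integral_sum i)
    finally show ?thesis unfolding signal_test_def by (simp del: One_nat_def)
  qed
  show ?thesis
    unfolding eq[OF gsn] eq[OF gs]
    by (intro tendsto_sum tendsto_mult tendsto_const signal_test_tendsto h) auto
qed

text \<open>Samples of (Wn, fn) have a majorant for the distance to (Wn, fn) of expectation at most
  \<epsilon>. Their expected distance to (W, f) converges to that of samples of (W, f), hence is
  eventually below 2 \<epsilon>. Some sample therefore makes the sum smaller than 4 \<epsilon>, and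
  the triangle inequality through it finishes.\<close>

lemma eventually_dist_le:
  assumes sym: "\<And>n s t. Wn n (s, t) = Wn n (t, s)" "\<And>s t. W (s, t) = W (t, s)" and \<eta>: "0 < \<eta>"
  shows "\<forall>\<^sub>F n in sequentially. dist_le \<eta> (Wn n) (fn n) W f"
proof -
  have r0: "0 \<le> r" using gs by (rule borel_gs_radius_nonneg)
  define \<epsilon> where "\<epsilon> = \<eta> / 10"
  have \<epsilon>: "0 < \<epsilon>" using \<eta> by (simp add: \<epsilon>_def)
  obtain k where k: "k > 0" and samp: "\<And>V g. borel_gs r V g \<Longrightarrow> (\<forall>s t. V (s, t) = V (t, s)) \<Longrightarrow>
    (\<exists>B K. (\<forall>E\<in>Pow (vertex_pairs k). B E \<in> borel_measurable (sample_space k) \<and> (\<forall>x. \<bar>B E x\<bar> \<le> K)) \<and>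
      sample_expect k V B \<le> \<epsilon> \<and>
      (\<forall>E x. dist_le (B E x) V g (step_graph k E) (step_signal k (\<lambda>i. g (x i))) \<and>
        dist_le (B E x) (step_graph k E) (step_signal k (\<lambda>i. g (x i))) V g))"
    using sampling[OF \<epsilon> r0] by blast
  define D where "D = sample_dist r k W f"
  have Dc: "continuous_on UNIV (D E)" for E unfolding D_def by (rule continuous_sample_dist[OF gs k])
  have D0: "0 \<le> D E a" for E a unfolding D_def by (rule sample_dist_nonneg[OF gs k])
  define X where "X = (\<lambda>V g. sample_expect k V (\<lambda>E x. D E (sampled_signal k g x)))"
  \<comment> \<open>On actual samples, clamping and padding by 0 are invisible: the signal values
    lie in [-r, r] and every cell index lies in {1..k}.\<close>
  have sig: "step_signal k (\<lambda>i. clamp (- r) r (sampled_signal k g x i)) = step_signal k (\<lambda>i. g (x i))"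
    if "borel_gs r V g" for V g x
  proof
    fix s
    have "\<bar>g (x (cell k s))\<bar> \<le> r" using that by (auto simp: borel_gs_def)
    then show "step_signal k (\<lambda>i. clamp (- r) r (sampled_signal k g x i)) s = step_signal k (\<lambda>i. g (x i)) s"
      using cell_in[OF k, of s] by (simp add: step_signal_def sampled_signal_def clamp_id abs_le_iff)
  qed
  have Dm: "(\<lambda>x. D E (sampled_signal k g x)) \<in> borel_measurable (sample_space k)" if "borel_gs r V g" for E V g
    by (rule measurable_compose[OF measurable_sampled_signal borel_measurable_continuous_onI[OF Dc]])
      (use that in \<open>auto simp: borel_gs_def\<close>)
  obtain K0 where K0: "\<And>E a. E \<in> Pow (vertex_pairs k) \<Longrightarrow> a \<in> signal_cube r k \<Longrightarrow> \<bar>D E a\<bar> \<le> K0"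
  proof -
    obtain KE where KE: "\<And>E a. a \<in> signal_cube r k \<Longrightarrow> \<bar>D E a\<bar> \<le> KE E"
      using continuous_signal_cube_bounded[OF Dc] by metis
    show thesis
    proof (rule that)
      fix E a assume "E \<in> Pow (vertex_pairs k)" "a \<in> signal_cube r k"
      then have "KE E \<le> (\<Sum>E\<in>Pow (vertex_pairs k). \<bar>KE E\<bar>)"
        using member_le_sum[of E "Pow (vertex_pairs k)" "\<lambda>E. \<bar>KE E\<bar>"] by simp
      with KE[OF \<open>a \<in> signal_cube r k\<close>, of E] show "\<bar>D E a\<bar> \<le> (\<Sum>E\<in>Pow (vertex_pairs k). \<bar>KE E\<bar>)" by linarith
    qed
  qed
  have Db: "\<bar>D E (sampled_signal k g x)\<bar> \<le> K0" if "E \<in> Pow (vertex_pairs k)" "borel_gs r V g" for E V g x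
    using that by (intro K0 sampled_signal_in_cube) (auto simp: borel_gs_def)
  have XW: "X W f \<le> \<epsilon>"
  proof -
    obtain B K where B: "\<And>E. E \<in> Pow (vertex_pairs k) \<Longrightarrow> B E \<in> borel_measurable (sample_space k)"
      "\<And>E x. E \<in> Pow (vertex_pairs k) \<Longrightarrow> \<bar>B E x\<bar> \<le> K"
      "sample_expect k W B \<le> \<epsilon>" "\<And>E x. dist_le (B E x) (step_graph k E) (step_signal k (\<lambda>i. f (x i))) W f"
      using samp[OF gs] sym by blast
    have W01: "W \<in> borel_measurable (borel \<Otimes>\<^sub>M borel)" "\<And>z. 0 \<le> W z" "\<And>z. W z \<le> 1" using gs by (auto simp: borel_gs_def)
    have "X W f \<le> sample_expect k W B"
      unfolding X_def sample_expect_def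
    proof (rule integral_mono)
      show "integrable (sample_space k) (\<lambda>x. \<Sum>E\<in>Pow (vertex_pairs k). edge_prob k W x E * D E (sampled_signal k f x))"
        by (rule integrable_edge_sum[OF W01 Dm[OF gs] Db[OF _ gs]])
      show "integrable (sample_space k) (\<lambda>x. \<Sum>E\<in>Pow (vertex_pairs k). edge_prob k W x E * B E x)"
        by (rule integrable_edge_sum[OF W01 B(1,2)])
      fix x
      show "(\<Sum>E\<in>Pow (vertex_pairs k). edge_prob k W x E * D E (sampled_signal k f x)) \<le> (\<Sum>E\<in>Pow (vertex_pairs k). edge_prob k W x E * B E x)"
      proof (intro sum_mono mult_left_mono edge_prob_nonneg W01)
        fix E
        show "D E (sampled_signal k f x) \<le> B E x"
          unfolding D_def by (rule sample_dist_le[OF gs k]) (simp add: sig[OF gs] B(4))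
      qed
    qed
    with B(3) show ?thesis by linarith
  qed
  have "(\<lambda>n. X (Wn n) (fn n)) \<longlonglongrightarrow> X W f" unfolding X_def by (rule sample_expect_tendsto[OF Dc])
  then have "\<forall>\<^sub>F n in sequentially. X (Wn n) (fn n) < X W f + \<epsilon>"
    by (rule order_tendstoD) (use \<epsilon> in simp)
  then show ?thesis
  proof eventually_elim
    case (elim n)
    note gn = gsn[of n]
    obtain B K where B: "\<And>E. E \<in> Pow (vertex_pairs k) \<Longrightarrow> B E \<in> borel_measurable (sample_space k)"
      "\<And>E x. E \<in> Pow (vertex_pairs k) \<Longrightarrow> \<bar>B E x\<bar> \<le> K"
      "sample_expect k (Wn n) B \<le> \<epsilon>" "\<And>E x. dist_le (B E x) (Wn n) (fn n) (step_graph k E) (step_signal k (\<lambda>i. fn n (x i)))"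
      using samp[OF gn] sym by blast
    have W01: "Wn n \<in> borel_measurable (borel \<Otimes>\<^sub>M borel)" "\<And>z. 0 \<le> Wn n z" "\<And>z. Wn n z \<le> 1" using gn by (auto simp: borel_gs_def)
    define g where "g = (\<lambda>x. \<Sum>E\<in>Pow (vertex_pairs k). edge_prob k (Wn n) x E * B E x)"
    define g' where "g' = (\<lambda>x. \<Sum>E\<in>Pow (vertex_pairs k). edge_prob k (Wn n) x E * D E (sampled_signal k (fn n) x))"
    have gi: "integrable (sample_space k) g" "integrable (sample_space k) g'"
      unfolding g_def g'_def
      by (rule integrable_edge_sum[OF W01 B(1,2)] integrable_edge_sum[OF W01 Dm[OF gn] Db[OF _ gn]]; assumption)+
    have small: "(\<integral>x. g x + g' x \<partial>sample_space k) \<le> 3 * \<epsilon>"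
    proof -
      have "(\<integral>x. g x + g' x \<partial>sample_space k) = sample_expect k (Wn n) B + X (Wn n) (fn n)"
        using gi unfolding X_def sample_expect_def g_def[symmetric] g'_def[symmetric] by (rule Bochner_Integration.integral_add)
      then show ?thesis using B(3) elim XW by linarith
    qed
    \<comment> \<open>First moment argument: the edge probabilities sum to 1, so a lower bound 4
      \<epsilon> for all graphs and points would survive averaging.\<close>
    have "\<exists>E x. B E x + D E (sampled_signal k (fn n) x) < 4 * \<epsilon>"
    proof (rule ccontr)
      assume "\<not> ?thesis"
      then have ge: "4 * \<epsilon> \<le> B E x + D E (sampled_signal k (fn n) x)" for E x by (auto simp: not_less)
      have "4 * \<epsilon> \<le> g x + g' x" for x
      proof -
        have "4 * \<epsilon> = (\<Sum>E\<in>Pow (vertex_pairs k). edge_prob k (Wn n) x E * (4 * \<epsilon>))"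
          by (simp add: sum_distrib_right[symmetric] sum_edge_prob)
        also have "\<dots> \<le> (\<Sum>E\<in>Pow (vertex_pairs k). edge_prob k (Wn n) x E * (B E x + D E (sampled_signal k (fn n) x)))"
          by (intro sum_mono mult_left_mono ge edge_prob_nonneg W01)
        also have "\<dots> = g x + g' x" by (simp add: g_def g'_def distrib_left sum.distrib)
        finally show ?thesis .
      qed
      then have "4 * \<epsilon> \<le> (\<integral>x. g x + g' x \<partial>sample_space k)"
        using gi by (intro prob_space.integral_ge_const[OF prob_space_sample]) auto
      then show False using small \<epsilon> by linarith
    qed
    then obtain E x where Ex: "B E x + D E (sampled_signal k (fn n) x) < 4 * \<epsilon>" by blast
    \<comment> \<open>The extra \<epsilon> is paid because the infimum in \<open>sample_dist\<close>
      may not be attained; the total stays below 5 \<epsilon>, within \<eta> = 10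
      \<epsilon>.\<close>
    have d2: "dist_le (D E (sampled_signal k (fn n) x) + \<epsilon>) (step_graph k E) (step_signal k (\<lambda>i. fn n (x i))) W f"
      using dist_le_of_sample_dist[OF gs k, of E "sampled_signal k (fn n) x" "D E (sampled_signal k (fn n) x) + \<epsilon>"] \<epsilon>
      by (simp add: D_def sig[OF gn])
    have "dist_le (B E x + (D E (sampled_signal k (fn n) x) + \<epsilon>)) (Wn n) (fn n) W f"
    proof (rule dist_le_trans[OF gn _ gs B(4) d2])
      show "borel_gs r (step_graph k E) (step_signal k (\<lambda>i. fn n (x i)))"
        by (rule borel_gs_step) (use gn in \<open>auto simp: borel_gs_def\<close>)
    qed
    then show ?case by (rule dist_le_mono) (use Ex \<epsilon> in \<open>simp add: \<epsilon>_def\<close>)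
  qed
qed

end

section \<open>Borel versions of Lebesgue measurable graphon-signals\<close>

lemma borel_measurable_completion_AE_eq:
  fixes f g :: "'a \<Rightarrow> real"
  assumes g: "g \<in> borel_measurable M" and ae: "AE x in M. f x = g x"
  shows "f \<in> borel_measurable (completion M)"
proof (rule measurableI)
  fix A :: "real set" assume A: "A \<in> sets borel"
  have "AE x in completion M. x \<in> g -` A \<inter> space M \<longleftrightarrow> x \<in> f -` A \<inter> space M"
    using AE_completion[OF ae] by (rule eventually_mono) simp
  moreover have "g -` A \<inter> space M \<in> sets (completion M)"
    using measurable_sets[OF g A] by simp
  ultimately show "f -` A \<inter> space (completion M) \<in> sets (completion M)"
    using completion.in_sets_AE[of "g -` A \<inter> space M" "f -` A \<inter> space M" M] by simp
qed simp

text \<open>The bridge used for all transfers: a Lebesgue integral is computed from a Borel version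
  of the integrand, with measurability of the original following from almost everywhere
  equality.\<close>

lemma integral_completion_AE_eq:
  fixes f g :: "'a \<Rightarrow> real"
  assumes g: "g \<in> borel_measurable M" and ae: "AE x in M. f x = g x"
  shows "integral\<^sup>L (completion M) f = integral\<^sup>L M g"
proof -
  have "integral\<^sup>L (completion M) f = integral\<^sup>L (completion M) g"
    by (rule integral_cong_AE[OF borel_measurable_completion_AE_eq[OF g ae] measurable_completion[OF g] AE_completion[OF ae]])
  also have "\<dots> = integral\<^sup>L M g" by (rule integral_completion[OF g])
  finally show ?thesis .
qed

section \<open>Lebesgue measure on the unit interval and square against \<open>unif\<close>\<close>

lemma space_unit_leb: "space unit_leb = {0..1}"
  by (simp add: space_restrict_space)

lemma AE_unit_leb_iff: "(AE x in unit_leb. P x) \<longleftrightarrow> (AE x in unif. P x)"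
  unfolding AE_unif_iff by (subst AE_restrict_space_iff) (auto simp: AE_completion_iff)

lemma emeasure_unit_leb: "A \<in> sets borel \<Longrightarrow> emeasure unit_leb (A \<inter> {0..1}) = emeasure unif A"
  by (subst emeasure_restrict_space) (auto simp: emeasure_unif)

lemma prob_space_unit_leb: "prob_space unit_leb"
  by (rule prob_spaceI) (simp add: space_unit_leb emeasure_restrict_space)

lemma measurable_unit_leb_id: "(\<lambda>x. x) \<in> measurable unit_leb borel"
  by (rule measurable_restrict_space1) (simp add: measurable_completion)

lemma distr_unit_leb_id: "distr unit_leb borel (\<lambda>x. x) = unif"
proof (rule measure_eqI)
  fix A assume "A \<in> sets (distr unit_leb borel (\<lambda>x. x))"
  then have "A \<in> sets borel" by simp
  then show "emeasure (distr unit_leb borel (\<lambda>x. x)) A = emeasure unif A"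
    by (subst emeasure_distr[OF measurable_unit_leb_id]) (auto simp: space_unit_leb emeasure_unit_leb)
qed simp

lemma unit_square_borel [measurable]: "({0..1} \<times> {0..1} :: (real \<times> real) set) \<in> sets borel"
  by (intro borel_closed closed_Times) auto

lemma unif2_eq_density:
  "unif \<Otimes>\<^sub>M unif = density lborel (\<lambda>z. indicator ({0..1} \<times> {0..1}) z)"
proof -
  have "unif \<Otimes>\<^sub>M unif = density (lborel \<Otimes>\<^sub>M lborel) (\<lambda>(x, y). indicator {0..1} x * indicator {0..1} y)"
    unfolding unif_def
    by (rule pair_measure_density) (auto simp: lborel.sigma_finite_measure_axioms
        unif.sigma_finite_measure_axioms[unfolded unif_def])
  also have "\<dots> = density lborel (\<lambda>z. indicator ({0..1} \<times> {0..1}) z)"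
    unfolding lborel_prod by (intro arg_cong[of _ _ "density lborel"]) (auto simp: indicator_def)
  finally show ?thesis .
qed

lemma AE_unif2_iff: "(AE z in unif \<Otimes>\<^sub>M unif. P z) \<longleftrightarrow> (AE z in lborel. z \<in> {0..1} \<times> {0..1} \<longrightarrow> P z)"
  unfolding unif2_eq_density
  by (subst AE_density, measurable) (auto simp: indicator_def intro!: AE_cong)

lemma Int_unit_in_sets:
  assumes "S \<in> sets borel"
  shows "S \<inter> {0..1} \<in> sets unit_leb"
proof -
  have "S \<inter> {0..1} \<in> sets lborel" using assms by simp
  then have "S \<inter> {0..1} \<in> sets lebesgue" by (rule sets_completionI_sets)
  then show ?thesis by (subst sets_restrict_space_iff) auto
qed

lemma unit_leb_set_version:
  assumes "S \<in> sets unit_leb"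
  shows "\<exists>S'\<in>sets borel. AE x in unif. x \<in> S \<longleftrightarrow> x \<in> S'"
proof -
  have "S \<in> sets lebesgue" using assms by (auto simp: sets_restrict_space)
  then obtain S' N N' where S: "S = S' \<union> N" "N \<subseteq> N'" "N' \<in> null_sets lborel" "S' \<in> sets lborel"
    by (rule sets_completionE)
  have "AE x in lborel. x \<notin> N'" using S by (intro AE_not_in)
  then have "AE x in unif. x \<in> S \<longleftrightarrow> x \<in> S'" unfolding AE_unif_iff
    by (rule eventually_mono) (use S in auto)
  with S show ?thesis by auto
qed

lemma set_integral_rectangle:
  fixes U U' :: "real \<times> real \<Rightarrow> real"
  assumes S: "S \<subseteq> {0..1}" "T \<subseteq> {0..1}" and [measurable]: "S' \<in> sets borel" "T' \<in> sets borel"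
    and SS: "AE x in unif. x \<in> S \<longleftrightarrow> x \<in> S'" and TT: "AE x in unif. x \<in> T \<longleftrightarrow> x \<in> T'"
    and [measurable]: "U' \<in> borel_measurable (borel \<Otimes>\<^sub>M borel)" and U: "AE z in unif \<Otimes>\<^sub>M unif. U z = U' z"
  shows "(LINT z:S \<times> T|lebesgue. U z) = (\<integral>z. indicator S' (fst z) * indicator T' (snd z) * U' z \<partial>(unif \<Otimes>\<^sub>M unif))"
proof -
  have [measurable]: "U' \<in> borel_measurable borel" using assms(7) by (simp add: borel_prod)
  have m: "(\<lambda>z. indicator S' (fst z) * indicator T' (snd z) * U' z) \<in> borel_measurable borel"
    unfolding borel_prod[symmetric] by measurable
  have ae: "AE z in unif \<Otimes>\<^sub>M unif. indicator (S \<times> T) z *\<^sub>R U z = indicator S' (fst z) * indicator T' (snd z) * U' z"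
    using AE_unif2[OF SS] AE_unif2[OF TT] U by eventually_elim (auto simp: indicator_def)
  have "(LINT z:S \<times> T|lebesgue. U z) =
    (\<integral>z. indicator ({0..1} \<times> {0..1}) z *\<^sub>R (indicator S' (fst z) * indicator T' (snd z) * U' z) \<partial>lborel)"
    unfolding set_lebesgue_integral_def
  proof (rule integral_completion_AE_eq)
    show "(\<lambda>z. indicator ({0..1} \<times> {0..1}) z *\<^sub>R (indicator S' (fst z) * indicator T' (snd z) * U' z)) \<in> borel_measurable lborel"
      using m by measurable
    show "AE z in lborel. indicator (S \<times> T) z *\<^sub>R U z =
        indicator ({0..1} \<times> {0..1}) z *\<^sub>R (indicator S' (fst z) * indicator T' (snd z) * U' z)"
      using ae unfolding AE_unif2_iff
      by (rule eventually_mono) (use S in \<open>auto simp: indicator_def\<close>)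
  qed
  also have "\<dots> = (\<integral>z. indicator S' (fst z) * indicator T' (snd z) * U' z \<partial>density lborel (\<lambda>z. ennreal (indicator ({0..1} \<times> {0..1}) z)))"
    by (rule integral_density[symmetric]) (use m in auto)
  finally show ?thesis by (simp add: unif2_eq_density ennreal_indicator)
qed

lemma cut_le_trivial:
  assumes [measurable]: "U' \<in> borel_measurable (borel \<Otimes>\<^sub>M borel)" and K: "\<And>z. \<bar>U' z\<bar> \<le> K"
  shows "cut_le unif U' K"
proof (rule cut_le_L1[OF prob_space_unif])
  have K': "\<bar>\<bar>U' z\<bar>\<bar> \<le> K" for z using K by simp
  show "integrable (unif \<Otimes>\<^sub>M unif) (\<lambda>z. \<bar>U' z\<bar>)" by (rule unif2.integrable_bounded[OF _ K']) measurable
  have "\<bar>\<integral>z. \<bar>U' z\<bar> \<partial>(unif \<Otimes>\<^sub>M unif)\<bar> \<le> K" by (rule unif2.integral_abs_le_const[OF K'])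
  then show "(\<integral>z. \<bar>U' z\<bar> \<partial>(unif \<Otimes>\<^sub>M unif)) \<le> K" by simp
qed

context
  fixes U U' :: "real \<times> real \<Rightarrow> real" and K :: real
  assumes U'[measurable]: "U' \<in> borel_measurable (borel \<Otimes>\<^sub>M borel)" and K: "\<And>z. \<bar>U' z\<bar> \<le> K"
    and U: "AE z in unif \<Otimes>\<^sub>M unif. U z = U' z"
begin

text \<open>Lebesgue sets have Borel versions, and Borel sets cut down to the unit interval are
  Lebesgue sets; neither change affects the integrals.\<close>

lemma cut_le_iff_rectangles:
  "cut_le unif U' c \<longleftrightarrow> (\<forall>S\<in>sets unit_leb. \<forall>T\<in>sets unit_leb. \<bar>LINT z:S \<times> T|lebesgue. U z\<bar> \<le> c)"
proof safe
  fix S T assume c: "cut_le unif U' c" and ST: "S \<in> sets unit_leb" "T \<in> sets unit_leb"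
  obtain S' T' where "S' \<in> sets borel" "T' \<in> sets borel"
    "AE x in unif. x \<in> S \<longleftrightarrow> x \<in> S'" "AE x in unif. x \<in> T \<longleftrightarrow> x \<in> T'"
    using unit_leb_set_version ST by metis
  moreover have "S \<subseteq> {0..1}" "T \<subseteq> {0..1}" using ST by (auto simp: sets_restrict_space)
  ultimately show "\<bar>LINT z:S \<times> T|lebesgue. U z\<bar> \<le> c"
    using c set_integral_rectangle[of S T S' T' U' U] U' U by (simp add: cut_le_def)
next
  assume c: "\<forall>S\<in>sets unit_leb. \<forall>T\<in>sets unit_leb. \<bar>LINT z:S \<times> T|lebesgue. U z\<bar> \<le> c"
  show "cut_le unif U' c" unfolding cut_le_def
  proof safe
    fix S T assume "S \<in> sets unif" "T \<in> sets unif"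
    then have ST: "S \<in> sets borel" "T \<in> sets borel" by auto
    have AE01: "AE x in unif. x \<in> {0..1}" using AE_unif_interior by (rule eventually_mono) auto
    have ae: "AE x in unif. x \<in> R \<inter> {0..1} \<longleftrightarrow> x \<in> R" for R using AE01 by (rule eventually_mono) auto
    have "S \<inter> {0..1} \<in> sets unit_leb" "T \<inter> {0..1} \<in> sets unit_leb"
      by (rule Int_unit_in_sets[OF ST(1)], rule Int_unit_in_sets[OF ST(2)])
    then have "\<bar>LINT z:(S \<inter> {0..1}) \<times> (T \<inter> {0..1})|lebesgue. U z\<bar> \<le> c" using c by blast
    then show "\<bar>\<integral>z. indicator S (fst z) * indicator T (snd z) * U' z \<partial>(unif \<Otimes>\<^sub>M unif)\<bar> \<le> c"
      using set_integral_rectangle[of "S \<inter> {0..1}" "T \<inter> {0..1}" S T U' U] ST ae U' U by simp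
  qed
qed

lemma kernel_cut_norm_bdd:
  "bdd_above ((\<lambda>(S, T). \<bar>LINT z:S \<times> T|lebesgue. U z\<bar>) ` (sets unit_leb \<times> sets unit_leb))"
  using cut_le_iff_rectangles[of K] cut_le_trivial[OF U' K] by (intro bdd_aboveI[of _ K]) auto

lemma kernel_cut_norm_le_iff: "kernel_cut_norm U \<le> c \<longleftrightarrow> cut_le unif U' c"
  unfolding kernel_cut_norm_def cut_le_iff_rectangles
  by (subst cSUP_le_iff[OF _ kernel_cut_norm_bdd]) auto

lemma kernel_cut_norm_nonneg: "0 \<le> kernel_cut_norm U"
  using kernel_cut_norm_le_iff[of "kernel_cut_norm U"] cut_le_nonneg by blast

end

section \<open>The signal cut norm against the L^1 norm\<close>

lemma set_integral_interval:
  fixes h h' :: "real \<Rightarrow> real"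
  assumes S: "S \<subseteq> {0..1}" and [measurable]: "S' \<in> sets borel" and SS: "AE x in unif. x \<in> S \<longleftrightarrow> x \<in> S'"
    and [measurable]: "h' \<in> borel_measurable borel" and h: "AE x in unif. h x = h' x"
  shows "(LINT x:S|lebesgue. h x) = (\<integral>x. indicator S' x * h' x \<partial>unif)"
proof -
  have ae: "AE x in unif. indicator S x *\<^sub>R h x = indicator S' x * h' x"
    using SS h by eventually_elim (auto simp: indicator_def)
  have "(LINT x:S|lebesgue. h x) = (\<integral>x. indicator {0..1} x *\<^sub>R (indicator S' x * h' x) \<partial>lborel)"
    unfolding set_lebesgue_integral_def
  proof (rule integral_completion_AE_eq)
    show "AE x in lborel. indicator S x *\<^sub>R h x = indicator {0..1} x *\<^sub>R (indicator S' x * h' x)"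
      using ae unfolding AE_unif_iff
      by (rule eventually_mono) (use S in \<open>auto simp: indicator_def\<close>)
  qed measurable
  also have "\<dots> = (\<integral>x. indicator S' x * h' x \<partial>density lborel (\<lambda>x. ennreal (indicator {0..1} x)))"
    by (rule integral_density[symmetric]) auto
  finally show ?thesis by (simp add: unif_def ennreal_indicator)
qed

context
  fixes h h' :: "real \<Rightarrow> real" and K :: real
  assumes h'[measurable]: "h' \<in> borel_measurable borel" and K: "\<And>x. \<bar>h' x\<bar> \<le> K"
    and h: "AE x in unif. h x = h' x"
begin

lemma abs_set_integral_le_L1:
  assumes S: "S \<in> sets unit_leb"
  shows "\<bar>LINT x:S|lebesgue. h x\<bar> \<le> (\<integral>x. \<bar>h' x\<bar> \<partial>unif)"
proof -
  obtain S' where S': "S' \<in> sets borel" "AE x in unif. x \<in> S \<longleftrightarrow> x \<in> S'"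
    using unit_leb_set_version[OF S] by blast
  have "S \<subseteq> {0..1}" using S by (auto simp: sets_restrict_space)
  then have "\<bar>LINT x:S|lebesgue. h x\<bar> = \<bar>\<integral>x. indicator S' x * h' x \<partial>unif\<bar>"
    using set_integral_interval[OF _ S' h' h] by simp
  also have "\<dots> \<le> (\<integral>x. \<bar>indicator S' x * h' x\<bar> \<partial>unif)" by (rule integral_abs_bound)
  also have "\<dots> \<le> (\<integral>x. \<bar>h' x\<bar> \<partial>unif)"
  proof (rule integral_mono_AE')
    have K': "\<bar>\<bar>h' x\<bar>\<bar> \<le> K" for x using K by simp
    show "integrable unif (\<lambda>x. \<bar>h' x\<bar>)" by (rule unif.integrable_bounded[OF _ K']) measurable
  qed (auto simp: indicator_def)
  finally show ?thesis .
qed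

lemma signal_cut_norm_le_L1: "signal_cut_norm h \<le> (\<integral>x. \<bar>h' x\<bar> \<partial>unif)"
  unfolding signal_cut_norm_def by (rule cSUP_least) (auto intro: abs_set_integral_le_L1)

text \<open>The integral of |h'| splits over the set where h' is nonnegative and its complement, and
  each part is bounded by the cut norm.\<close>

lemma L1_le_signal_cut_norm: "(\<integral>x. \<bar>h' x\<bar> \<partial>unif) \<le> 2 * signal_cut_norm h"
proof -
  have bdd: "bdd_above ((\<lambda>S. \<bar>LINT x:S|lebesgue. h x\<bar>) ` sets unit_leb)"
    by (rule bdd_aboveI[of _ "\<integral>x. \<bar>h' x\<bar> \<partial>unif"]) (auto intro: abs_set_integral_le_L1)
  have AE01: "AE x in unif. x \<in> {0..1}" using AE_unif_interior by (rule eventually_mono) auto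
  have le: "\<bar>\<integral>x. indicator S x * h' x \<partial>unif\<bar> \<le> signal_cut_norm h" if S: "S \<in> sets borel" for S
  proof -
    have "S \<inter> {0..1} \<in> sets unit_leb" using S by (rule Int_unit_in_sets)
    then have "\<bar>LINT x:S \<inter> {0..1}|lebesgue. h x\<bar> \<le> signal_cut_norm h"
      unfolding signal_cut_norm_def by (rule cSUP_upper[OF _ bdd])
    moreover have "(LINT x:S \<inter> {0..1}|lebesgue. h x) = (\<integral>x. indicator S x * h' x \<partial>unif)"
      by (rule set_integral_interval[OF _ S _ h' h]) (use AE01 in \<open>auto elim: eventually_mono\<close>)
    ultimately show ?thesis by simp
  qed
  define P where "P = {x. 0 \<le> h' x}"
  have [measurable]: "P \<in> sets borel" "- P \<in> sets borel"
  proof -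
    have "{x \<in> space borel. 0 \<le> h' x} \<in> sets borel" by measurable
    then show "P \<in> sets borel" by (simp add: P_def)
    then show "- P \<in> sets borel" by auto
  qed
  have ind: "\<bar>indicator S x * h' x\<bar> \<le> K" for S x by (rule abs_indicator_mult_le[OF K])
  have i: "integrable unif (\<lambda>x. indicator P x * h' x)" "integrable unif (\<lambda>x. indicator (- P) x * h' x)"
    by (rule unif.integrable_bounded[OF _ ind], measurable)+
  have "(\<integral>x. \<bar>h' x\<bar> \<partial>unif) = (\<integral>x. indicator P x * h' x - indicator (- P) x * h' x \<partial>unif)"
    by (intro Bochner_Integration.integral_cong refl) (auto simp: P_def indicator_def)
  also have "\<dots> = (\<integral>x. indicator P x * h' x \<partial>unif) - (\<integral>x. indicator (- P) x * h' x \<partial>unif)"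
    using i by (rule Bochner_Integration.integral_diff)
  also have "\<dots> \<le> 2 * signal_cut_norm h" using le[of P] le[of "- P"] by (simp add: abs_le_iff)
  finally show ?thesis .
qed

end

definition borel_version :: "real \<Rightarrow> (real \<times> real \<Rightarrow> real) \<Rightarrow> (real \<Rightarrow> real) \<Rightarrow> (real \<times> real \<Rightarrow> real) \<Rightarrow> (real \<Rightarrow> real) \<Rightarrow> bool" where
  "borel_version r W f W' f' \<longleftrightarrow> borel_gs r W' f' \<and> (\<forall>s t. W' (s, t) = W' (t, s)) \<and>
     (AE z in unif \<Otimes>\<^sub>M unif. W z = W' z) \<and> (AE x in unif. f x = f' x)"

text \<open>A Borel function equal to the original almost everywhere may violate symmetry and the
  bounds on a null set. Averaging with the transpose restores symmetry, and clamping restores the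
  bounds; almost everywhere, both leave the values unchanged.\<close>

lemma borel_version_exists:
  assumes r: "0 \<le> r" and Wf: "(W, f) \<in> graphon_signals r"
  shows "\<exists>W' f'. borel_version r W f W' f'"
proof -
  let ?Q = "{0..1} \<times> {0..1} :: (real \<times> real) set"
  have Q: "?Q \<in> sets lebesgue" using unit_square_borel by (intro sets_completionI_sets) simp
  have W: "W \<in> borel_measurable (lebesgue_on ?Q)" "\<And>z. z \<in> ?Q \<Longrightarrow> 0 \<le> W z \<and> W z \<le> 1"
    "\<And>x y. x \<in> {0..1} \<Longrightarrow> y \<in> {0..1} \<Longrightarrow> W (x, y) = W (y, x)"
    and f: "f \<in> borel_measurable unit_leb" "esssup unit_leb (\<lambda>x. ereal \<bar>f x\<bar>) \<le> ereal r"
    using Wf by (auto simp: graphon_signals_def graphon_def kernel_def)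
  have "(\<lambda>z. if z \<in> ?Q then W z else 0) \<in> borel_measurable lebesgue"
    using W(1) measurable_restrict_space_iff[of ?Q lebesgue 0 borel W] Q by simp
  then obtain W0 where W0[measurable]: "W0 \<in> borel_measurable lborel"
    and W0': "AE z in lborel. (if z \<in> ?Q then W z else 0) = W0 z"
    using completion_ex_borel_measurable_real by blast
  have [measurable]: "W0 \<in> borel_measurable (borel \<Otimes>\<^sub>M borel)" using W0 by (simp add: borel_prod)
  have W0ae: "AE z in unif \<Otimes>\<^sub>M unif. z \<in> ?Q \<and> W z = W0 z"
    unfolding AE_unif2_iff using W0' by (rule eventually_mono) auto
  have swap: "AE z in unif \<Otimes>\<^sub>M unif. (snd z, fst z) \<in> ?Q \<and> W (snd z, fst z) = W0 (snd z, fst z)"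
  proof -
    have "AE z in distr (unif \<Otimes>\<^sub>M unif) (unif \<Otimes>\<^sub>M unif) (\<lambda>(x, y). (y, x)). z \<in> ?Q \<and> W z = W0 z"
      by (subst unif2.distr_pair_swap[symmetric]) (rule W0ae)
    from AE_distrD[OF measurable_pair_swap' this] show ?thesis by (simp add: split_beta')
  qed
  define W' where "W' = (\<lambda>z. clamp 0 1 ((W0 z + W0 (snd z, fst z)) / 2))"
  have "AE z in unif \<Otimes>\<^sub>M unif. W z = W' z"
    using W0ae swap
  proof eventually_elim
    case (elim z)
    then have "W (snd z, fst z) = W z" using W(3)[of "fst z" "snd z"] by (auto simp: mem_Times_iff)
    then show ?case using elim W(2)[of z] by (simp add: W'_def clamp_id)
  qed
  moreover have "W' \<in> borel_measurable (borel \<Otimes>\<^sub>M borel)" unfolding W'_def by measurable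
  moreover have "W' (s, t) = W' (t, s)" for s t by (simp add: W'_def add.commute)
  moreover
  have "(\<lambda>x. if x \<in> {0..1} then f x else 0) \<in> borel_measurable lebesgue"
    using f(1) measurable_restrict_space_iff[of "{0..1}" lebesgue 0 borel f] by simp
  then obtain f0 where f0[measurable]: "f0 \<in> borel_measurable lborel"
    and f0': "AE x in lborel. (if x \<in> {0..1} then f x else 0) = f0 x"
    using completion_ex_borel_measurable_real by blast
  have f0ae: "AE x in unif. f x = f0 x"
    unfolding AE_unif_iff using f0' by (rule eventually_mono) auto
  have "AE x in unit_leb. ereal \<bar>f x\<bar> \<le> esssup unit_leb (\<lambda>x. ereal \<bar>f x\<bar>)" by (rule esssup_AE)
  then have "AE x in unit_leb. \<bar>f x\<bar> \<le> r"
  proof (rule eventually_mono)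
    fix x assume "ereal \<bar>f x\<bar> \<le> esssup unit_leb (\<lambda>x. ereal \<bar>f x\<bar>)"
    then have "ereal \<bar>f x\<bar> \<le> ereal r" using f(2) by (rule order_trans)
    then show "\<bar>f x\<bar> \<le> r" by simp
  qed
  then have fr: "AE x in unif. \<bar>f x\<bar> \<le> r" by (simp add: AE_unit_leb_iff)
  define f' where "f' = (\<lambda>x. clamp (- r) r (f0 x))"
  have "AE x in unif. f x = f' x"
    using f0ae fr by eventually_elim (auto simp: f'_def clamp_id abs_le_iff)
  moreover have "f' \<in> borel_measurable borel" using f0 unfolding f'_def by simp
  moreover have "\<bar>f' x\<bar> \<le> r" for x using clamp_in[of "-r" r "f0 x"] r by (simp add: f'_def abs_le_iff minus_le_iff)
  moreover have "0 \<le> W' z \<and> W' z \<le> 1" for z using clamp_in[of 0 1] by (simp add: W'_def)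
  ultimately have "borel_version r W f W' f'" unfolding borel_version_def borel_gs_def by blast
  then show ?thesis by blast
qed

section \<open>Homomorphism densities of Borel versions\<close>

text \<open>The indicator of a null set has cut bound 0, so the pivot bound with constant factors 1
  makes its integral at (x i, x j) vanish. This replaces a computation of the joint law of two
  coordinates.\<close>

lemma AE_sample_pair:
  assumes ae: "AE z in unif \<Otimes>\<^sub>M unif. P z" and ij: "i \<in> {1..k}" "j \<in> {1..k}" "i \<noteq> j"
  shows "AE x in sample_space k. P (x i, x j)"
proof -
  interpret S: prob_space "sample_space k" by (rule prob_space_sample)
  obtain N where N: "N \<in> null_sets (unif \<Otimes>\<^sub>M unif)" "{z. \<not> P z} \<subseteq> N"
    using ae by (auto simp: eventually_ae_filter space_pair_measure)
  have [measurable]: "N \<in> sets (unif \<Otimes>\<^sub>M unif)" using N by auto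
  have N0: "(\<integral>z. indicator N z \<partial>(unif \<Otimes>\<^sub>M unif)) = (0 :: real)" using N by (simp add: measure_def null_setsD1)
  have c: "cut_le unif (indicator N) 0"
  proof (rule cut_le_L1[OF prob_space_unif])
    show "integrable (unif \<Otimes>\<^sub>M unif) (\<lambda>z. \<bar>indicator N z\<bar> :: real)"
      by (rule unif2.integrable_bounded[where K=1]) (auto simp: indicator_def)
  qed (use N0 in simp)
  have "\<bar>\<integral>x. 1 * 1 * indicator N (x i, x j) \<partial>sample_space k\<bar> \<le> 4 * 1 * 1 * (0 :: real)"
  proof (rule pivot_bound[OF prob_space_unif _ ij _ _ _ _ _ _ c])
    show "\<bar>indicator N z :: real\<bar> \<le> 1" for z by (simp add: indicator_def)
  qed auto
  moreover have "0 \<le> (\<integral>x. indicator N (x i, x j) \<partial>sample_space k :: real)"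
    by (rule Bochner_Integration.integral_nonneg) simp
  ultimately have int0: "(\<integral>x. indicator N (x i, x j) \<partial>sample_space k) = (0 :: real)"
    by (simp only: mult_1_left mult_1_right mult_zero_right abs_le_zero_iff)
  have m: "(\<lambda>x. indicator N (x i, x j) :: real) \<in> borel_measurable (sample_space k)"
  proof -
    have "(\<lambda>x. (x i, x j)) \<in> measurable (sample_space k) (unif \<Otimes>\<^sub>M unif)"
      using ij by (intro measurable_Pair measurable_component_singleton)
    from measurable_compose[OF this, of "indicator N :: _ \<Rightarrow> real" borel] show ?thesis by simp
  qed
  have "integrable (sample_space k) (\<lambda>x. indicator N (x i, x j) :: real)"
    by (rule S.integrable_bounded[OF m, where K=1]) (simp add: indicator_def)
  then have "AE x in sample_space k. indicator N (x i, x j) = (0 :: real)"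
    using int0 by (subst (asm) integral_nonneg_eq_0_iff_AE) auto
  then show ?thesis by (rule eventually_mono) (use N in \<open>auto simp: indicator_def\<close>)
qed

text \<open>The coordinatewise identity carries the product of Lebesgue measures to the product of
  copies of \<open>unif\<close>. Almost everywhere equality of the integrands is pulled back along
  it, and completion absorbs the remaining null set.\<close>

lemma hom_density_eq_hom_dens:
  assumes v: "borel_version r W f W' f'" and E: "E \<subseteq> vertex_pairs k"
  shows "hom_density k E d (W, f) = hom_dens k E d W' f'"
proof -
  let ?L = "PiM {1..k} (\<lambda>_. unit_leb)"
  define F where "F = (\<lambda>x. (\<Prod>i\<in>{1..k}. f (x i) ^ d i) * (\<Prod>e\<in>E. W (x (Min e), x (Max e))))"
  define F' where "F' = (\<lambda>x. (\<Prod>i\<in>{1..k}. f' (x i) ^ d i) * (\<Prod>e\<in>E. edge_weight W' x e))"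
  have gs: "borel_gs r W' f'" and W: "AE z in unif \<Otimes>\<^sub>M unif. W z = W' z" and f: "AE x in unif. f x = f' x"
    using v by (auto simp: borel_version_def)
  have finE: "finite E" using E finite_vertex_pairs finite_subset by blast
  have F'm: "F' \<in> borel_measurable (sample_space k)"
    unfolding F'_def using gs
    by (intro borel_measurable_times measurable_signal_prod measurable_edge_prod E) (auto simp: borel_gs_def)
  have aeS: "AE x in sample_space k. F x = F' x"
  proof -
    have 1: "AE x in sample_space k. \<forall>i\<in>{1..k}. f (x i) = f' (x i)"
    proof (subst AE_ball_countable)
      show "countable {1..k}" by simp
      show "\<forall>i\<in>{1..k}. AE x in sample_space k. f (x i) = f' (x i)"
        using f by (intro ballI AE_PiM_component prob_space_unif)
    qed
    have 2: "AE x in sample_space k. \<forall>e\<in>E. W (x (Min e), x (Max e)) = W' (x (Min e), x (Max e))"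
    proof (subst AE_ball_countable)
      show "countable E" using finE by (rule countable_finite)
      show "\<forall>e\<in>E. AE x in sample_space k. W (x (Min e), x (Max e)) = W' (x (Min e), x (Max e))"
        using vertex_pairs_Min_Max E by (intro ballI AE_sample_pair[OF W]) blast+
    qed
    from 1 2 show ?thesis
      by eventually_elim (simp add: F_def F'_def edge_weight_def del: One_nat_def)
  qed
  \<comment> \<open>Points of the product space are extensional, so the restricted identity acts
    trivially; \<open>compose\<close> is the form required by the rule for images of product
    measures.\<close>
  have cid: "compose {1..k} (\<lambda>x. x) x = x" if "x \<in> space ?L" for x
    using that by (auto simp: compose_def space_PiM PiE_def extensional_def fun_eq_iff)
  have unif': "distr unit_leb unif (\<lambda>x. x) = unif"
    using distr_unit_leb_id distr_cong[of unit_leb unit_leb unif borel "\<lambda>x. x" "\<lambda>x. x"] by simp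
  have mid: "(\<lambda>x. x) \<in> measurable unit_leb unif"
    unfolding measurable_cong_sets[OF refl sets_unif] by (rule measurable_unit_leb_id)
  have dist: "distr ?L (sample_space k) (compose {1..k} (\<lambda>x. x)) = sample_space k"
    using distr_PiM_finite_prob_space'[of "{1..k}" "\<lambda>_. unit_leb" "\<lambda>_. unif" "\<lambda>x. x"]
      prob_space_unit_leb prob_space_unif mid by (simp add: unif')
  have cm: "compose {1..k} (\<lambda>x. x) \<in> measurable ?L (sample_space k)"
    unfolding compose_def
    by (rule measurable_restrict, rule measurable_compose[OF _ mid], rule measurable_component_singleton)
  have F'c: "(\<lambda>x. F' (compose {1..k} (\<lambda>x. x) x)) \<in> borel_measurable ?L"
    by (rule measurable_compose[OF cm F'm])
  then have F'L: "F' \<in> borel_measurable ?L"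
    by (subst measurable_cong[of ?L F' "\<lambda>x. F' (compose {1..k} (\<lambda>x. x) x)"]) (simp add: cid del: One_nat_def)
  have aeL: "AE x in ?L. F x = F' x"
  proof -
    have "AE x in ?L. F (compose {1..k} (\<lambda>x. x) x) = F' (compose {1..k} (\<lambda>x. x) x)"
      by (rule AE_distrD[OF cm]) (unfold dist, rule aeS)
    then show ?thesis using AE_space by eventually_elim (use cid in metis)
  qed
  have "hom_density k E d (W, f) = integral\<^sup>L (completion ?L) F"
    by (simp add: hom_density_def F_def)
  also have "\<dots> = integral\<^sup>L ?L F'" by (rule integral_completion_AE_eq[OF F'L aeL])
  also have "\<dots> = (\<integral>x. F' (compose {1..k} (\<lambda>x. x) x) \<partial>?L)"
    by (rule Bochner_Integration.integral_cong) (simp_all add: cid del: One_nat_def)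
  also have "\<dots> = integral\<^sup>L (sample_space k) F'"
    using integral_distr[OF cm F'm] dist by simp
  finally show ?thesis by (simp add: hom_dens_def F'_def)
qed

text \<open>Applying a measure-preserving map in every coordinate preserves the product
  measure.\<close>

lemma hom_dens_mp:
  assumes "mp \<phi>" and gs: "borel_gs r W f" and E: "E \<subseteq> vertex_pairs k"
  shows "hom_dens k E d (\<lambda>z. W (\<phi> (fst z), \<phi> (snd z))) (\<lambda>x. f (\<phi> x)) = hom_dens k E d W f"
proof -
  have \<phi>[measurable]: "\<phi> \<in> borel_measurable borel" by (rule mp_measurable) fact
  have \<phi>u: "\<phi> \<in> measurable unif unif" by measurable
  have "distr unif unif \<phi> = unif"
    using assms(1) distr_cong[of unif unif unif borel \<phi> \<phi>] by (simp add: mp_def)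
  then have dist: "distr (sample_space k) (sample_space k) (compose {1..k} \<phi>) = sample_space k"
    using distr_PiM_finite_prob_space'[of "{1..k}" "\<lambda>_. unif" "\<lambda>_. unif" \<phi>] prob_space_unif \<phi>u by simp
  have cm: "compose {1..k} \<phi> \<in> measurable (sample_space k) (sample_space k)"
    unfolding compose_def
    by (rule measurable_restrict, rule measurable_compose[OF _ \<phi>u], rule measurable_component_singleton)
  define F where "F = (\<lambda>x. (\<Prod>i\<in>{1..k}. f (x i) ^ d i) * (\<Prod>e\<in>E. edge_weight W x e))"
  have Fm: "F \<in> borel_measurable (sample_space k)"
    unfolding F_def using gs
    by (intro borel_measurable_times measurable_signal_prod measurable_edge_prod E) (auto simp: borel_gs_def)
  have "F (compose {1..k} \<phi> x) = (\<Prod>i\<in>{1..k}. f (\<phi> (x i)) ^ d i) * (\<Prod>e\<in>E. edge_weight (\<lambda>z. W (\<phi> (fst z), \<phi> (snd z))) x e)" for x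
  proof -
    have "(\<Prod>e\<in>E. edge_weight W (compose {1..k} \<phi> x) e) = (\<Prod>e\<in>E. edge_weight (\<lambda>z. W (\<phi> (fst z), \<phi> (snd z))) x e)"
    proof (intro prod.cong refl)
      fix e assume "e \<in> E"
      then have "Min e \<in> {1..k}" "Max e \<in> {1..k}" using E vertex_pairs_Min_Max by blast+
      then show "edge_weight W (compose {1..k} \<phi> x) e = edge_weight (\<lambda>z. W (\<phi> (fst z), \<phi> (snd z))) x e"
        by (simp add: edge_weight_def compose_def)
    qed
    moreover have "(\<Prod>i\<in>{1..k}. f (compose {1..k} \<phi> x i) ^ d i) = (\<Prod>i\<in>{1..k}. f (\<phi> (x i)) ^ d i)"
      by (intro prod.cong) (auto simp: compose_def)
    ultimately show ?thesis by (simp add: F_def del: One_nat_def)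
  qed
  then have "hom_dens k E d (\<lambda>z. W (\<phi> (fst z), \<phi> (snd z))) (\<lambda>x. f (\<phi> x)) = (\<integral>x. F (compose {1..k} \<phi> x) \<partial>sample_space k)"
    by (simp add: hom_dens_def del: One_nat_def)
  also have "\<dots> = integral\<^sup>L (sample_space k) F"
    using integral_distr[OF cm Fm] dist by simp
  finally show ?thesis by (simp add: hom_dens_def F_def)
qed

section \<open>Passing between Lebesgue and Borel rearrangements\<close>

lemma ae_bij_borel_version:
  assumes \<phi>: "\<phi> \<in> ae_bij_measure_preserving"
  shows "\<exists>\<phi>'. mp \<phi>' \<and> (AE x in unif. \<phi> x = \<phi>' x)"
proof -
  have m: "\<phi> \<in> measurable unit_leb unit_leb" and d: "distr unit_leb unit_leb \<phi> = unit_leb"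
    using \<phi> by (auto simp: ae_bij_measure_preserving_def)
  have mb: "\<phi> \<in> borel_measurable unit_leb"
    by (rule measurable_compose[OF m measurable_unit_leb_id])
  have "(\<lambda>x. if x \<in> {0..1} then \<phi> x else 0) \<in> borel_measurable lebesgue"
    using mb measurable_restrict_space_iff[of "{0..1}" lebesgue 0 borel \<phi>] by simp
  then obtain \<phi>' where \<phi>'[measurable]: "\<phi>' \<in> borel_measurable lborel"
    and ae: "AE x in lborel. (if x \<in> {0..1} then \<phi> x else 0) = \<phi>' x"
    using completion_ex_borel_measurable_real by blast
  have [measurable]: "\<phi>' \<in> borel_measurable borel" using \<phi>' by simp
  have ae': "AE x in unif. \<phi> x = \<phi>' x"
    unfolding AE_unif_iff using ae by (rule eventually_mono) auto
  have "distr unif borel \<phi>' = distr (distr unit_leb borel (\<lambda>x. x)) borel \<phi>'" by (simp add: distr_unit_leb_id)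
  also have "\<dots> = distr unit_leb borel (\<phi>' \<circ> (\<lambda>x. x))"
    by (rule distr_distr) (auto intro: measurable_unit_leb_id)
  also have "\<dots> = distr unit_leb borel \<phi>"
  proof (rule distr_cong_AE)
    show "AE x in unit_leb. (\<phi>' \<circ> (\<lambda>x. x)) x = \<phi> x"
      unfolding AE_unit_leb_iff using ae' by (rule eventually_mono) simp
    show "\<phi>' \<circ> (\<lambda>x. x) \<in> measurable unit_leb borel"
      using measurable_compose[OF measurable_unit_leb_id, of \<phi>' borel] by (simp add: o_def)
  qed (use mb in auto)
  also have "\<dots> = distr (distr unit_leb unit_leb \<phi>) borel (\<lambda>x. x)"
    using distr_distr[OF measurable_unit_leb_id m] by (simp add: o_def)
  also have "\<dots> = unif" by (simp add: d distr_unit_leb_id)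
  finally have "mp \<phi>'" by (simp add: mp_def)
  with ae' show ?thesis by blast
qed

lemma unit_AE_null_set:
  assumes "AE x in unif. P x"
  shows "{x \<in> {0..1}. \<not> P x} \<in> null_sets unit_leb"
proof -
  have "AE x in lebesgue. x \<in> {0..1} \<longrightarrow> P x" using assms by (simp add: AE_unif_iff AE_completion_iff)
  then have "{x \<in> space lebesgue. \<not> (x \<in> {0..1} \<longrightarrow> P x)} \<in> null_sets lebesgue"
    unfolding completion.AE_iff_null_sets .
  moreover have "{x \<in> space lebesgue. \<not> (x \<in> {0..1} \<longrightarrow> P x)} = {x \<in> {0..1}. \<not> P x}" by auto
  ultimately show ?thesis by (subst null_sets_restrict_space) auto
qed

text \<open>A Borel map preserving \<open>unif\<close> may leave the unit interval on a null set,
  which clamping repairs. Preimages of Lebesgue sets are Lebesgue because a Lebesgue set differs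
  from a Borel set by a null set, and preimages of null sets are null.\<close>

lemma clamp_mp_measure_preserving:
  assumes "mp \<phi>"
  shows "(\<lambda>x. clamp 0 1 (\<phi> x)) \<in> measurable unit_leb unit_leb"
    and "distr unit_leb unit_leb (\<lambda>x. clamp 0 1 (\<phi> x)) = unit_leb"
    and "AE x in unif. clamp 0 1 (\<phi> x) = \<phi> x"
proof -
  let ?\<phi> = "\<lambda>x. clamp 0 1 (\<phi> x)"
  have [measurable]: "\<phi> \<in> borel_measurable borel" by (rule mp_measurable) fact
  show cl: "AE x in unif. ?\<phi> x = \<phi> x"
    using mp_AE[OF assms AE_unif_interior] by (rule eventually_mono) (simp add: clamp_id)
  have key: "{x \<in> {0..1}. ?\<phi> x \<in> S} \<in> sets unit_leb \<and> emeasure unit_leb {x \<in> {0..1}. ?\<phi> x \<in> S} = emeasure unit_leb S"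
    if S: "S \<in> sets unit_leb" for S
  proof -
    obtain S' where S'[measurable]: "S' \<in> sets borel" and ae: "AE x in unif. x \<in> S \<longleftrightarrow> x \<in> S'"
      using unit_leb_set_version[OF S] by blast
    define A where "A = \<phi> -` S'"
    have A[measurable]: "A \<in> sets borel" unfolding A_def by (rule measurable_sets_borel[OF _ S']) measurable
    define B where "B = {x \<in> {0..1}. ?\<phi> x \<in> S}"
    have AB: "AE x in unif. x \<in> A \<inter> {0..1} \<longleftrightarrow> x \<in> B"
      using mp_AE[OF assms ae] cl AE_unif_interior by eventually_elim (auto simp: A_def B_def)
    have Al: "A \<inter> {0..1} \<in> sets lebesgue" using A by (intro sets_completionI_sets) simp
    have "AE x in lebesgue. x \<in> A \<inter> {0..1} \<longleftrightarrow> x \<in> B"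
      unfolding AE_completion_iff
      using AB unfolding AE_unif_iff by (rule eventually_mono) (auto simp: B_def)
    then have Bl: "B \<in> sets lebesgue" by (rule completion.in_sets_AE) (use Al in auto)
    have "B \<subseteq> {0..1}" unfolding B_def by blast
    with Bl have B: "B \<in> sets unit_leb" by (simp add: sets_restrict_space_iff)
    have "emeasure unit_leb B = emeasure unit_leb (A \<inter> {0..1})"
    proof (rule emeasure_eq_AE[OF _ B Int_unit_in_sets[OF A]])
      show "AE x in unit_leb. x \<in> B \<longleftrightarrow> x \<in> A \<inter> {0..1}"
        unfolding AE_unit_leb_iff using AB by (rule eventually_mono) blast
    qed
    also have "\<dots> = emeasure unif A" by (rule emeasure_unit_leb[OF A])
    also have "\<dots> = emeasure (distr unif borel \<phi>) S'" by (subst emeasure_distr) (auto simp: A_def)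
    also have "\<dots> = emeasure unif S'" using assms by (simp add: mp_def)
    also have "\<dots> = emeasure unit_leb (S' \<inter> {0..1})" by (rule emeasure_unit_leb[symmetric, OF S'])
    also have "\<dots> = emeasure unit_leb S"
    proof (rule emeasure_eq_AE[OF _ Int_unit_in_sets[OF S'] S])
      show "AE x in unit_leb. x \<in> S' \<inter> {0..1} \<longleftrightarrow> x \<in> S"
        unfolding AE_unit_leb_iff using ae AE_unif_interior by eventually_elim auto
    qed
    finally show ?thesis using B by (simp add: B_def)
  qed
  have pre: "?\<phi> -` S \<inter> space unit_leb = {x \<in> {0..1}. ?\<phi> x \<in> S}" for S
    by (auto simp: space_unit_leb)
  show m: "?\<phi> \<in> measurable unit_leb unit_leb"
  proof (rule measurableI)
    show "?\<phi> x \<in> space unit_leb" for x using clamp_in[of 0 1] by (simp add: space_unit_leb)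
    show "?\<phi> -` S \<inter> space unit_leb \<in> sets unit_leb" if "S \<in> sets unit_leb" for S
      using key[OF that] unfolding pre by blast
  qed
  show "distr unit_leb unit_leb ?\<phi> = unit_leb"
  proof (rule measure_eqI)
    fix S assume "S \<in> sets (distr unit_leb unit_leb ?\<phi>)"
    then have S: "S \<in> sets unit_leb" by simp
    show "emeasure (distr unit_leb unit_leb ?\<phi>) S = emeasure unit_leb S"
      unfolding emeasure_distr[OF m S] pre using key[OF S] by blast
  qed simp
qed

lemma mp_iso_ae_bij:
  assumes "mp_iso \<phi>"
  shows "(\<lambda>x. clamp 0 1 (\<phi> x)) \<in> ae_bij_measure_preserving"
proof -
  obtain \<psi> where \<psi>: "mp \<phi>" "mp \<psi>" "AE x in unif. \<psi> (\<phi> x) = x" "AE x in unif. \<phi> (\<psi> x) = x"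
    using assms by (auto simp: mp_iso_def)
  let ?\<phi> = "\<lambda>x. clamp 0 1 (\<phi> x)" and ?\<psi> = "\<lambda>x. clamp 0 1 (\<psi> x)"
  note c\<phi> = clamp_mp_measure_preserving[OF \<psi>(1)] and c\<psi> = clamp_mp_measure_preserving[OF \<psi>(2)]
  have 1: "AE x in unif. ?\<psi> (?\<phi> x) = x"
    using c\<phi>(3) mp_AE[OF \<psi>(1) c\<psi>(3)] \<psi>(3) by eventually_elim simp
  have 2: "AE x in unif. ?\<phi> (?\<psi> x) = x"
    using c\<psi>(3) mp_AE[OF \<psi>(2) c\<phi>(3)] \<psi>(4) by eventually_elim simp
  let ?M = "{x \<in> {0..1}. ?\<psi> (?\<phi> x) \<noteq> x}" and ?N = "{x \<in> {0..1}. ?\<phi> (?\<psi> x) \<noteq> x}"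
  have in01: "clamp 0 1 y \<in> {0..1}" for y :: real using clamp_in[of 0 1 y] by simp
  \<comment> \<open>If \<psi> inverts \<phi> at x, then \<phi> inverts \<psi> at \<phi> x, and
    conversely; so the two sets of good points are exchanged.\<close>
  have "bij_betw ?\<phi> ({0..1} - ?M) ({0..1} - ?N)"
    by (rule bij_betw_byWitness[where f'="?\<psi>"]) (use in01 in auto)
  then show ?thesis
    unfolding ae_bij_measure_preserving_def
    using unit_AE_null_set[OF 1] unit_AE_null_set[OF 2] c\<phi>(1,2) by blast
qed

section \<open>The cut distance in terms of Borel versions\<close>

context
  fixes r :: real and W V W' V' :: "real \<times> real \<Rightarrow> real" and f g f' g' :: "real \<Rightarrow> real"
  assumes W: "borel_version r W f W' f'" and V: "borel_version r V g V' g'"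
begin

lemma versions_gs: "borel_gs r W' f'" "borel_gs r V' g'"
  using W V by (auto simp: borel_version_def)

context
  fixes \<phi> \<phi>' :: "real \<Rightarrow> real"
  assumes \<phi>': "mp \<phi>'" and \<phi>: "AE x in unif. \<phi> x = \<phi>' x"
begin

lemma kernel_diff_measurable: "(\<lambda>z. W' z - V' (\<phi>' (fst z), \<phi>' (snd z))) \<in> borel_measurable (borel \<Otimes>\<^sub>M borel)"
proof -
  have [measurable]: "W' \<in> borel_measurable (borel \<Otimes>\<^sub>M borel)" "V' \<in> borel_measurable (borel \<Otimes>\<^sub>M borel)"
    using versions_gs by (auto simp: borel_gs_def)
  note [measurable] = mp_measurable[OF \<phi>']
  show ?thesis by measurable
qed

lemma kernel_diff_bound: "\<bar>W' z - V' (\<phi>' (fst z), \<phi>' (snd z))\<bar> \<le> 1"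
proof -
  have "0 \<le> W' z" "W' z \<le> 1" "0 \<le> V' (\<phi>' (fst z), \<phi>' (snd z))" "V' (\<phi>' (fst z), \<phi>' (snd z)) \<le> 1"
    using versions_gs unfolding borel_gs_def by blast+
  then show ?thesis by linarith
qed

text \<open>The exceptional set where V and V' differ is pulled back along the Borel map
  \<open>\<phi>'\<close>, under which null sets stay null; only afterwards is \<open>\<phi>'\<close>
  exchanged for \<phi>.\<close>

lemma kernel_diff_AE:
  "AE z in unif \<Otimes>\<^sub>M unif. (case z of (x, y) \<Rightarrow> W (x, y) - V (\<phi> x, \<phi> y)) = W' z - V' (\<phi>' (fst z), \<phi>' (snd z))"
proof -
  note [measurable] = mp_measurable[OF \<phi>']
  have "AE z in distr (unif \<Otimes>\<^sub>M unif) (borel \<Otimes>\<^sub>M borel) (\<lambda>z. (\<phi>' (fst z), \<phi>' (snd z))). V z = V' z"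
    unfolding mp_distr_pair[OF \<phi>'] using V by (simp add: borel_version_def)
  then have "AE z in unif \<Otimes>\<^sub>M unif. V (\<phi>' (fst z), \<phi>' (snd z)) = V' (\<phi>' (fst z), \<phi>' (snd z))"
    by (rule AE_distrD[rotated]) measurable
  moreover have "AE z in unif \<Otimes>\<^sub>M unif. W z = W' z" using W by (simp add: borel_version_def)
  ultimately show ?thesis using AE_unif2[OF \<phi>] by eventually_elim (auto simp: split_beta')
qed

lemma signal_diff_measurable: "(\<lambda>x. f' x - g' (\<phi>' x)) \<in> borel_measurable borel"
proof -
  have [measurable]: "f' \<in> borel_measurable borel" "g' \<in> borel_measurable borel"
    using versions_gs by (auto simp: borel_gs_def)
  note [measurable] = mp_measurable[OF \<phi>']
  show ?thesis by measurable
qed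

lemma signal_diff_bound: "\<bar>f' x - g' (\<phi>' x)\<bar> \<le> 2 * r"
  using abs_abs_diff_le[of "f' x" r "g' (\<phi>' x)"] versions_gs by (simp add: borel_gs_def)

lemma signal_diff_AE: "AE x in unif. f x - g (\<phi> x) = f' x - g' (\<phi>' x)"
proof -
  have "AE x in unif. g x = g' x" using V by (simp add: borel_version_def)
  from mp_AE[OF \<phi>' this] have "AE x in unif. g (\<phi>' x) = g' (\<phi>' x)" .
  moreover have "AE x in unif. f x = f' x" using W by (simp add: borel_version_def)
  ultimately show ?thesis using \<phi> by eventually_elim simp
qed

lemmas kernel_cut_norm_diff_le_iff = kernel_cut_norm_le_iff[OF kernel_diff_measurable kernel_diff_bound kernel_diff_AE]
lemmas kernel_cut_norm_diff_nonneg = kernel_cut_norm_nonneg[OF kernel_diff_measurable kernel_diff_bound kernel_diff_AE]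
lemmas signal_cut_norm_diff_le_L1 = signal_cut_norm_le_L1[OF signal_diff_measurable signal_diff_bound signal_diff_AE]
lemmas L1_diff_le_signal_cut_norm = L1_le_signal_cut_norm[OF signal_diff_measurable signal_diff_bound signal_diff_AE]

lemma signal_cut_norm_diff_nonneg: "0 \<le> signal_cut_norm (\<lambda>x. f x - g (\<phi> x))"
proof -
  have "0 \<le> (\<integral>x. \<bar>f' x - g' (\<phi>' x)\<bar> \<partial>unif)" by simp
  with L1_diff_le_signal_cut_norm show ?thesis by linarith
qed

end

lemma cut_distance_terms_nonneg:
  assumes "\<phi> \<in> ae_bij_measure_preserving"
  shows "0 \<le> kernel_cut_norm (\<lambda>(x, y). W (x, y) - V (\<phi> x, \<phi> y))" "0 \<le> signal_cut_norm (\<lambda>x. f x - g (\<phi> x))"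
  using ae_bij_borel_version[OF assms] kernel_cut_norm_diff_nonneg signal_cut_norm_diff_nonneg by blast+

lemma cut_distance_bdd:
  "bdd_below ((\<lambda>\<phi>. kernel_cut_norm (\<lambda>(x, y). W (x, y) - V (\<phi> x, \<phi> y)) + signal_cut_norm (\<lambda>x. f x - g (\<phi> x))) ` ae_bij_measure_preserving)"
  using cut_distance_terms_nonneg by (intro bdd_belowI[of _ 0]) force

lemma ae_bij_nonempty: "ae_bij_measure_preserving \<noteq> {}"
  using mp_iso_ae_bij[OF mp_iso_id] by blast

lemma cut_distance_nonneg: "0 \<le> cut_distance (W, f) (V, g)"
  unfolding cut_distance_def using cut_distance_terms_nonneg ae_bij_nonempty
  by (auto intro!: cINF_greatest add_nonneg_nonneg)

lemma cut_distance_le: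
  assumes "dist_le c W' f' V' g'"
  shows "cut_distance (W, f) (V, g) \<le> c"
proof -
  obtain \<phi> c1 where \<phi>: "mp_iso \<phi>" "cut_le unif (\<lambda>z. W' z - V' (\<phi> (fst z), \<phi> (snd z))) c1"
    "c1 + (\<integral>x. \<bar>f' x - g' (\<phi> x)\<bar> \<partial>unif) \<le> c" using assms by (auto simp: dist_le_def)
  let ?\<phi> = "\<lambda>x. clamp 0 1 (\<phi> x)"
  note m = mp_iso_mp[OF \<phi>(1)] and ae = clamp_mp_measure_preserving(3)[OF mp_iso_mp[OF \<phi>(1)]]
  have "cut_distance (W, f) (V, g) \<le>
    kernel_cut_norm (\<lambda>(x, y). W (x, y) - V (?\<phi> x, ?\<phi> y)) + signal_cut_norm (\<lambda>x. f x - g (?\<phi> x))"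
    unfolding cut_distance_def prod.case by (rule cINF_lower[OF cut_distance_bdd mp_iso_ae_bij[OF \<phi>(1)]])
  also have "\<dots> \<le> c1 + (\<integral>x. \<bar>f' x - g' (\<phi> x)\<bar> \<partial>unif)"
    using kernel_cut_norm_diff_le_iff[OF m ae] \<phi>(2) by (intro add_mono signal_cut_norm_diff_le_L1[OF m ae]) blast
  finally show ?thesis using \<phi>(3) by linarith
qed

text \<open>Both terms of the infimum are nonnegative, so each is below c for a suitable map; the
  factor 2 comes from replacing the signal cut norm by the L^1 norm.\<close>

lemma near_optimal_map:
  assumes "cut_distance (W, f) (V, g) < c"
  shows "\<exists>\<phi>. mp \<phi> \<and> cut_le unif (\<lambda>z. W' z - V' (\<phi> (fst z), \<phi> (snd z))) c \<and>
    (\<integral>x. \<bar>f' x - g' (\<phi> x)\<bar> \<partial>unif) \<le> 2 * c"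
proof -
  obtain \<phi> where \<phi>: "\<phi> \<in> ae_bij_measure_preserving" and lt:
    "kernel_cut_norm (\<lambda>(x, y). W (x, y) - V (\<phi> x, \<phi> y)) + signal_cut_norm (\<lambda>x. f x - g (\<phi> x)) < c"
    using assms unfolding cut_distance_def prod.case cINF_less_iff[OF ae_bij_nonempty cut_distance_bdd] by blast
  obtain \<phi>' where m: "mp \<phi>'" and ae: "AE x in unif. \<phi> x = \<phi>' x" using ae_bij_borel_version[OF \<phi>] by blast
  have "kernel_cut_norm (\<lambda>(x, y). W (x, y) - V (\<phi> x, \<phi> y)) \<le> c" "signal_cut_norm (\<lambda>x. f x - g (\<phi> x)) \<le> c"
    using lt cut_distance_terms_nonneg[OF \<phi>] by linarith+
  with kernel_cut_norm_diff_le_iff[OF m ae] L1_diff_le_signal_cut_norm[OF m ae] m show ?thesis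
    by (intro exI[of _ \<phi>']) auto
qed

text \<open>The counting lemma compares W' with the rearranged V', and rearrangement does not change
  the densities of V'.\<close>

lemma hom_density_diff_le:
  assumes r: "1 \<le> r" and c: "cut_distance (W, f) (V, g) < c" and E: "E \<subseteq> vertex_pairs k"
  shows "\<bar>hom_density k E d (W, f) - hom_density k E d (V, g)\<bar> \<le>
    r ^ (\<Sum>i\<in>{1..k}. d i) * (real (card E) * 4 + real (\<Sum>i\<in>{1..k}. d i) * 2) * c"
proof -
  obtain \<phi> where m: "mp \<phi>" and cut: "cut_le unif (\<lambda>z. W' z - V' (\<phi> (fst z), \<phi> (snd z))) c"
    and L1: "(\<integral>x. \<bar>f' x - g' (\<phi> x)\<bar> \<partial>unif) \<le> 2 * c" using near_optimal_map[OF c] by blast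
  let ?V = "\<lambda>z. V' (\<phi> (fst z), \<phi> (snd z))" and ?g = "\<lambda>x. g' (\<phi> x)"
  have gsV: "borel_gs r ?V ?g"
  proof -
    have [measurable]: "\<phi> \<in> borel_measurable borel" using m by (rule mp_measurable)
    have [measurable]: "V' \<in> borel_measurable (borel \<Otimes>\<^sub>M borel)" "g' \<in> borel_measurable borel"
      using versions_gs by (auto simp: borel_gs_def)
    have "?V \<in> borel_measurable (borel \<Otimes>\<^sub>M borel)" "?g \<in> borel_measurable borel" by measurable
    then show ?thesis using versions_gs(2) by (simp add: borel_gs_def)
  qed
  have "\<bar>hom_dens k E d W' f' - hom_dens k E d ?V ?g\<bar> \<le>
    r ^ (\<Sum>i\<in>{1..k}. d i) * (real (card E) * (4 * c) + real (\<Sum>i\<in>{1..k}. d i) * (\<integral>x. \<bar>f' x - ?g x\<bar> \<partial>unif))"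
    by (rule counting_lemma[OF r versions_gs(1) gsV E cut])
  also have "\<dots> \<le> r ^ (\<Sum>i\<in>{1..k}. d i) * (real (card E) * (4 * c) + real (\<Sum>i\<in>{1..k}. d i) * (2 * c))"
    using r by (intro mult_left_mono add_left_mono L1) (auto intro: sum_nonneg)
  also have "\<dots> = r ^ (\<Sum>i\<in>{1..k}. d i) * (real (card E) * 4 + real (\<Sum>i\<in>{1..k}. d i) * 2) * c"
    by (simp add: algebra_simps)
  finally show ?thesis
    unfolding hom_density_eq_hom_dens[OF W E] hom_density_eq_hom_dens[OF V E] hom_dens_mp[OF m versions_gs(2) E] .
qed

end

lemma simple_graph_on_iff: "simple_graph_on k E \<longleftrightarrow> E \<subseteq> vertex_pairs k"
  by (auto simp: simple_graph_on_def vertex_pairs_def)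

theorem corollary3p3:
  fixes r :: real
    and Wn :: "nat \<Rightarrow> real \<times> real \<Rightarrow> real" and fn :: "nat \<Rightarrow> real \<Rightarrow> real"
    and W :: "real \<times> real \<Rightarrow> real" and f :: "real \<Rightarrow> real"
  assumes "r > 1"
    and "\<And>n. (Wn n, fn n) \<in> graphon_signals r"
    and "(W, f) \<in> graphon_signals r"
  shows "(\<lambda>n. cut_distance (Wn n, fn n) (W, f)) \<longlonglongrightarrow> 0 \<longleftrightarrow>
    (\<forall>(k::nat) (E::nat set set) (d::nat \<Rightarrow> nat). simple_graph_on k E \<longrightarrow>
       (\<lambda>n. hom_density k E d (Wn n, fn n)) \<longlonglongrightarrow> hom_density k E d (W, f))"
proof -
  have r: "0 \<le> r" "1 \<le> r" using assms(1) by auto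
  obtain W' f' where v: "borel_version r W f W' f'"
    using borel_version_exists[OF r(1) assms(3)] by blast
  obtain Wn' fn' where vn: "\<And>n. borel_version r (Wn n) (fn n) (Wn' n) (fn' n)"
    using borel_version_exists[OF r(1) assms(2)] by metis
  show ?thesis
  proof (intro iffI allI impI)
    fix k E d assume lim: "(\<lambda>n. cut_distance (Wn n, fn n) (W, f)) \<longlonglongrightarrow> 0" and "simple_graph_on k E"
    then have E: "E \<subseteq> vertex_pairs k" by (simp add: simple_graph_on_iff)
    define C where "C = r ^ (\<Sum>i\<in>{1..k}. d i) * (real (card E) * 4 + real (\<Sum>i\<in>{1..k}. d i) * 2)"
    \<comment> \<open>The density bound asks for a number strictly above the cut distance; the
      summand 1 / Suc n supplies it and tends to 0.\<close>
    let ?c = "\<lambda>n. C * (cut_distance (Wn n, fn n) (W, f) + 1 / Suc n)"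
    have "?c \<longlonglongrightarrow> C * (0 + 0)"
      by (intro tendsto_intros lim LIMSEQ_Suc[OF lim_1_over_n])
    then have lim0: "?c \<longlonglongrightarrow> 0" by simp
    have bound: "norm (hom_density k E d (Wn n, fn n) - hom_density k E d (W, f)) \<le> ?c n" for n
      using hom_density_diff_le[OF vn v r(2) _ E, of n "cut_distance (Wn n, fn n) (W, f) + 1 / Suc n" d]
      by (simp add: C_def del: One_nat_def)
    have "(\<lambda>n. hom_density k E d (Wn n, fn n) - hom_density k E d (W, f)) \<longlonglongrightarrow> 0"
      by (rule Lim_null_comparison[OF always_eventually lim0]) (rule allI, rule bound)
    then show "(\<lambda>n. hom_density k E d (Wn n, fn n)) \<longlonglongrightarrow> hom_density k E d (W, f)" by (simp add: LIM_zero_iff)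
  next
    assume conv: "\<forall>k E d. simple_graph_on k E \<longrightarrow>
       (\<lambda>n. hom_density k E d (Wn n, fn n)) \<longlonglongrightarrow> hom_density k E d (W, f)"
    have conv': "(\<lambda>n. hom_dens k E d (Wn' n) (fn' n)) \<longlonglongrightarrow> hom_dens k E d W' f'"
      if E: "E \<subseteq> vertex_pairs k" for k E d
      unfolding hom_density_eq_hom_dens[OF v E, symmetric] hom_density_eq_hom_dens[OF vn E, symmetric]
      using conv E by (simp add: simple_graph_on_iff)
    show "(\<lambda>n. cut_distance (Wn n, fn n) (W, f)) \<longlonglongrightarrow> 0"
    proof (rule tendstoI)
      fix e :: real assume "0 < e"
      \<comment> \<open>Half of e, since the resulting bound on the cut distance is not
        strict.\<close>
      then have "\<forall>\<^sub>F n in sequentially. dist_le (e / 2) (Wn' n) (fn' n) W' f'"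
        using v vn by (intro eventually_dist_le[where r=r] conv') (auto simp: borel_version_def)
      then show "\<forall>\<^sub>F n in sequentially. dist (cut_distance (Wn n, fn n) (W, f)) 0 < e"
      proof eventually_elim
        case (elim n)
        from cut_distance_le[OF vn v elim] cut_distance_nonneg[OF vn v, of n] \<open>0 < e\<close>
        show ?case by (simp add: dist_real_def)
      qed
    qed
  qed
qed

end
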